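(* Let $A$ be a Dedekind domain or a field, $R$ an $A$-algebra and $P$ an $R$-module such that $(A,R,P)$ satisfies the standard hypotheses. Suppose that for every residue field $F$ of $A$ the natural map $F\otimes_A \mathrm{DEnd}_R(P)\to \mathrm{DEnd}_{R_F}(P_F)$ is surjective. Then for any $A$-algebra $B$ the natural map $$B^{\mathrm{op}}\otimes_A \mathrm{DEnd}_R(P)\to \mathrm{DEnd}_{R_B}(P_B)$$ is an isomorphism.
   Context: All modules are left modules. A residue field of $A$ is $A/\mathfrak m$ with $\mathfrak m$ a maximal ideal. For an $A$-algebra $B$, $B^{\mathrm{op}}$ is the opposite algebra, $R_B=B\otimes_A R$ and $P_B=B\otimes_A P$. $\mathrm{End}_R(P)$ is the ring of $R$-endomorphisms of $P$; the double centraliser ring $\mathrm{DEnd}_R(P)$ is the ring of maps $\sigma:P\to P$ with $\sigma\circ\alpha=\alpha\circ\sigma$ for all $\alpha\in\mathrm{End}_R(P)$, i.e. the endomorphism ring of $P$ regarded as an $\mathrm{End}_R(P)$-module. Standard hypotheses for $(A,R,P)$: (i) $R$ and $P$ are free of finite rank over $A$; (ii) $\mathrm{End}_R(P)$ is free of finite rank over $A$; (iii) for every $A$-algebra $B$ the natural map $\Psi_B:B^{\mathrm{op}}\otimes_A\mathrm{End}_R(P)\to\mathrm{End}_{R_B}(P_B)$, $\Psi_B(b\otimes\alpha)(b'\otimes p)=b'b\otimes\alpha(p)$, is an isomorphism. The natural map on double centralisers is the base change map for endomorphism algebras of the module $P$ over $\Lambda=\mathrm{End}_R(P)$, i.e.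 the map of the same form as $\Psi_B$ with $\Lambda$ in place of $R$, where $\mathrm{DEnd}_R(P)=\mathrm{End}_\Lambda(P)$ and the endomorphism algebra of $P_B$ over the base change of $\Lambda$ is identified with $\mathrm{DEnd}_{R_B}(P_B)$ by means of (iii). For commutative $B$ it sends $b\otimes\sigma$ to the map $b'\otimes p\mapsto b'b\otimes\sigma(p)$. *)

theory Defs
  imports "HOL-Algebra.Ring_Divisibility" "HOL-Algebra.Module" "HOL-Algebra.Free_Abelian_Groups"
begin

section \<open>Dedekind domains\<close>

text \<open>
  Integral closedness in the field of fractions is stated with denominators cleared: \<open>a / b\<close> is a
  zero of the monic polynomial \<open>X ^ n + \<Sum>i<n. c i * X ^ i\<close> iff \<open>b ^ n\<close> times the value is zero,
  and \<open>a / b\<close> lies in \<open>A\<close> iff \<open>a = q * b\<close> for some \<open>q\<close> in \<open>A\<close>.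
\<close>

locale dedekind_domain = noetherian_domain A for A (structure) +
  assumes integrally_closed:
      "\<lbrakk> a \<in> carrier A; b \<in> carrier A; b \<noteq> \<zero>; c \<in> {..<n::nat} \<rightarrow> carrier A;
         a [^] n \<oplus> (\<Oplus>i\<in>{..<n}. c i \<otimes> (a [^] i \<otimes> b [^] (n - i))) = \<zero> \<rbrakk>
       \<Longrightarrow> \<exists>q \<in> carrier A. a = q \<otimes> b"
    and nonzero_prime_maximal: "\<lbrakk> primeideal I A; I \<noteq> {\<zero>} \<rbrakk> \<Longrightarrow> maximalideal I A"

section \<open>Algebras and modules\<close>

text \<open>The library's \<open>algebra\<close> requires a commutative algebra and its \<open>module\<close> a commutative ring of
  scalars; the algebras here need not be commutative.\<close>

locale assoc_algebra = module A B + ring B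
  for A :: "('a, 'z) ring_scheme" (structure) and B :: "('a, 'b, 'u) module_scheme" (structure) +
  assumes smult_mult_left:
      "\<lbrakk> a \<in> carrier A; x \<in> carrier B; y \<in> carrier B \<rbrakk>
       \<Longrightarrow> (a \<odot>\<^bsub>B\<^esub> x) \<otimes>\<^bsub>B\<^esub> y = a \<odot>\<^bsub>B\<^esub> (x \<otimes>\<^bsub>B\<^esub> y)"
    and smult_mult_right:
      "\<lbrakk> a \<in> carrier A; x \<in> carrier B; y \<in> carrier B \<rbrakk>
       \<Longrightarrow> x \<otimes>\<^bsub>B\<^esub> (a \<odot>\<^bsub>B\<^esub> y) = a \<odot>\<^bsub>B\<^esub> (x \<otimes>\<^bsub>B\<^esub> y)"

locale left_module = R?: ring R + M?: abelian_group M
  for R :: "('r, 'z) ring_scheme" (structure) and M :: "('r, 'm, 'u) module_scheme" (structure) +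
  assumes smult_closed:
      "\<lbrakk> r \<in> carrier R; x \<in> carrier M \<rbrakk> \<Longrightarrow> r \<odot>\<^bsub>M\<^esub> x \<in> carrier M"
    and smult_l_distr:
      "\<lbrakk> r \<in> carrier R; s \<in> carrier R; x \<in> carrier M \<rbrakk>
       \<Longrightarrow> (r \<oplus> s) \<odot>\<^bsub>M\<^esub> x = r \<odot>\<^bsub>M\<^esub> x \<oplus>\<^bsub>M\<^esub> s \<odot>\<^bsub>M\<^esub> x"
    and smult_r_distr:
      "\<lbrakk> r \<in> carrier R; x \<in> carrier M; y \<in> carrier M \<rbrakk>
       \<Longrightarrow> r \<odot>\<^bsub>M\<^esub> (x \<oplus>\<^bsub>M\<^esub> y) = r \<odot>\<^bsub>M\<^esub> x \<oplus>\<^bsub>M\<^esub> r \<odot>\<^bsub>M\<^esub> y"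
    and smult_assoc:
      "\<lbrakk> r \<in> carrier R; s \<in> carrier R; x \<in> carrier M \<rbrakk>
       \<Longrightarrow> (r \<otimes> s) \<odot>\<^bsub>M\<^esub> x = r \<odot>\<^bsub>M\<^esub> (s \<odot>\<^bsub>M\<^esub> x)"
    and smult_one: "x \<in> carrier M \<Longrightarrow> \<one> \<odot>\<^bsub>M\<^esub> x = x"

definition left_module_hom ::
    "('r, 'z) ring_scheme \<Rightarrow> ('r, 'm, 'u) module_scheme \<Rightarrow> ('r, 'n, 'v) module_scheme \<Rightarrow> ('m \<Rightarrow> 'n) set"
  where "left_module_hom R M N =
    {f \<in> carrier M \<rightarrow> carrier N.
       (\<forall>x \<in> carrier M. \<forall>y \<in> carrier M. f (x \<oplus>\<^bsub>M\<^esub> y) = f x \<oplus>\<^bsub>N\<^esub> f y) \<and>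
       (\<forall>r \<in> carrier R. \<forall>x \<in> carrier M. f (r \<odot>\<^bsub>M\<^esub> x) = r \<odot>\<^bsub>N\<^esub> f x)}"

definition left_module_iso ::
    "('r, 'z) ring_scheme \<Rightarrow> ('r, 'm, 'u) module_scheme \<Rightarrow> ('r, 'n, 'v) module_scheme \<Rightarrow> ('m \<Rightarrow> 'n) set"
  where "left_module_iso R M N =
    {f \<in> left_module_hom R M N. bij_betw f (carrier M) (carrier N)}"

definition free_of_finite_rank ::
    "('a, 'z) ring_scheme \<Rightarrow> ('a, 'm, 'u) module_scheme \<Rightarrow> bool"
  where "free_of_finite_rank A M \<longleftrightarrow>
    (\<exists>(n::nat) e. e \<in> {..<n} \<rightarrow> carrier M \<and>
       (\<forall>x \<in> carrier M. \<exists>!c. c \<in> {..<n} \<rightarrow>\<^sub>E carrier A \<and> x = (\<Oplus>\<^bsub>M\<^esub>i\<in>{..<n}. c i \<odot>\<^bsub>M\<^esub> e i)))"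

definition opposite :: "('a, 'b) module \<Rightarrow> ('a, 'b) module"
  where "opposite B = B\<lparr>monoid.mult := \<lambda>x y. y \<otimes>\<^bsub>B\<^esub> x\<rparr>"

text \<open>The \<open>A\<close>-module underlying a module over the \<open>A\<close>-algebra \<open>R\<close>.\<close>

definition restrict_scalars :: "('a, 'r) module \<Rightarrow> ('r, 'p) module \<Rightarrow> ('a, 'p) module"
  where "restrict_scalars R P =
    \<lparr>carrier = carrier P, monoid.mult = monoid.mult P,
     monoid.one = monoid.one P, ring.zero = ring.zero P, ring.add = ring.add P,
     smult = (\<lambda>a p. (a \<odot>\<^bsub>R\<^esub> \<one>\<^bsub>R\<^esub>) \<odot>\<^bsub>P\<^esub> p)\<rparr>"

definition residue_algebra :: "('a, 'z) ring_scheme \<Rightarrow> 'a set \<Rightarrow> ('a, 'a set) module"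
  where "residue_algebra A m =
    \<lparr>carrier = carrier (A Quot m), monoid.mult = monoid.mult (A Quot m),
     monoid.one = monoid.one (A Quot m), ring.zero = ring.zero (A Quot m), ring.add = ring.add (A Quot m),
     smult = (\<lambda>a u. (m +>\<^bsub>A\<^esub> a) \<otimes>\<^bsub>A Quot m\<^esub> u)\<rparr>"

section \<open>Endomorphism algebras and double centralisers\<close>

text \<open>Endomorphisms are extensional functions, so that they are determined by their values on the
  carrier of \<open>P\<close>. The argument \<open>R\<close> carries the \<open>A\<close>-algebra structure.\<close>

definition End_alg :: "('a, 'r) module \<Rightarrow> ('r, 'p) module \<Rightarrow> ('a, 'p \<Rightarrow> 'p) module"
  where "End_alg R P =
    \<lparr>carrier = left_module_hom R P P \<inter> extensional (carrier P),
     monoid.mult = (\<lambda>f g. compose (carrier P) f g),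
     monoid.one = (\<lambda>x\<in>carrier P. x),
     ring.zero = (\<lambda>x\<in>carrier P. \<zero>\<^bsub>P\<^esub>),
     ring.add = (\<lambda>f g. \<lambda>x\<in>carrier P. f x \<oplus>\<^bsub>P\<^esub> g x),
     smult = (\<lambda>a f. \<lambda>x\<in>carrier P. (a \<odot>\<^bsub>R\<^esub> \<one>\<^bsub>R\<^esub>) \<odot>\<^bsub>P\<^esub> f x)\<rparr>"

text \<open>\<open>P\<close> regarded as a module over a ring of endomorphisms of \<open>P\<close>.\<close>

definition eval_module :: "('r, 'p) module \<Rightarrow> ('p \<Rightarrow> 'p, 'p) module"
  where "eval_module P =
    \<lparr>carrier = carrier P, monoid.mult = monoid.mult P,
     monoid.one = monoid.one P, ring.zero = ring.zero P, ring.add = ring.add P,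
     smult = (\<lambda>f p. f p)\<rparr>"

definition DEnd_alg :: "('a, 'r) module \<Rightarrow> ('r, 'p) module \<Rightarrow> ('a, 'p \<Rightarrow> 'p) module"
  where "DEnd_alg R P = End_alg (End_alg R P) (eval_module P)"

section \<open>Tensor products\<close>

text \<open>The tensor product of two \<open>A\<close>-modules is the free Abelian group on the set of pairs modulo the
  subgroup generated by the relators of \<open>A\<close>-balanced biadditive maps.\<close>

type_synonym ('m, 'n) tensor = "(('m \<times> 'n) \<Rightarrow>\<^sub>0 int) set"

definition tensor_relators ::
    "('a, 'z) ring_scheme \<Rightarrow> ('a, 'm) module \<Rightarrow> ('a, 'n) module \<Rightarrow> (('m \<times> 'n) \<Rightarrow>\<^sub>0 int) set"
  where "tensor_relators A M N =
    {frag_of (x \<oplus>\<^bsub>M\<^esub> x', y) - frag_of (x, y) - frag_of (x', y) | x x' y.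
       x \<in> carrier M \<and> x' \<in> carrier M \<and> y \<in> carrier N} \<union>
    {frag_of (x, y \<oplus>\<^bsub>N\<^esub> y') - frag_of (x, y) - frag_of (x, y') | x y y'.
       x \<in> carrier M \<and> y \<in> carrier N \<and> y' \<in> carrier N} \<union>
    {frag_of (a \<odot>\<^bsub>M\<^esub> x, y) - frag_of (x, a \<odot>\<^bsub>N\<^esub> y) | a x y.
       a \<in> carrier A \<and> x \<in> carrier M \<and> y \<in> carrier N}"

definition tensor_kernel ::
    "('a, 'z) ring_scheme \<Rightarrow> ('a, 'm) module \<Rightarrow> ('a, 'n) module \<Rightarrow> ('m, 'n) tensor"
  where "tensor_kernel A M N =
    generate (free_Abelian_group (carrier M \<times> carrier N)) (tensor_relators A M N)"

definition tensor_group ::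
    "('a, 'z) ring_scheme \<Rightarrow> ('a, 'm) module \<Rightarrow> ('a, 'n) module \<Rightarrow> ('m, 'n) tensor monoid"
  where "tensor_group A M N =
    free_Abelian_group (carrier M \<times> carrier N) Mod tensor_kernel A M N"

definition pure_tensor ::
    "('a, 'z) ring_scheme \<Rightarrow> ('a, 'm) module \<Rightarrow> ('a, 'n) module \<Rightarrow> 'm \<Rightarrow> 'n \<Rightarrow> ('m, 'n) tensor"
  where "pure_tensor A M N x y =
    tensor_kernel A M N #>\<^bsub>free_Abelian_group (carrier M \<times> carrier N)\<^esub> frag_of (x, y)"

text \<open>\<open>tensor_lift G g\<close> is the homomorphism to the Abelian group \<open>G\<close> induced by the balanced
  biadditive map \<open>g\<close>. For such \<open>g\<close> the value does not depend on the representative chosen.\<close>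

definition tensor_lift :: "('g, 'z) monoid_scheme \<Rightarrow> ('m \<Rightarrow> 'n \<Rightarrow> 'g) \<Rightarrow> ('m, 'n) tensor \<Rightarrow> 'g"
  where "tensor_lift G g u =
    (let c = (SOME c. c \<in> u)
     in finprod G (\<lambda>(x, y). g x y [^]\<^bsub>G\<^esub> Poly_Mapping.lookup c (x, y)) (Poly_Mapping.keys c))"

text \<open>The biadditive extension of \<open>(x \<otimes> y, x' \<otimes> y') \<mapsto> f x x' \<otimes> g y y'\<close>, with values in \<open>M \<otimes> N\<close>.\<close>

definition tensor_pairing ::
    "('a, 'z) ring_scheme \<Rightarrow> ('a, 'm) module \<Rightarrow> ('a, 'n) module \<Rightarrow>
     ('x \<Rightarrow> 'm \<Rightarrow> 'm) \<Rightarrow> ('y \<Rightarrow> 'n \<Rightarrow> 'n) \<Rightarrow> ('x, 'y) tensor \<Rightarrow> ('m, 'n) tensor \<Rightarrow> ('m, 'n) tensor"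
  where "tensor_pairing A M N f g u w =
    tensor_lift (tensor_group A M N) (\<lambda>x y.
      tensor_lift (tensor_group A M N) (\<lambda>x' y'. pure_tensor A M N (f x x') (g y y')) w) u"

text \<open>\<open>B \<otimes>\<^sub>A R\<close> as an \<open>A\<close>-algebra.\<close>

definition tensor_algebra ::
    "('a, 'z) ring_scheme \<Rightarrow> ('a, 'b) module \<Rightarrow> ('a, 'r) module \<Rightarrow> ('a, ('b, 'r) tensor) module"
  where "tensor_algebra A B R =
    \<lparr>carrier = carrier (tensor_group A B R),
     monoid.mult = tensor_pairing A B R (monoid.mult B) (monoid.mult R),
     monoid.one = pure_tensor A B R \<one>\<^bsub>B\<^esub> \<one>\<^bsub>R\<^esub>,
     ring.zero = monoid.one (tensor_group A B R),
     ring.add = monoid.mult (tensor_group A B R),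
     smult = (\<lambda>a. tensor_lift (tensor_group A B R) (\<lambda>b r. pure_tensor A B R (a \<odot>\<^bsub>B\<^esub> b) r))\<rparr>"

text \<open>\<open>B \<otimes>\<^sub>A P\<close> as a module over \<open>B \<otimes>\<^sub>A R\<close>, where \<open>P\<close> is an \<open>R\<close>-module. The fields \<open>mult\<close> and
  \<open>one\<close> of a module record have no meaning.\<close>

definition tensor_module ::
    "('a, 'z) ring_scheme \<Rightarrow> ('a, 'b) module \<Rightarrow> ('a, 'r) module \<Rightarrow> ('r, 'p) module \<Rightarrow>
     (('b, 'r) tensor, ('b, 'p) tensor) module"
  where "tensor_module A B R P =
    \<lparr>carrier = carrier (tensor_group A B (restrict_scalars R P)),
     monoid.mult = undefined,
     monoid.one = undefined,
     ring.zero = monoid.one (tensor_group A B (restrict_scalars R P)),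
     ring.add = monoid.mult (tensor_group A B (restrict_scalars R P)),
     smult = tensor_pairing A B (restrict_scalars R P) (monoid.mult B) (smult P)\<rparr>"

section \<open>Base change maps\<close>

text \<open>\<open>\<Psi>\<^sub>B (b \<otimes> \<alpha>) (b' \<otimes> p) = b'b \<otimes> \<alpha> p\<close>\<close>

definition Psi ::
    "('a, 'z) ring_scheme \<Rightarrow> ('a, 'b) module \<Rightarrow> ('a, 'r) module \<Rightarrow> ('r, 'p) module \<Rightarrow>
     ('b, 'p \<Rightarrow> 'p) tensor \<Rightarrow> ('b, 'p) tensor \<Rightarrow> ('b, 'p) tensor"
  where "Psi A B R P u =
    (\<lambda>w \<in> carrier (tensor_module A B R P).
       tensor_pairing A B (restrict_scalars R P) (\<lambda>b b'. b' \<otimes>\<^bsub>B\<^esub> b) (\<lambda>\<alpha> p. \<alpha> p) u w)"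

text \<open>The last condition is meant for all \<open>A\<close>-algebras \<open>B\<close>. HOL cannot quantify over types inside a
  formula, so the type of the elements of \<open>B\<close> is a parameter.\<close>

definition standard_hypotheses ::
    "'b itself \<Rightarrow> ('a, 'z) ring_scheme \<Rightarrow> ('a, 'r) module \<Rightarrow> ('r, 'p) module \<Rightarrow> bool"
  where "standard_hypotheses _ A R P \<longleftrightarrow>
    free_of_finite_rank A R \<and>
    free_of_finite_rank A (restrict_scalars R P) \<and>
    free_of_finite_rank A (End_alg R P) \<and>
    (\<forall>B :: ('a, 'b) module. assoc_algebra A B \<longrightarrow>
       Psi A B R P \<in>
         left_module_iso A (tensor_algebra A (opposite B) (End_alg R P))
           (End_alg (tensor_algebra A B R) (tensor_module A B R P)) \<inter>
         ring_iso (tensor_algebra A (opposite B) (End_alg R P))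
           (End_alg (tensor_algebra A B R) (tensor_module A B R P)))"

text \<open>
  The natural map on double centralisers. Let \<open>\<Lambda> = End\<^sub>R(P)\<close>. If \<open>\<Psi>\<^sub>B\<close> is an isomorphism, it
  identifies \<open>End (P\<^sub>B)\<close> over \<open>R\<^sub>B\<close> with \<open>B\<^sup>o\<^sup>p \<otimes> \<Lambda>\<close>, the base change of \<open>\<Lambda>\<close> along \<open>B\<^sup>o\<^sup>p\<close>,
  so the map is \<open>\<Psi>\<close> for \<open>\<Lambda>\<close> and the algebra \<open>B\<^sup>o\<^sup>p\<close>: it sends \<open>b \<otimes> \<sigma>\<close> to \<open>b' \<otimes> p \<mapsto> bb' \<otimes> \<sigma> p\<close>, products being taken in \<open>B\<close>. (For noncommutative \<open>B\<close>
  right multiplication by \<open>b\<close> need not commute with \<open>End (P\<^sub>B)\<close>, which contains all right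
  multiplications.) The modules \<open>B \<otimes> P\<close> and \<open>B\<^sup>o\<^sup>p \<otimes> P\<close>, and likewise \<open>B\<^sup>o\<^sup>p \<otimes> DEnd(P)\<close> and
  \<open>B \<otimes> DEnd(P)\<close>, have the same underlying \<open>A\<close>-module. As regards multiplication, the map is a
  homomorphism on \<open>B \<otimes> DEnd(P)\<close>.
\<close>

definition DEnd_map ::
    "('a, 'z) ring_scheme \<Rightarrow> ('a, 'b) module \<Rightarrow> ('a, 'r) module \<Rightarrow> ('r, 'p) module \<Rightarrow>
     ('b, 'p \<Rightarrow> 'p) tensor \<Rightarrow> ('b, 'p) tensor \<Rightarrow> ('b, 'p) tensor"
  where "DEnd_map A B R P = Psi A (opposite B) (End_alg R P) (eval_module P)"

end

(* In a basis of P, an element of the double centraliser of P_B is a matrix with entries in B that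
   commutes with the matrices of all endomorphisms of P, that is, a solution in B of a homogeneous
   linear system with coefficients in A. Surjectivity over the residue field of m says that every
   solution modulo m lifts to a solution in A. Hence Gaussian elimination with pivots outside m
   ends with the zero system, and some s outside m times the identity on the span of the relations
   extends to an A-linear map from the space of all matrices to that span. Such s form an ideal contained in no maximal ideal, so s = 1 is
   possible: the relations are a direct summand. The complementary projection writes every solution
   in B as a combination, with its own entries as coefficients, of finitely many solutions in A,
   and this gives the inverse of the base change map. *)
theory Submission
  imports Defs
begin

section \<open>Linear equations over a domain\<close>

text \<open>Elimination can only stop at the zero system: when every coefficient lies in
  \<open>m\<close>, every vector is a solution modulo \<open>m\<close>, so the unit vectors lift to
  solutions over the base ring. The lifts form a matrix congruent to the identity modulo
  \<open>m\<close>, hence nonsingular over the domain, and only the zero relation annihilates them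
  all. Denominators are cleared at every step, so neither localisations nor determinants are formed.

  The system to which this is applied is the set \<open>\<Phi>\<close> of all relations over
  \<open>A\<close> satisfied by the double centraliser matrices of P and also by those of P_B. It
  contains the commutation relations, so a vector over \<open>A\<close> orthogonal to it is a double
  centraliser matrix; by its definition it annihilates the matrices over \<open>B\<close>, which are
  therefore fixed by the complementary projection.

  For noncommutative \<open>B\<close> the endomorphisms of P_B include the right multiplications by
  \<open>B\<close>. An element of the double centraliser commutes with these, hence is determined by
  its values on the elements 1 \<otimes> e_a, that is, by a matrix over \<open>B\<close>.\<close>

definition (in ring) dot :: "'i set \<Rightarrow> ('i \<Rightarrow> 'a) \<Rightarrow> ('i \<Rightarrow> 'a) \<Rightarrow> 'a"
  where "dot I c x = (\<Oplus>i\<in>I. c i \<otimes> x i)"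

lemma (in cring) dot_closed [simp]:
  "\<lbrakk> c \<in> I \<rightarrow> carrier R; x \<in> I \<rightarrow> carrier R \<rbrakk> \<Longrightarrow> dot I c x \<in> carrier R"
  unfolding dot_def by (rule finsum_closed) auto

lemma (in cring) dot_commute:
  "\<lbrakk> c \<in> I \<rightarrow> carrier R; x \<in> I \<rightarrow> carrier R \<rbrakk> \<Longrightarrow> dot I c x = dot I x c"
  unfolding dot_def by (rule finsum_cong') (auto simp: Pi_iff m_comm)

lemma (in cring) dot_cong:
  "\<lbrakk> \<And>i. i \<in> I \<Longrightarrow> c i = d i; \<And>i. i \<in> I \<Longrightarrow> x i = y i; d \<in> I \<rightarrow> carrier R; y \<in> I \<rightarrow> carrier R \<rbrakk>
   \<Longrightarrow> dot I c x = dot I d y"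
  unfolding dot_def by (rule finsum_cong') (auto simp: Pi_iff)

lemma (in cring) dot_insert:
  "\<lbrakk> finite I; k \<notin> I; c \<in> insert k I \<rightarrow> carrier R; x \<in> insert k I \<rightarrow> carrier R \<rbrakk>
   \<Longrightarrow> dot (insert k I) c x = c k \<otimes> x k \<oplus> dot I c x"
  unfolding dot_def by (rule finsum_insert) (auto simp: Pi_iff)

lemma (in cring) dot_lincomb_right:
  assumes "finite I" "c \<in> I \<rightarrow> carrier R" "x \<in> I \<rightarrow> carrier R" "y \<in> I \<rightarrow> carrier R"
    and a: "a \<in> carrier R" "b \<in> carrier R"
  shows "dot I c (\<lambda>i. a \<otimes> x i \<oplus> b \<otimes> y i) = a \<otimes> dot I c x \<oplus> b \<otimes> dot I c y"
  using assms(1-4)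
proof (induction I rule: finite_induct)
  case empty
  then show ?case using a by (simp add: dot_def)
next
  case (insert k I)
  have mem: "c k \<in> carrier R" "x k \<in> carrier R" "y k \<in> carrier R" "dot I c x \<in> carrier R" "dot I c y \<in> carrier R"
    using insert.prems by (auto intro: dot_closed)
  have "dot (insert k I) c (\<lambda>i. a \<otimes> x i \<oplus> b \<otimes> y i)
      = c k \<otimes> (a \<otimes> x k \<oplus> b \<otimes> y k) \<oplus> (a \<otimes> dot I c x \<oplus> b \<otimes> dot I c y)"
    using insert a by (subst dot_insert) (auto simp: Pi_iff)
  also have "\<dots> = a \<otimes> (c k \<otimes> x k \<oplus> dot I c x) \<oplus> b \<otimes> (c k \<otimes> y k \<oplus> dot I c y)"
    using mem a by (simp add: r_distr l_distr m_ac a_ac)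
  finally show ?case using insert by (simp add: dot_insert)
qed

lemma (in cring) dot_lincomb_left:
  assumes "finite I" "c \<in> I \<rightarrow> carrier R" "d \<in> I \<rightarrow> carrier R" "x \<in> I \<rightarrow> carrier R"
    and "a \<in> carrier R" "b \<in> carrier R"
  shows "dot I (\<lambda>i. a \<otimes> c i \<oplus> b \<otimes> d i) x = a \<otimes> dot I c x \<oplus> b \<otimes> dot I d x"
proof -
  have "dot I (\<lambda>i. a \<otimes> c i \<oplus> b \<otimes> d i) x = dot I x (\<lambda>i. a \<otimes> c i \<oplus> b \<otimes> d i)"
    using assms by (intro dot_commute) (auto simp: Pi_iff)
  then show ?thesis
    using assms by (simp add: dot_lincomb_right dot_commute[of x I])
qed

text \<open>Modulo the prime ideal \<open>m\<close> the matrix \<open>w\<close> is diagonal with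
  nonzero diagonal entries, so its determinant is nonzero, and over a domain this forces
  \<open>c\<close> to vanish. Elimination replaces the determinant.\<close>

lemma (in domain) diagonal_mod_prime_elim:
  assumes "primeideal m R" "finite I" "c \<in> I \<rightarrow> carrier R"
    and "\<And>j. j \<in> I \<Longrightarrow> w j \<in> I \<rightarrow> carrier R"
    and "\<And>i j. i \<in> I \<Longrightarrow> j \<in> I \<Longrightarrow> i \<noteq> j \<Longrightarrow> w j i \<in> m"
    and "\<And>j. j \<in> I \<Longrightarrow> w j j \<notin> m"
    and "\<And>j. j \<in> I \<Longrightarrow> dot I c (w j) = \<zero>"
    and "i \<in> I"
  shows "c i = \<zero>"
  using assms(2-)
proof (induction I arbitrary: w i rule: finite_induct)
  case empty
  then show ?case by simp
next
  case (insert k I)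
  interpret m: primeideal m R by fact
  \<comment> \<open>Column \<open>k\<close> is cleared with pivot \<open>w k k\<close>, without
    division. The new diagonal entry differs from \<open>w k k \<otimes> w j j\<close> by an element
    of \<open>m\<close>, so primeness keeps it outside \<open>m\<close> and the hypotheses survive
    on \<open>I\<close>.\<close>
  define w' where "w' j i = w k k \<otimes> w j i \<oplus> (\<ominus> w j k) \<otimes> w k i" for j i
  have wc: "w j i \<in> carrier R" if "j \<in> insert k I" "i \<in> insert k I" for i j
    using insert.prems(2) that by blast
  have ck: "c k \<in> carrier R" and cI: "c \<in> I \<rightarrow> carrier R" using insert.prems(1) by auto
  have w'k: "w' j k = \<zero>" if "j \<in> I" for j
    using wc that by (simp add: w'_def l_minus m_comm[of "w k k" "w j k"] r_neg)
  have zero: "c i = \<zero>" if i: "i \<in> I" for i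
  proof (rule insert.IH)
    show "i \<in> I" "c \<in> I \<rightarrow> carrier R" by fact+
    show "w' j \<in> I \<rightarrow> carrier R" if "j \<in> I" for j using wc that by (auto simp: w'_def)
    show "w' j i \<in> m" if "i \<in> I" "j \<in> I" "i \<noteq> j" for i j
    proof -
      have "w j i \<in> m" "w k i \<in> m" using insert.prems(3) that insert.hyps by auto
      then show ?thesis using wc that unfolding w'_def
        by (intro m.a_closed m.I_l_closed) auto
    qed
    show "w' j j \<notin> m" if "j \<in> I" for j
    proof
      assume a: "w' j j \<in> m"
      have "w j k \<in> m" "w k j \<in> m" using insert.prems(3) that insert.hyps by auto
      then have b: "w j k \<otimes> w k j \<in> m" using wc that by (intro m.I_l_closed) auto
      have "w k k \<otimes> w j j = w' j j \<oplus> w j k \<otimes> w k j"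
        using wc that by (simp add: w'_def l_minus r_neg a_assoc l_neg)
      then have "w k k \<otimes> w j j \<in> m" using a b by (simp add: m.a_closed)
      then show False using m.I_prime[of "w k k" "w j j"] wc that insert.prems(4)[of k] insert.prems(4)[of j] by auto
    qed
    show "dot I c (w' j) = \<zero>" if j: "j \<in> I" for j
    proof -
      have "w k k \<otimes> dot (insert k I) c (w j) \<oplus> (\<ominus> w j k) \<otimes> dot (insert k I) c (w k) = dot (insert k I) c (w' j)"
        unfolding w'_def by (rule dot_lincomb_right[symmetric]) (use insert.hyps insert.prems(1,2) j wc in auto)
      then have "dot (insert k I) c (w' j) = \<zero>" using insert.prems(5) j wc by simp
      moreover have w'c: "w' j \<in> insert k I \<rightarrow> carrier R" using wc j by (auto simp: w'_def)
      moreover have "dot (insert k I) c (w' j) = c k \<otimes> w' j k \<oplus> dot I c (w' j)"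
        using insert.hyps insert.prems(1) w'c by (intro dot_insert)
      moreover have "dot I c (w' j) \<in> carrier R" using w'c cI by (intro dot_closed) auto
      ultimately show ?thesis using ck w'k[OF j] by simp
    qed
  qed
  have "dot I c (w k) = \<zero>"
  proof -
    have "dot I c (w k) = dot I (\<lambda>_. \<zero>) (w k)" using zero wc by (intro dot_cong) auto
    also have "\<dots> = (\<Oplus>i\<in>I. \<zero>)" unfolding dot_def using wc by (intro finsum_cong') auto
    finally show ?thesis by (simp add: finsum_zero)
  qed
  moreover have "dot (insert k I) c (w k) = \<zero>" using insert.prems(5) by simp
  ultimately have "c k \<otimes> w k k = \<zero>"
    using dot_insert[of I k c "w k"] insert.hyps insert.prems(1) insert.prems(2)[of k] wc[of k k] ck by simp
  moreover have "w k k \<noteq> \<zero>" using insert.prems(4)[of k] m.zero_closed by auto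
  ultimately have "c k = \<zero>" using integral[of "c k" "w k k"] ck wc by auto
  then show ?case using zero insert.prems(6) by auto
qed

text \<open>The closure hypothesis is binary; nonemptiness of \<open>\<Phi>\<close> supplies the
  zero relation for the empty sum.\<close>

lemma (in cring) lincomb_sum_closed:
  assumes Phi: "\<Phi> \<subseteq> UNIV \<rightarrow> carrier R" "\<Phi> \<noteq> {}"
    and lin: "\<And>c d a b. \<lbrakk> c \<in> \<Phi>; d \<in> \<Phi>; a \<in> carrier R; b \<in> carrier R \<rbrakk> \<Longrightarrow> (\<lambda>i. a \<otimes> c i \<oplus> b \<otimes> d i) \<in> \<Phi>"
    and "finite J" "\<And>l. l \<in> J \<Longrightarrow> T l \<in> \<Phi>" "a \<in> J \<rightarrow> carrier R"
  shows "(\<lambda>j. \<Oplus>l\<in>J. a l \<otimes> T l j) \<in> \<Phi>"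
  using assms(4-)
proof (induction J rule: finite_induct)
  case empty
  obtain c where c: "c \<in> \<Phi>" using Phi by auto
  then have "(\<lambda>i. \<zero> \<otimes> c i \<oplus> \<zero> \<otimes> c i) \<in> \<Phi>" by (intro lin) auto
  moreover have "(\<lambda>i. \<zero> \<otimes> c i \<oplus> \<zero> \<otimes> c i) = (\<lambda>j. \<Oplus>l\<in>{}. a l \<otimes> T l j)"
    using c Phi by (auto simp: fun_eq_iff Pi_iff subset_iff)
  ultimately show ?case by simp
next
  case (insert k J)
  have T: "T l j \<in> carrier R" if "l \<in> insert k J" for l j using insert.prems(1)[OF that] Phi by (auto simp: Pi_iff)
  have "(\<lambda>j. a k \<otimes> T k j \<oplus> \<one> \<otimes> (\<Oplus>l\<in>J. a l \<otimes> T l j)) \<in> \<Phi>"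
    using insert by (intro lin) auto
  moreover have "(\<lambda>j. a k \<otimes> T k j \<oplus> \<one> \<otimes> (\<Oplus>l\<in>J. a l \<otimes> T l j)) = (\<lambda>j. \<Oplus>l\<in>insert k J. a l \<otimes> T l j)"
  proof
    fix j
    have "(\<Oplus>l\<in>J. a l \<otimes> T l j) \<in> carrier R" using T insert.prems(2) by (intro finsum_closed) auto
    then show "a k \<otimes> T k j \<oplus> \<one> \<otimes> (\<Oplus>l\<in>J. a l \<otimes> T l j) = (\<Oplus>l\<in>insert k J. a l \<otimes> T l j)"
      using T insert by (subst finsum_insert) (auto simp: Pi_iff)
  qed
  ultimately show ?case by simp
qed

lemma (in cring) dot_in_ideal:
  assumes "ideal m R" "finite I" "\<And>i. i \<in> I \<Longrightarrow> c i \<in> m" "x \<in> I \<rightarrow> carrier R"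
  shows "dot I c x \<in> m"
  using assms(2-)
proof (induction I rule: finite_induct)
  case empty
  then show ?case using ideal.axioms(1)[OF assms(1)] by (simp add: dot_def additive_subgroup.zero_closed)
next
  case (insert k I)
  interpret m: ideal m R by fact
  have "c k \<otimes> x k \<in> m" "dot I c x \<in> m" using insert by (auto intro: m.I_r_closed)
  then show ?case using insert by (subst dot_insert) (auto intro: m.a_closed m.a_Hcarr)
qed

lemma (in cring) inverse_mod_maximalideal:
  assumes "maximalideal m R" "u \<in> carrier R" "u \<notin> m"
  obtains z where "z \<in> carrier R" "\<one> \<ominus> u \<otimes> z \<in> m"
proof -
  interpret m: maximalideal m R by fact
  let ?J = "m <+>\<^bsub>R\<^esub> PIdl u"
  have J: "ideal ?J R" by (rule add_ideals[OF m.is_ideal cgenideal_ideal[OF assms(2)]])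
  have mJ: "m \<subseteq> ?J"
  proof
    fix a assume a: "a \<in> m"
    then have "a = a \<oplus> \<zero> \<otimes> u" using assms(2) m.Icarr by simp
    moreover have "\<zero> \<otimes> u \<in> PIdl u" unfolding cgenideal_def by auto
    ultimately show "a \<in> ?J" using a unfolding set_add_def' by blast
  qed
  have "u = \<zero> \<oplus> u" "u \<in> PIdl u" using assms(2) cgenideal_self by auto
  then have uJ: "u \<in> ?J" using m.zero_closed unfolding set_add_def' by blast
  have "?J = carrier R"
    using m.I_maximal[OF J mJ] uJ assms ideal.Icarr[OF J] by blast
  then have "\<one> \<in> ?J" by simp
  then obtain a z where az: "a \<in> m" "z \<in> carrier R" "\<one> = a \<oplus> z \<otimes> u"
    by (auto simp: set_add_def' cgenideal_def)
  have "a \<in> carrier R" using az by auto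
  then have "\<one> \<ominus> u \<otimes> z = a" using az assms by (simp add: minus_eq m_comm[of u z] a_assoc r_neg)
  then show ?thesis using that az by simp
qed

text \<open>The hypothesis \<open>lift\<close> says that every solution modulo \<open>m\<close> of the system \<open>\<Phi>\<close> is the reduction of a
  solution. The conclusion says that, after inverting \<open>s\<close>, the span of \<open>\<Phi>\<close> is a direct summand,
  with projection matrix \<open>T / s\<close>; it is obtained by Gaussian elimination with pivots outside \<open>m\<close>.\<close>

lemma (in domain) splitting_outside_maximalideal:
  assumes m: "maximalideal m R" and "finite I"
    and "\<Phi> \<subseteq> UNIV \<rightarrow> carrier R" "\<Phi> \<noteq> {}"
    and "\<And>c d a b. \<lbrakk> c \<in> \<Phi>; d \<in> \<Phi>; a \<in> carrier R; b \<in> carrier R \<rbrakk> \<Longrightarrow> (\<lambda>i. a \<otimes> c i \<oplus> b \<otimes> d i) \<in> \<Phi>"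
    and lift: "\<And>x. \<lbrakk> x \<in> UNIV \<rightarrow> carrier R; \<And>c. c \<in> \<Phi> \<Longrightarrow> dot I c x \<in> m \<rbrakk>
       \<Longrightarrow> \<exists>w \<in> UNIV \<rightarrow> carrier R. (\<forall>c\<in>\<Phi>. dot I c w = \<zero>) \<and> (\<forall>i\<in>I. w i \<ominus> x i \<in> m)"
  shows "\<exists>s T. s \<in> carrier R \<and> s \<notin> m \<and> (\<forall>i\<in>I. T i \<in> \<Phi>) \<and>
     (\<forall>c\<in>\<Phi>. \<forall>j\<in>I. dot I c (\<lambda>i. T i j) = s \<otimes> c j)"
  using assms(2-)
proof (induction I arbitrary: \<Phi> rule: finite_psubset_induct)
  case (psubset I)
  note Phi = psubset.prems(1) and ne = psubset.prems(2) and lin = psubset.prems(3) and lift = psubset.prems(4)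
  interpret m: maximalideal m R by fact
  have prime: "primeideal m R" using m maximalideal_prime by blast
  have one: "\<one> \<notin> m" using m.I_notcarr m.one_imp_carrier by blast
  have Phic: "c i \<in> carrier R" if "c \<in> \<Phi>" for c i using that Phi by auto
  show ?case
  proof (cases "\<exists>c\<in>\<Phi>. \<exists>i\<in>I. c i \<notin> m")
    case False
    then have inm: "\<And>c i. c \<in> \<Phi> \<Longrightarrow> i \<in> I \<Longrightarrow> c i \<in> m" by blast
    have "\<exists>w \<in> UNIV \<rightarrow> carrier R. (\<forall>c\<in>\<Phi>. dot I c w = \<zero>) \<and> (\<forall>i\<in>I. w i \<ominus> (if i = j then \<one> else \<zero>) \<in> m)" for j
      using inm psubset.hyps m.is_ideal by (intro lift dot_in_ideal) auto
    then obtain w where w: "\<And>j i. w j i \<in> carrier R" "\<And>j c. c \<in> \<Phi> \<Longrightarrow> dot I c (w j) = \<zero>"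
      "\<And>j i. i \<in> I \<Longrightarrow> w j i \<ominus> (if i = j then \<one> else \<zero>) \<in> m"
      unfolding Bex_def Pi_iff by simp metis
    have wm: "w j i \<in> m" if "i \<in> I" "i \<noteq> j" for i j using w(1)[of j i] w(3)[of i j] that by (simp add: minus_eq)
    have wj: "w j j \<notin> m" if "j \<in> I" for j
    proof
      assume "w j j \<in> m"
      then have "w j j \<oplus> (\<ominus> (w j j \<ominus> \<one>)) \<in> m" using w(3)[OF that, of j] by (intro m.a_closed m.a_inv_closed) auto
      moreover have "w j j \<oplus> (\<ominus> (w j j \<ominus> \<one>)) = \<one>"
        using w(1)[of j j] by (simp add: minus_eq minus_add r_neg2 a_assoc[symmetric] r_neg)
      ultimately show False using one by simp
    qed
    have zero: "c i = \<zero>" if "c \<in> \<Phi>" "i \<in> I" for c i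
      by (rule diagonal_mod_prime_elim[OF prime \<open>finite I\<close>, of c w])
        (use that w wm wj Phic in auto)
    obtain c0 where c0: "c0 \<in> \<Phi>" using ne by auto
    have "dot I c (\<lambda>i. c0 j) = \<one> \<otimes> c j" if c: "c \<in> \<Phi>" and j: "j \<in> I" for c j
    proof -
      have "dot I c (\<lambda>i. c0 j) = (\<Oplus>i\<in>I. \<zero>)"
        unfolding dot_def using zero[OF c] Phic[OF c0] by (intro finsum_cong') auto
      then show ?thesis using zero[OF c j] by (simp add: finsum_zero)
    qed
    \<comment> \<open>All relations vanish on \<open>I\<close>, so both sides of the required
      identity are zero; \<open>s\<close> may be 1 and any member of \<open>\<Phi>\<close> may serve
      as every row of \<open>T\<close>.\<close>
    then show ?thesis using one c0 by (intro exI[of _ \<one>] exI[of _ "\<lambda>i. c0"]) auto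
  next
    case True
    then obtain c0 k where c0: "c0 \<in> \<Phi>" and k: "k \<in> I" and u: "c0 k \<notin> m" by blast
    define I' where "I' = I - {k}"
    have I: "I = insert k I'" "k \<notin> I'" "finite I'" "I' \<subset> I" using k \<open>finite I\<close> by (auto simp: I'_def)
    note [simp] = Phic[OF c0]
    \<comment> \<open>Clears coordinate \<open>k\<close> with the pivot \<open>c0 k\<close>, without
      division. Since \<open>g\<close> is linear with values in \<open>\<Phi>\<close>, its image is
      again closed under linear combinations, and rows found in the image are rows in
      \<open>\<Phi>\<close>.\<close>
    define g where "g c = (\<lambda>i. c0 k \<otimes> c i \<oplus> (\<ominus> c k) \<otimes> c0 i)" for c
    have gPhi: "g c \<in> \<Phi>" if "c \<in> \<Phi>" for c unfolding g_def using that c0 Phic by (intro lin) auto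
    have gk: "g c k = \<zero>" if "c \<in> \<Phi>" for c using Phic[OF that] by (simp add: g_def l_minus m_comm[of "c0 k" "c k"] r_neg)
    have dotg: "dot J (g c) x = c0 k \<otimes> dot J c x \<oplus> (\<ominus> c k) \<otimes> dot J c0 x"
      if "c \<in> \<Phi>" "x \<in> J \<rightarrow> carrier R" "finite J" for c x J
      unfolding g_def using that Phic c0 by (intro dot_lincomb_left) auto
    have dotI': "dot I (g c) x = dot I' (g c) x" if "c \<in> \<Phi>" "x \<in> UNIV \<rightarrow> carrier R" for c x
      using I gPhi[OF that(1)] Phi that unfolding I(1) by (subst dot_insert) (auto simp: gk Pi_iff intro!: l_zero dot_closed)
    have "\<exists>s T. s \<in> carrier R \<and> s \<notin> m \<and> (\<forall>i\<in>I'. T i \<in> g ` \<Phi>) \<and>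
       (\<forall>c\<in>g ` \<Phi>. \<forall>j\<in>I'. dot I' c (\<lambda>i. T i j) = s \<otimes> c j)"
    proof (rule psubset.IH)
      show "I' \<subset> I" by fact
      show "g ` \<Phi> \<subseteq> UNIV \<rightarrow> carrier R" using gPhi Phi by blast
      show "g ` \<Phi> \<noteq> {}" using ne by simp
      show "(\<lambda>i. a \<otimes> c i \<oplus> b \<otimes> d i) \<in> g ` \<Phi>" if cd: "c \<in> g ` \<Phi>" "d \<in> g ` \<Phi>" and ab: "a \<in> carrier R" "b \<in> carrier R" for c d a b
      proof -
        obtain c' d' where c': "c' \<in> \<Phi>" "c = g c'" and d': "d' \<in> \<Phi>" "d = g d'" using cd by auto
        have "(\<lambda>i. a \<otimes> c i \<oplus> b \<otimes> d i) = g (\<lambda>i. a \<otimes> c' i \<oplus> b \<otimes> d' i)"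
          unfolding c' d' g_def using Phic[OF c'(1)] Phic[OF d'(1)] ab
          by (auto simp: fun_eq_iff r_distr l_distr m_ac a_ac l_minus r_minus minus_add)
        then show ?thesis using lin c' d' ab by auto
      qed
      show "\<exists>w\<in>UNIV \<rightarrow> carrier R. (\<forall>c\<in>g ` \<Phi>. dot I' c w = \<zero>) \<and> (\<forall>i\<in>I'. w i \<ominus> x i \<in> m)"
        if x: "x \<in> UNIV \<rightarrow> carrier R" and xm: "\<And>c. c \<in> g ` \<Phi> \<Longrightarrow> dot I' c x \<in> m" for x
      proof -
        obtain z where z: "z \<in> carrier R" "\<one> \<ominus> c0 k \<otimes> z \<in> m" using inverse_mod_maximalideal[OF m _ u] by auto
        define t where "t = dot I' c0 x"
        have t: "t \<in> carrier R" unfolding t_def using x Phic c0 by (intro dot_closed) auto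
        \<comment> \<open>Back substitution modulo \<open>m\<close>: as \<open>z\<close> inverts the
          pivot modulo \<open>m\<close>, this coordinate solves the pivot equation up to the error
          \<open>(\<one> \<ominus> c0 k \<otimes> z) \<otimes> t\<close>. The equation of any other
          \<open>c\<close> follows from that of \<open>g c\<close>, because
          \<open>c0 k \<otimes> dot I c v\<close> lies in the prime ideal \<open>m\<close> and
          \<open>c0 k\<close> does not.\<close>
        define v where "v = x(k := z \<otimes> (\<ominus> t))"
        have v: "v \<in> UNIV \<rightarrow> carrier R" using x z t by (auto simp: v_def)
        have vI: "v \<in> I \<rightarrow> carrier R" using v by auto
        have vI': "dot I' c v = dot I' c x" if "c \<in> \<Phi>" for c
          using I x Phic that by (intro dot_cong) (auto simp: v_def)
        have "dot I c0 v = c0 k \<otimes> (z \<otimes> (\<ominus> t)) \<oplus> t"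
          using dot_insert[of I' k c0 v] I(2,3) v Phic[OF c0] vI'[OF c0] unfolding I(1)
          using z(1) t by (simp add: v_def t_def Pi_iff fun_upd_def)
        also have "\<dots> = (\<one> \<ominus> c0 k \<otimes> z) \<otimes> t"
          using t z(1) by (simp add: minus_eq l_distr l_minus r_minus m_assoc) (rule a_comm; simp)
        finally have c0v: "dot I c0 v \<in> m" using z t by (simp add: m.I_r_closed)
        have "dot I c v \<in> m" if c: "c \<in> \<Phi>" for c
        proof -
          have car: "dot I c v \<in> carrier R" "dot I c0 v \<in> carrier R" using v Phic c c0 by (auto intro!: dot_closed)
          have "dot I (g c) v \<in> m" using dotI'[OF c v] vI'[OF gPhi[OF c]] xm c by auto
          then have 1: "c0 k \<otimes> dot I c v \<oplus> (\<ominus> c k) \<otimes> dot I c0 v \<in> m" using dotg[OF c, of v I] vI \<open>finite I\<close> by simp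
          have "c k \<otimes> dot I c0 v \<in> m" by (rule m.I_l_closed[OF c0v Phic[OF c]])
          with 1 have "(c0 k \<otimes> dot I c v \<oplus> (\<ominus> c k) \<otimes> dot I c0 v) \<oplus> c k \<otimes> dot I c0 v \<in> m" by (rule m.a_closed)
          then have "c0 k \<otimes> dot I c v \<in> m" using car Phic[OF c] by (simp add: a_assoc l_minus l_neg)
          then show ?thesis using primeideal.I_prime[OF prime, of "c0 k" "dot I c v"] u car by auto
        qed
        from lift[OF v this] obtain w where w: "w \<in> UNIV \<rightarrow> carrier R" "\<And>c. c \<in> \<Phi> \<Longrightarrow> dot I c w = \<zero>" "\<And>i. i \<in> I \<Longrightarrow> w i \<ominus> v i \<in> m"
          by blast
        have "dot I' (g c) w = \<zero>" if "c \<in> \<Phi>" for c using dotI'[OF that w(1)] w(2)[OF gPhi[OF that]] by simp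
        moreover have "w i \<ominus> x i \<in> m" if "i \<in> I'" for i using w(3)[of i] that I(1,2) by (cases "i = k") (auto simp: v_def)
        ultimately show ?thesis using w(1) by (intro bexI[of _ w]) blast+
      qed
    qed
    then obtain s' T' where s': "s' \<in> carrier R" "s' \<notin> m" and T': "\<And>i. i \<in> I' \<Longrightarrow> T' i \<in> g ` \<Phi>"
      and eq: "\<And>c j. c \<in> \<Phi> \<Longrightarrow> j \<in> I' \<Longrightarrow> dot I' (g c) (\<lambda>i. T' i j) = s' \<otimes> g c j" by blast
    have T'Phi: "T' i \<in> \<Phi>" if "i \<in> I'" for i using T'[OF that] gPhi by auto
    have T'c: "T' i j \<in> carrier R" if "i \<in> I'" for i j using T'Phi[OF that] Phic by auto
    have T'k: "T' i k = \<zero>" if "i \<in> I'" for i using T'[OF that] gk by auto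
    \<comment> \<open>By induction, with sums over \<open>I'\<close>, c0 k times (\<Sum> c i T' i)
      minus c k times (\<Sum> c0 i T' i) equals s' times (c0 k times c minus c k times c0). Solving
      for the multiple of \<open>c\<close> and collecting the terms with \<open>c k\<close> gives
      row \<open>k\<close>; the factor becomes \<open>s' \<otimes> c0 k\<close>. The coefficients
      \<open>\<ominus> \<one>\<close> and \<open>\<zero>\<close> bring the rows into the form that
      \<open>lin\<close> expects.\<close>
    define T where "T i = (if i = k then (\<lambda>j. s' \<otimes> c0 j \<oplus> (\<ominus> \<one>) \<otimes> (\<Oplus>l\<in>I'. c0 l \<otimes> T' l j))
      else (\<lambda>j. c0 k \<otimes> T' i j \<oplus> \<zero> \<otimes> T' i j))" for i
    have "T i \<in> \<Phi>" if "i \<in> I" for i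
    proof -
      have "(\<lambda>j. (\<Oplus>l\<in>I'. c0 l \<otimes> T' l j)) \<in> \<Phi>" using I T'Phi lin by (intro lincomb_sum_closed[OF Phi ne]) auto
      then show ?thesis unfolding T_def using that I s' c0 T'Phi by (auto intro!: lin)
    qed
    moreover have "dot I c (\<lambda>i. T i j) = (s' \<otimes> c0 k) \<otimes> c j" if c: "c \<in> \<Phi>" and j: "j \<in> I" for c j
    proof -
      let ?D = "dot I' c (\<lambda>i. T' i j)" and ?E = "dot I' c0 (\<lambda>i. T' i j)"
      have D: "?D \<in> carrier R" "?E \<in> carrier R" using T'c Phic c c0 by (auto intro!: dot_closed)
      note [simp] = Phic[OF c] s'(1)
      have "dot I' (g c) (\<lambda>i. T' i j) = s' \<otimes> g c j"
      \<comment> \<open>The induction hypothesis covers only the columns in \<open>I'\<close>. In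
        column \<open>k\<close> both sides vanish, since every member of the image of
        \<open>g\<close> is zero there.\<close>
      proof (cases "j = k")
        case True
        have "dot I' (g c) (\<lambda>i. T' i j) = (\<Oplus>i\<in>I'. \<zero>)" unfolding dot_def True
          using T'k Phic[OF gPhi[OF c]] by (intro finsum_cong') auto
        then show ?thesis using True gk[OF c] by (simp add: finsum_zero)
      qed (use eq c j I in auto)
      moreover have "dot I' (g c) (\<lambda>i. T' i j) = c0 k \<otimes> ?D \<oplus> (\<ominus> c k) \<otimes> ?E"
        by (rule dotg) (use c T'c I(3) in auto)
      ultimately have key: "c0 k \<otimes> ?D \<oplus> (\<ominus> c k) \<otimes> ?E = s' \<otimes> (c0 k \<otimes> c j \<oplus> (\<ominus> c k) \<otimes> c0 j)"
        by (simp only: g_def)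
      have Tk: "T k j = s' \<otimes> c0 j \<oplus> (\<ominus> ?E)" using D unfolding dot_def by (simp add: T_def l_minus)
      have Tc: "T i j \<in> carrier R" if "i \<in> I" for i j using \<open>\<And>i. i \<in> I \<Longrightarrow> T i \<in> \<Phi>\<close>[OF that] Phic by auto
      have "dot I' c (\<lambda>i. T i j) = dot I' c (\<lambda>i. c0 k \<otimes> T' i j \<oplus> \<zero> \<otimes> T' i j)"
        by (rule dot_cong) (use I T'c Phic[OF c] in \<open>auto simp: T_def\<close>)
      also have "\<dots> = c0 k \<otimes> ?D \<oplus> \<zero> \<otimes> ?D"
        by (rule dot_lincomb_right) (use I T'c Phic[OF c] in auto)
      finally have 2: "dot I' c (\<lambda>i. T i j) = c0 k \<otimes> ?D" using D by simp
      have "dot I c (\<lambda>i. T i j) = c k \<otimes> (s' \<otimes> c0 j \<oplus> (\<ominus> ?E)) \<oplus> c0 k \<otimes> ?D"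
        unfolding 2[symmetric] Tk[symmetric] I(1) by (rule dot_insert) (use I Tc Phic[OF c] in auto)
      also have "\<dots> = c k \<otimes> (s' \<otimes> c0 j) \<oplus> (c0 k \<otimes> ?D \<oplus> (\<ominus> c k) \<otimes> ?E)"
        using D by (simp add: r_distr l_minus r_minus a_ac)
      also have "\<dots> = (s' \<otimes> c0 k) \<otimes> c j"
      proof -
        let ?q = "c k \<otimes> (s' \<otimes> c0 j)" and ?p = "s' \<otimes> c0 k \<otimes> c j"
        have "s' \<otimes> (c0 k \<otimes> c j \<oplus> (\<ominus> c k) \<otimes> c0 j) = ?p \<oplus> (\<ominus> ?q)"
          by (simp add: r_distr l_minus r_minus m_ac)
        moreover have "?q \<oplus> (?p \<oplus> (\<ominus> ?q)) = ?p"
          by (simp add: a_comm[of ?p "\<ominus> ?q"] r_neg2)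
        ultimately show ?thesis unfolding key by simp
      qed
      finally show ?thesis .
    qed
    moreover have "s' \<otimes> c0 k \<notin> m" using primeideal.I_prime[OF prime, of s' "c0 k"] s' u by auto
    ultimately show ?thesis using s' by (intro exI[of _ "s' \<otimes> c0 k"] exI[of _ T]) auto
  qed
qed

section \<open>Passage from the maximal ideals to the ring itself\<close>

lemma (in ring) exists_maximalideal:
  assumes J: "ideal J R" "J \<noteq> carrier R"
  shows "\<exists>m. maximalideal m R \<and> J \<subseteq> m"
proof -
  let ?S = "{I. ideal I R \<and> J \<subseteq> I \<and> I \<noteq> carrier R}"
  have "\<exists>M\<in>?S. \<forall>X\<in>?S. M \<subseteq> X \<longrightarrow> X = M"
  proof (rule subset_Zorn_nonempty)
    show "?S \<noteq> {}" using J by blast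
  next
    fix C assume C: "C \<noteq> {}" "subset.chain ?S C"
    have "subset.chain {I. ideal I R} C" using C(2) by (auto simp: subset_chain_def)
    from chain_Union_is_ideal[OF this] have "ideal (\<Union>C) R" using C(1) by simp
    moreover have "J \<subseteq> \<Union>C" using C unfolding subset_chain_def by blast
    moreover have "\<Union>C \<noteq> carrier R"
    proof
      assume "\<Union>C = carrier R"
      then obtain I where I: "I \<in> C" "\<one> \<in> I" by blast
      then have "ideal I R" "I \<noteq> carrier R" using C(2) by (auto simp: subset_chain_def)
      then show False using ideal.one_imp_carrier I by blast
    qed
    ultimately show "\<Union>C \<in> ?S" by blast
  qed
  then obtain M where "M \<in> ?S" and max: "\<forall>X\<in>?S. M \<subseteq> X \<longrightarrow> X = M" by (rule bexE)
  then have M: "ideal M R" "J \<subseteq> M" "M \<noteq> carrier R" by auto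
  have "maximalideal M R"
  proof (rule maximalidealI)
    show "X = M \<or> X = carrier R" if "ideal X R" "M \<subseteq> X" for X
      using max[rule_format, of X] that M(2) by blast
  qed (use M in auto)
  then show ?thesis using M(2) by blast
qed

text \<open>Restricted to \<open>I\<close>, the matrix \<open>T\<close> is idempotent: its rows lie
  in \<open>\<Phi>\<close>, and multiplying a row from \<open>\<Phi>\<close> by it changes nothing.
  The ideal of admissible factors \<open>s\<close> adds up the local solutions without the choice of
  a finite cover.\<close>

lemma (in domain) splitting:
  assumes "finite I" and Phi: "\<Phi> \<subseteq> UNIV \<rightarrow> carrier R" and ne: "\<Phi> \<noteq> {}"
    and lin: "\<And>c d a b. \<lbrakk> c \<in> \<Phi>; d \<in> \<Phi>; a \<in> carrier R; b \<in> carrier R \<rbrakk> \<Longrightarrow> (\<lambda>i. a \<otimes> c i \<oplus> b \<otimes> d i) \<in> \<Phi>"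
    and lift: "\<And>m x. \<lbrakk> maximalideal m R; x \<in> UNIV \<rightarrow> carrier R; \<And>c. c \<in> \<Phi> \<Longrightarrow> dot I c x \<in> m \<rbrakk>
       \<Longrightarrow> \<exists>w \<in> UNIV \<rightarrow> carrier R. (\<forall>c\<in>\<Phi>. dot I c w = \<zero>) \<and> (\<forall>i\<in>I. w i \<ominus> x i \<in> m)"
  shows "\<exists>T. (\<forall>i\<in>I. T i \<in> \<Phi>) \<and> (\<forall>c\<in>\<Phi>. \<forall>j\<in>I. dot I c (\<lambda>i. T i j) = c j)"
proof -
  define J where "J = {s \<in> carrier R. \<exists>T. (\<forall>i\<in>I. T i \<in> \<Phi>) \<and> (\<forall>c\<in>\<Phi>. \<forall>j\<in>I. dot I c (\<lambda>i. T i j) = s \<otimes> c j)}"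
  have Phic: "c i \<in> carrier R" if "c \<in> \<Phi>" for c i using that Phi by auto
  \<comment> \<open>The conditions on \<open>T\<close> are linear in \<open>s\<close> and
    \<open>T\<close> jointly. This one property yields sums, negatives and multiples in the
    ideal.\<close>
  have comb: "a \<otimes> s \<oplus> b \<otimes> t \<in> J" if st: "s \<in> J" "t \<in> J" and ab: "a \<in> carrier R" "b \<in> carrier R" for s t a b
  proof -
    obtain T where s: "s \<in> carrier R" and T: "\<And>i. i \<in> I \<Longrightarrow> T i \<in> \<Phi>" "\<And>c j. c \<in> \<Phi> \<Longrightarrow> j \<in> I \<Longrightarrow> dot I c (\<lambda>i. T i j) = s \<otimes> c j"
      using st(1) unfolding J_def by blast
    obtain U where t: "t \<in> carrier R" and U: "\<And>i. i \<in> I \<Longrightarrow> U i \<in> \<Phi>" "\<And>c j. c \<in> \<Phi> \<Longrightarrow> j \<in> I \<Longrightarrow> dot I c (\<lambda>i. U i j) = t \<otimes> c j"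
      using st(2) unfolding J_def by blast
    define V where "V i = (\<lambda>j. a \<otimes> T i j \<oplus> b \<otimes> U i j)" for i
    have "V i \<in> \<Phi>" if "i \<in> I" for i unfolding V_def using T U that ab by (intro lin) auto
    moreover have "dot I c (\<lambda>i. V i j) = (a \<otimes> s \<oplus> b \<otimes> t) \<otimes> c j" if "c \<in> \<Phi>" "j \<in> I" for c j
    proof -
      have "dot I c (\<lambda>i. V i j) = a \<otimes> dot I c (\<lambda>i. T i j) \<oplus> b \<otimes> dot I c (\<lambda>i. U i j)"
        unfolding V_def by (rule dot_lincomb_right) (use that T(1) U(1) Phic ab \<open>finite I\<close> in auto)
      also have "\<dots> = (a \<otimes> s \<oplus> b \<otimes> t) \<otimes> c j"
        using T(2)[OF that] U(2)[OF that] s t ab Phic[OF that(1)] by (simp add: l_distr m_assoc)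
      finally show ?thesis .
    qed
    ultimately show ?thesis unfolding J_def using s t ab by blast
  qed
  have notin: "\<exists>s\<in>J. s \<notin> m" if "maximalideal m R" for m
    using splitting_outside_maximalideal[OF that \<open>finite I\<close> Phi ne lin lift[OF that]] unfolding J_def by blast
  have Jc: "J \<subseteq> carrier R" by (auto simp: J_def)
  have ne: "\<exists>s. s \<in> J"
  proof -
    obtain m where "maximalideal m R" using exists_maximalideal[OF zeroideal] one_not_zero by fastforce
    then show ?thesis using notin by blast
  qed
  have J: "ideal J R"
  proof (rule idealI[OF ring_axioms])
    show *: "a \<otimes> s \<in> J" if "s \<in> J" "a \<in> carrier R" for a s using comb[OF that(1) that(1) that(2) zero_closed] that Jc by auto
    show "s \<otimes> a \<in> J" if "s \<in> J" "a \<in> carrier R" for a s using *[OF that] that Jc m_comm[of a s] by auto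
    show "subgroup J (add_monoid R)"
    proof (rule add.subgroupI)
      show "J \<subseteq> carrier R" "J \<noteq> {}" using Jc ne by auto
      show "\<ominus> s \<in> J" if "s \<in> J" for s
        using comb[OF that that, of "\<ominus> \<one>" \<zero>] that Jc by (auto simp: l_minus)
      show "s \<oplus> t \<in> J" if "s \<in> J" "t \<in> J" for s t
        using comb[OF that, of \<one> \<one>] subsetD[OF Jc that(1)] subsetD[OF Jc that(2)] by simp
    qed
  qed
  have "\<one> \<in> J"
  proof (rule ccontr)
    assume "\<one> \<notin> J"
    then obtain m where "maximalideal m R" "J \<subseteq> m" using exists_maximalideal[OF J] by blast
    then show False using notin by blast
  qed
  then show ?thesis using Phic unfolding J_def by auto
qed

section \<open>Tensor products\<close>

locale tensor_factors =
  fixes A :: "('a, 'z) ring_scheme" and M :: "('a, 'm) module" and N :: "('a, 'n) module"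
  assumes module_M: "module A M" and module_N: "module A N"
begin

interpretation M: module A M by (rule module_M)
interpretation N: module A N by (rule module_N)

abbreviation "F \<equiv> free_Abelian_group (carrier M \<times> carrier N)"
abbreviation "K \<equiv> tensor_kernel A M N"
abbreviation "T \<equiv> tensor_group A M N"
abbreviation "pt \<equiv> pure_tensor A M N"

lemma free_diff_closed: "\<lbrakk> c \<in> carrier F; d \<in> carrier F \<rbrakk> \<Longrightarrow> c - d \<in> carrier F"
  using keys_diff[of c d] by auto

lemma tensor_relators_subset: "tensor_relators A M N \<subseteq> carrier F"
  unfolding tensor_relators_def
  by (auto intro!: free_diff_closed simp del: carrier_free_Abelian_group_iff)

lemma tensor_kernel_subgroup: "subgroup K F"
  unfolding tensor_kernel_def
  by (rule group.generate_is_subgroup[OF group_free_Abelian_group tensor_relators_subset])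

lemma tensor_kernel_normal: "K \<lhd> F"
  by (rule comm_group.subgroup_imp_normal[OF abelian_free_Abelian_group tensor_kernel_subgroup])

lemma tensor_group_comm_group: "comm_group T"
  unfolding tensor_group_def
  by (rule comm_group.abelian_FactGroup[OF abelian_free_Abelian_group tensor_kernel_subgroup])

lemma tensor_group_mult:
  "\<lbrakk> c \<in> carrier F; d \<in> carrier F \<rbrakk> \<Longrightarrow> (K #>\<^bsub>F\<^esub> c) \<otimes>\<^bsub>T\<^esub> (K #>\<^bsub>F\<^esub> d) = K #>\<^bsub>F\<^esub> (c + d)"
  using normal.rcos_sum[OF tensor_kernel_normal, of c d] by (simp add: tensor_group_def FactGroup_def)

lemma tensor_group_carrier: "carrier T = (\<lambda>c. K #>\<^bsub>F\<^esub> c) ` carrier F"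
  by (auto simp: tensor_group_def FactGroup_def RCOSETS_def)

lemma tensor_coset_eqI:
  assumes "c \<in> carrier F" "d \<in> carrier F" "c - d \<in> K"
  shows "K #>\<^bsub>F\<^esub> c = K #>\<^bsub>F\<^esub> d"
proof -
  have "c \<in> K #>\<^bsub>F\<^esub> d" using assms(3) by (force simp: r_coset_def)
  then show ?thesis
    using group.repr_independence[OF group_free_Abelian_group _ assms(2) tensor_kernel_subgroup] by metis
qed

lemma pure_closed [simp, intro]: "\<lbrakk> x \<in> carrier M; y \<in> carrier N \<rbrakk> \<Longrightarrow> pt x y \<in> carrier T"
  by (auto simp: tensor_group_carrier pure_tensor_def)

lemma in_tensor_kernel: "c \<in> tensor_relators A M N \<Longrightarrow> c \<in> K"
  unfolding tensor_kernel_def by (rule generate.incl)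

lemma free_add_closed: "\<lbrakk> c \<in> carrier F; d \<in> carrier F \<rbrakk> \<Longrightarrow> c + d \<in> carrier F"
  using keys_add[of c d] by auto

lemma pure_add_left:
  assumes "x \<in> carrier M" "x' \<in> carrier M" "y \<in> carrier N"
  shows "pt (x \<oplus>\<^bsub>M\<^esub> x') y = pt x y \<otimes>\<^bsub>T\<^esub> pt x' y"
proof -
  let ?d = "frag_of (x, y) + frag_of (x', y)"
  have "frag_of (x \<oplus>\<^bsub>M\<^esub> x', y) - frag_of (x, y) - frag_of (x', y) \<in> K"
    using assms by (intro in_tensor_kernel) (auto simp: tensor_relators_def)
  then have "frag_of (x \<oplus>\<^bsub>M\<^esub> x', y) - ?d \<in> K" by (simp add: diff_diff_eq)
  moreover have "?d \<in> carrier F" using assms by (intro free_add_closed) auto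
  ultimately have "K #>\<^bsub>F\<^esub> frag_of (x \<oplus>\<^bsub>M\<^esub> x', y) = K #>\<^bsub>F\<^esub> ?d" using assms by (intro tensor_coset_eqI) auto
  then show ?thesis unfolding pure_tensor_def using assms by (subst tensor_group_mult) auto
qed

lemma pure_add_right:
  assumes "x \<in> carrier M" "y \<in> carrier N" "y' \<in> carrier N"
  shows "pt x (y \<oplus>\<^bsub>N\<^esub> y') = pt x y \<otimes>\<^bsub>T\<^esub> pt x y'"
proof -
  let ?d = "frag_of (x, y) + frag_of (x, y')"
  have "frag_of (x, y \<oplus>\<^bsub>N\<^esub> y') - frag_of (x, y) - frag_of (x, y') \<in> K"
    using assms by (intro in_tensor_kernel) (auto simp: tensor_relators_def)
  then have "frag_of (x, y \<oplus>\<^bsub>N\<^esub> y') - ?d \<in> K" by (simp add: diff_diff_eq)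
  moreover have "?d \<in> carrier F" using assms by (intro free_add_closed) auto
  ultimately have "K #>\<^bsub>F\<^esub> frag_of (x, y \<oplus>\<^bsub>N\<^esub> y') = K #>\<^bsub>F\<^esub> ?d" using assms by (intro tensor_coset_eqI) auto
  then show ?thesis unfolding pure_tensor_def using assms by (subst tensor_group_mult) auto
qed

lemma pure_smult:
  assumes "a \<in> carrier A" "x \<in> carrier M" "y \<in> carrier N"
  shows "pt (a \<odot>\<^bsub>M\<^esub> x) y = pt x (a \<odot>\<^bsub>N\<^esub> y)"
proof -
  have "frag_of (a \<odot>\<^bsub>M\<^esub> x, y) - frag_of (x, a \<odot>\<^bsub>N\<^esub> y) \<in> K"
    using assms by (intro in_tensor_kernel) (auto simp: tensor_relators_def)
  then show ?thesis unfolding pure_tensor_def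
    using assms by (intro tensor_coset_eqI) (auto simp del: carrier_free_Abelian_group_iff)
qed

lemma pure_minus_left:
  assumes "x \<in> carrier M" "y \<in> carrier N"
  shows "pt (\<ominus>\<^bsub>M\<^esub> x) y = inv\<^bsub>T\<^esub> (pt x y)"
proof -
  interpret T: comm_group T by (rule tensor_group_comm_group)
  have 0: "pt \<zero>\<^bsub>M\<^esub> y = \<one>\<^bsub>T\<^esub>"
    using pure_add_left[of "\<zero>\<^bsub>M\<^esub>" "\<zero>\<^bsub>M\<^esub>" y] assms by simp
  show ?thesis
    using pure_add_left[of "\<ominus>\<^bsub>M\<^esub> x" x y] assms 0
    by (intro T.inv_equality[symmetric]) (auto simp: M.M.l_neg)
qed

text \<open>Inverses need no case of their own: the inverse of x \<otimes> y is the pure tensor (-x)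
  \<otimes> y.\<close>

lemma tensor_induct [consumes 1, case_names one pure mult]:
  assumes "u \<in> carrier T"
    and one: "P \<one>\<^bsub>T\<^esub>"
    and pure: "\<And>x y. \<lbrakk> x \<in> carrier M; y \<in> carrier N \<rbrakk> \<Longrightarrow> P (pt x y)"
    and mult: "\<And>u v. \<lbrakk> u \<in> carrier T; v \<in> carrier T; P u; P v \<rbrakk> \<Longrightarrow> P (u \<otimes>\<^bsub>T\<^esub> v)"
  shows "P u"
proof -
  interpret T: comm_group T by (rule tensor_group_comm_group)
  obtain c where c: "Poly_Mapping.keys c \<subseteq> carrier M \<times> carrier N" "u = K #>\<^bsub>F\<^esub> c"
    using assms(1) by (auto simp: tensor_group_carrier)
  have Kc: "K #>\<^bsub>F\<^esub> c \<in> carrier T" if "Poly_Mapping.keys c \<subseteq> carrier M \<times> carrier N" for c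
    using that by (auto simp: tensor_group_carrier)
  have one': "K #>\<^bsub>F\<^esub> 0 = \<one>\<^bsub>T\<^esub>"
    using tensor_group_mult[of 0 0] Kc[of 0] by simp
  have minus: "K #>\<^bsub>F\<^esub> (- c) = inv\<^bsub>T\<^esub> (K #>\<^bsub>F\<^esub> c)" if "Poly_Mapping.keys c \<subseteq> carrier M \<times> carrier N" for c
    using tensor_group_mult[of "- c" c] that one' Kc by (intro T.inv_equality[symmetric]) auto
  have inv_pure: "P (inv\<^bsub>T\<^esub> pt x y)" if "x \<in> carrier M" "y \<in> carrier N" for x y
    using pure[of "\<ominus>\<^bsub>M\<^esub> x" y] that by (simp add: pure_minus_left)
  \<comment> \<open>Induction on free Abelian groups builds elements by differences, so the claim
    for the inverse is carried along.\<close>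
  have "P (K #>\<^bsub>F\<^esub> c) \<and> P (inv\<^bsub>T\<^esub> (K #>\<^bsub>F\<^esub> c))"
  proof (rule free_Abelian_group_induct[OF c(1)])
    show "P (K #>\<^bsub>F\<^esub> 0) \<and> P (inv\<^bsub>T\<^esub> (K #>\<^bsub>F\<^esub> 0))" using one by (simp add: one')
  next
    fix c d
    assume cd: "Poly_Mapping.keys c \<subseteq> carrier M \<times> carrier N" "Poly_Mapping.keys d \<subseteq> carrier M \<times> carrier N"
      and IH: "P (K #>\<^bsub>F\<^esub> c) \<and> P (inv\<^bsub>T\<^esub> (K #>\<^bsub>F\<^esub> c))" "P (K #>\<^bsub>F\<^esub> d) \<and> P (inv\<^bsub>T\<^esub> (K #>\<^bsub>F\<^esub> d))"
    have eq: "K #>\<^bsub>F\<^esub> (c - d) = (K #>\<^bsub>F\<^esub> c) \<otimes>\<^bsub>T\<^esub> inv\<^bsub>T\<^esub> (K #>\<^bsub>F\<^esub> d)"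
      using tensor_group_mult[of c "- d"] cd by (simp add: minus)
    have "inv\<^bsub>T\<^esub> (K #>\<^bsub>F\<^esub> (c - d)) = (K #>\<^bsub>F\<^esub> d) \<otimes>\<^bsub>T\<^esub> inv\<^bsub>T\<^esub> (K #>\<^bsub>F\<^esub> c)"
      unfolding eq using Kc cd by (simp add: T.inv_mult T.m_comm)
    then show "P (K #>\<^bsub>F\<^esub> (c - d)) \<and> P (inv\<^bsub>T\<^esub> (K #>\<^bsub>F\<^esub> (c - d)))" using mult eq IH Kc[OF cd(1)] Kc[OF cd(2)] by simp
  next
    fix p assume "p \<in> carrier M \<times> carrier N"
    then show "P (K #>\<^bsub>F\<^esub> frag_of p) \<and> P (inv\<^bsub>T\<^esub> (K #>\<^bsub>F\<^esub> frag_of p))"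
      using pure inv_pure by (cases p) (auto simp: pure_tensor_def)
  qed
  then show ?thesis using c by simp
qed

end

section \<open>The universal property of the tensor product\<close>

context tensor_factors
begin

interpretation M: module A M by (rule module_M)
interpretation N: module A N by (rule module_N)

text \<open>The target is written multiplicatively, so that a tensor group can be used directly and
  an algebra through its \<open>add_monoid\<close>.\<close>

definition balanced :: "('g, 'w) monoid_scheme \<Rightarrow> ('m \<Rightarrow> 'n \<Rightarrow> 'g) \<Rightarrow> bool"
  where "balanced G g \<longleftrightarrow>
    (\<forall>x\<in>carrier M. \<forall>y\<in>carrier N. g x y \<in> carrier G) \<and>
    (\<forall>x\<in>carrier M. \<forall>x'\<in>carrier M. \<forall>y\<in>carrier N. g (x \<oplus>\<^bsub>M\<^esub> x') y = g x y \<otimes>\<^bsub>G\<^esub> g x' y) \<and>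
    (\<forall>x\<in>carrier M. \<forall>y\<in>carrier N. \<forall>y'\<in>carrier N. g x (y \<oplus>\<^bsub>N\<^esub> y') = g x y \<otimes>\<^bsub>G\<^esub> g x y') \<and>
    (\<forall>a\<in>carrier A. \<forall>x\<in>carrier M. \<forall>y\<in>carrier N. g (a \<odot>\<^bsub>M\<^esub> x) y = g x (a \<odot>\<^bsub>N\<^esub> y))"

lemma balancedI:
  assumes "\<And>x y. \<lbrakk> x \<in> carrier M; y \<in> carrier N \<rbrakk> \<Longrightarrow> g x y \<in> carrier G"
    and "\<And>x x' y. \<lbrakk> x \<in> carrier M; x' \<in> carrier M; y \<in> carrier N \<rbrakk> \<Longrightarrow> g (x \<oplus>\<^bsub>M\<^esub> x') y = g x y \<otimes>\<^bsub>G\<^esub> g x' y"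
    and "\<And>x y y'. \<lbrakk> x \<in> carrier M; y \<in> carrier N; y' \<in> carrier N \<rbrakk> \<Longrightarrow> g x (y \<oplus>\<^bsub>N\<^esub> y') = g x y \<otimes>\<^bsub>G\<^esub> g x y'"
    and "\<And>a x y. \<lbrakk> a \<in> carrier A; x \<in> carrier M; y \<in> carrier N \<rbrakk> \<Longrightarrow> g (a \<odot>\<^bsub>M\<^esub> x) y = g x (a \<odot>\<^bsub>N\<^esub> y)"
  shows "balanced G g"
  unfolding balanced_def by (intro conjI ballI assms)

text \<open>\<open>tensor_lift\<close> evaluates an arbitrarily chosen representative. The choice
  does no harm because \<open>h\<close>, the extension of \<open>g\<close> to the free Abelian
  group, kills all relators and hence the subgroup \<open>K\<close> by which representatives
  differ.\<close>

lemma tensor_lift_coset: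
  assumes G: "comm_group G" and g: "balanced G g"
  obtains h where "h \<in> hom F G"
    and "\<And>x y. \<lbrakk> x \<in> carrier M; y \<in> carrier N \<rbrakk> \<Longrightarrow> h (frag_of (x, y)) = g x y"
    and "\<And>c. c \<in> carrier F \<Longrightarrow> tensor_lift G g (K #>\<^bsub>F\<^esub> c) = h c"
proof -
  interpret G: comm_group G by fact
  define g' where "g' p = (case p of (x, y) \<Rightarrow> g x y)" for p
  have g': "g' p \<in> carrier G" if "p \<in> carrier M \<times> carrier N" for p
    using g that by (auto simp: g'_def balanced_def)
  define h where "h c = finprod G (\<lambda>p. g' p [^]\<^bsub>G\<^esub> Poly_Mapping.lookup c p) (Poly_Mapping.keys c)" for c :: "('m \<times> 'n) \<Rightarrow>\<^sub>0 int"
  \<comment> \<open>Cancellation can make the support of a sum smaller than the union of the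
    supports; all products are therefore taken over one common finite set.\<close>
  have h_superset: "h c = finprod G (\<lambda>p. g' p [^]\<^bsub>G\<^esub> Poly_Mapping.lookup c p) S"
    if "finite S" "Poly_Mapping.keys c \<subseteq> S" "S \<subseteq> carrier M \<times> carrier N" for c S
    unfolding h_def
  proof (rule G.finprod_mono_neutral_cong_left)
    show "g' p [^]\<^bsub>G\<^esub> Poly_Mapping.lookup c p = \<one>\<^bsub>G\<^esub>" if "p \<in> S - Poly_Mapping.keys c" for p
      using that by (simp add: in_keys_iff)
  qed (use that g' in auto)
  have h_hom: "h \<in> hom F G"
  proof (rule homI)
    show "h c \<in> carrier G" if "c \<in> carrier F" for c
      unfolding h_def using that g' by (intro G.finprod_closed) auto
    show "h (c \<otimes>\<^bsub>F\<^esub> d) = h c \<otimes>\<^bsub>G\<^esub> h d" if cd: "c \<in> carrier F" "d \<in> carrier F" for c d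
    proof -
      let ?S = "Poly_Mapping.keys c \<union> Poly_Mapping.keys d"
      have S: "finite ?S" "?S \<subseteq> carrier M \<times> carrier N" using cd by auto
      then have gS: "\<And>p. p \<in> ?S \<Longrightarrow> g' p \<in> carrier G" using g' by blast
      have "h (c + d) = finprod G (\<lambda>p. g' p [^]\<^bsub>G\<^esub> Poly_Mapping.lookup (c + d) p) ?S"
        using S keys_add[of c d] by (intro h_superset) auto
      also have "\<dots> = finprod G (\<lambda>p. g' p [^]\<^bsub>G\<^esub> Poly_Mapping.lookup c p \<otimes>\<^bsub>G\<^esub> g' p [^]\<^bsub>G\<^esub> Poly_Mapping.lookup d p) ?S"
        by (rule G.finprod_cong') (use gS in \<open>auto simp: lookup_add G.int_pow_mult\<close>)
      also have "\<dots> = h c \<otimes>\<^bsub>G\<^esub> h d"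
        using h_superset[of ?S c] h_superset[of ?S d] S gS by (subst G.finprod_multf) auto
      finally show ?thesis by simp
    qed
  qed
  interpret h: group_hom F G h
    using h_hom by (simp add: group_hom_def group_hom_axioms_def G.is_group)
  have h_of: "h (frag_of p) = g' p" if "p \<in> carrier M \<times> carrier N" for p
    using g'[OF that] by (simp add: h_def G.finprod_singleton)
  have h_diff: "h (c - d) = h c \<otimes>\<^bsub>G\<^esub> inv\<^bsub>G\<^esub> h d" if "c \<in> carrier F" "d \<in> carrier F" for c d
    using h.hom_mult[of c "- d"] h.hom_inv[of d] that by simp
  have comm_cancel: "a \<otimes>\<^bsub>G\<^esub> b \<otimes>\<^bsub>G\<^esub> inv\<^bsub>G\<^esub> a \<otimes>\<^bsub>G\<^esub> inv\<^bsub>G\<^esub> b = \<one>\<^bsub>G\<^esub>" if "a \<in> carrier G" "b \<in> carrier G" for a b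
    using that by (simp add: G.m_comm[of a b] G.m_assoc)
  have "tensor_relators A M N \<subseteq> kernel F G h"
  proof
    fix c assume c: "c \<in> tensor_relators A M N"
    then have cF: "c \<in> carrier F" using tensor_relators_subset by blast
    have gg: "g x y \<in> carrier G" if "x \<in> carrier M" "y \<in> carrier N" for x y using g that by (auto simp: balanced_def)
    have "h c = \<one>\<^bsub>G\<^esub>"
      using c unfolding tensor_relators_def
    proof (elim UnE CollectE exE conjE)
      fix x x' y
      assume *: "c = frag_of (x \<oplus>\<^bsub>M\<^esub> x', y) - frag_of (x, y) - frag_of (x', y)"
        "x \<in> carrier M" "x' \<in> carrier M" "y \<in> carrier N"
      have "frag_of (x \<oplus>\<^bsub>M\<^esub> x', y) - frag_of (x, y) \<in> carrier F" using * by (intro free_diff_closed) auto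
      moreover have "g (x \<oplus>\<^bsub>M\<^esub> x') y = g x y \<otimes>\<^bsub>G\<^esub> g x' y" using g * by (auto simp: balanced_def)
      ultimately show "h c = \<one>\<^bsub>G\<^esub>" using * gg[of x y] gg[of x' y]
        by (simp add: h_diff h_of g'_def comm_cancel del: carrier_free_Abelian_group_iff)
    next
      fix x y y'
      assume *: "c = frag_of (x, y \<oplus>\<^bsub>N\<^esub> y') - frag_of (x, y) - frag_of (x, y')"
        "x \<in> carrier M" "y \<in> carrier N" "y' \<in> carrier N"
      have "frag_of (x, y \<oplus>\<^bsub>N\<^esub> y') - frag_of (x, y) \<in> carrier F" using * by (intro free_diff_closed) auto
      moreover have "g x (y \<oplus>\<^bsub>N\<^esub> y') = g x y \<otimes>\<^bsub>G\<^esub> g x y'" using g * by (auto simp: balanced_def)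
      ultimately show "h c = \<one>\<^bsub>G\<^esub>" using * gg[of x y] gg[of x y']
        by (simp add: h_diff h_of g'_def comm_cancel del: carrier_free_Abelian_group_iff)
    next
      fix a x y
      assume *: "c = frag_of (a \<odot>\<^bsub>M\<^esub> x, y) - frag_of (x, a \<odot>\<^bsub>N\<^esub> y)"
        "a \<in> carrier A" "x \<in> carrier M" "y \<in> carrier N"
      moreover have "g (a \<odot>\<^bsub>M\<^esub> x) y = g x (a \<odot>\<^bsub>N\<^esub> y)" using g * by (auto simp: balanced_def)
      ultimately show "h c = \<one>\<^bsub>G\<^esub>" using gg[of x "a \<odot>\<^bsub>N\<^esub> y"]
        by (simp add: h_diff h_of g'_def del: carrier_free_Abelian_group_iff)
    qed
    then show "c \<in> kernel F G h" using cF by (simp add: kernel_def)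
  qed
  then have K: "K \<subseteq> kernel F G h"
    unfolding tensor_kernel_def
    by (intro group.generate_subgroup_incl[OF group_free_Abelian_group _ h.subgroup_kernel])
  show thesis
  proof (rule that[OF h_hom])
    show "h (frag_of (x, y)) = g x y" if "x \<in> carrier M" "y \<in> carrier N" for x y
      using that h_of[of "(x, y)"] by (simp add: g'_def)
    show "tensor_lift G g (K #>\<^bsub>F\<^esub> c) = h c" if c: "c \<in> carrier F" for c
    proof -
      let ?d = "SOME d. d \<in> K #>\<^bsub>F\<^esub> c"
      have "c \<in> K #>\<^bsub>F\<^esub> c" by (rule group.rcos_self[OF group_free_Abelian_group c tensor_kernel_subgroup])
      then have "?d \<in> K #>\<^bsub>F\<^esub> c" by (rule someI)
      then obtain k where k: "k \<in> K" "?d = k + c" by (auto simp: r_coset_def)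
      then have "k \<in> carrier F" "h k = \<one>\<^bsub>G\<^esub>" using K by (auto simp: kernel_def)
      then have "h ?d = h c" using k(2) h.hom_mult[of k c] c h.hom_closed[OF c] by simp
      then show ?thesis by (simp add: tensor_lift_def h_def g'_def Let_def case_prod_unfold)
    qed
  qed
qed

lemma tensor_lift_hom:
  assumes "comm_group G" "balanced G g"
  shows "tensor_lift G g \<in> hom T G"
proof -
  obtain h where h: "h \<in> hom F G" "\<And>c. c \<in> carrier F \<Longrightarrow> tensor_lift G g (K #>\<^bsub>F\<^esub> c) = h c"
    using tensor_lift_coset[OF assms] by metis
  show ?thesis
  proof (rule homI)
    show "tensor_lift G g u \<in> carrier G" if "u \<in> carrier T" for u
      using that h by (auto simp: tensor_group_carrier hom_def simp del: carrier_free_Abelian_group_iff)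
    show "tensor_lift G g (u \<otimes>\<^bsub>T\<^esub> v) = tensor_lift G g u \<otimes>\<^bsub>G\<^esub> tensor_lift G g v"
      if uv: "u \<in> carrier T" "v \<in> carrier T" for u v
    proof -
      obtain c d where cd: "c \<in> carrier F" "u = K #>\<^bsub>F\<^esub> c" "d \<in> carrier F" "v = K #>\<^bsub>F\<^esub> d"
        using uv by (auto simp: tensor_group_carrier simp del: carrier_free_Abelian_group_iff)
      have "h (c + d) = h c \<otimes>\<^bsub>G\<^esub> h d" using hom_mult[OF h(1) cd(1,3)] by simp
      then show ?thesis using cd h(2) by (simp add: tensor_group_mult free_add_closed del: carrier_free_Abelian_group_iff)
    qed
  qed
qed

lemma tensor_lift_pure:
  assumes "comm_group G" "balanced G g" "x \<in> carrier M" "y \<in> carrier N"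
  shows "tensor_lift G g (pt x y) = g x y"
  using tensor_lift_coset[OF assms(1,2)] assms(3,4) unfolding pure_tensor_def
  by (metis SigmaI frag_of_in_free_Abelian_group)

lemma tensor_hom_eqI:
  assumes "group G" "h \<in> hom T G" "h' \<in> hom T G"
    and "\<And>x y. \<lbrakk> x \<in> carrier M; y \<in> carrier N \<rbrakk> \<Longrightarrow> h (pt x y) = h' (pt x y)"
    and "u \<in> carrier T"
  shows "h u = h' u"
  using assms(5)
proof (induction rule: tensor_induct)
  case one
  show ?case
    using assms(1-3) tensor_group_comm_group by (simp add: hom_one comm_group_def)
qed (use assms in \<open>auto simp: hom_mult\<close>)

end

section \<open>Operations on a tensor product induced by bilinear operations on its factors\<close>

definition bilinear_op ::
    "('a, 'z) ring_scheme \<Rightarrow> ('a, 'x) module \<Rightarrow> ('a, 'm) module \<Rightarrow> ('x \<Rightarrow> 'm \<Rightarrow> 'm) \<Rightarrow> bool"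
  where "bilinear_op A X M f \<longleftrightarrow>
    (\<forall>x\<in>carrier X. \<forall>m\<in>carrier M. f x m \<in> carrier M) \<and>
    (\<forall>x\<in>carrier X. \<forall>x'\<in>carrier X. \<forall>m\<in>carrier M. f (x \<oplus>\<^bsub>X\<^esub> x') m = f x m \<oplus>\<^bsub>M\<^esub> f x' m) \<and>
    (\<forall>x\<in>carrier X. \<forall>m\<in>carrier M. \<forall>m'\<in>carrier M. f x (m \<oplus>\<^bsub>M\<^esub> m') = f x m \<oplus>\<^bsub>M\<^esub> f x m') \<and>
    (\<forall>a\<in>carrier A. \<forall>x\<in>carrier X. \<forall>m\<in>carrier M. f (a \<odot>\<^bsub>X\<^esub> x) m = a \<odot>\<^bsub>M\<^esub> f x m) \<and>
    (\<forall>a\<in>carrier A. \<forall>x\<in>carrier X. \<forall>m\<in>carrier M. f x (a \<odot>\<^bsub>M\<^esub> m) = a \<odot>\<^bsub>M\<^esub> f x m)"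

lemma bilinear_opD:
  assumes "bilinear_op A X M f"
  shows "\<lbrakk> x \<in> carrier X; m \<in> carrier M \<rbrakk> \<Longrightarrow> f x m \<in> carrier M"
    and "\<lbrakk> x \<in> carrier X; x' \<in> carrier X; m \<in> carrier M \<rbrakk> \<Longrightarrow> f (x \<oplus>\<^bsub>X\<^esub> x') m = f x m \<oplus>\<^bsub>M\<^esub> f x' m"
    and "\<lbrakk> x \<in> carrier X; m \<in> carrier M; m' \<in> carrier M \<rbrakk> \<Longrightarrow> f x (m \<oplus>\<^bsub>M\<^esub> m') = f x m \<oplus>\<^bsub>M\<^esub> f x m'"
    and "\<lbrakk> a \<in> carrier A; x \<in> carrier X; m \<in> carrier M \<rbrakk> \<Longrightarrow> f (a \<odot>\<^bsub>X\<^esub> x) m = a \<odot>\<^bsub>M\<^esub> f x m"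
    and "\<lbrakk> a \<in> carrier A; x \<in> carrier X; m \<in> carrier M \<rbrakk> \<Longrightarrow> f x (a \<odot>\<^bsub>M\<^esub> m) = a \<odot>\<^bsub>M\<^esub> f x m"
  using assms unfolding bilinear_op_def by blast+

text \<open>In the instances below \<open>f\<close> is the multiplication of \<open>B\<close> in
  either order, while \<open>g\<close> is the action of \<open>R\<close> on \<open>P\<close>,
  evaluation of endomorphisms, or the product of double centralisers.\<close>

locale tensor_pairing_factors = tensor_factors A M N + XY: tensor_factors A X Y
  for A :: "('a, 'z) ring_scheme" and M :: "('a, 'm) module" and N :: "('a, 'n) module"
    and X :: "('a, 'x) module" and Y :: "('a, 'y) module" +
  fixes f :: "'x \<Rightarrow> 'm \<Rightarrow> 'm" and g :: "'y \<Rightarrow> 'n \<Rightarrow> 'n"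
  assumes f: "bilinear_op A X M f" and g: "bilinear_op A Y N g"
begin

interpretation T: comm_group T by (rule tensor_group_comm_group)

abbreviation "inner x y \<equiv> tensor_lift T (\<lambda>x' y'. pt (f x x') (g y y'))"

lemma inner_balanced:
  assumes "x \<in> carrier X" "y \<in> carrier Y"
  shows "balanced T (\<lambda>x' y'. pt (f x x') (g y y'))"
  by (rule balancedI)
    (use assms in \<open>simp_all add: bilinear_opD[OF f] bilinear_opD[OF g] pure_add_left pure_add_right pure_smult\<close>)

lemmas inner_hom = tensor_lift_hom[OF tensor_group_comm_group inner_balanced]
lemmas inner_pure = tensor_lift_pure[OF tensor_group_comm_group inner_balanced]

text \<open>Each identity equates two homomorphisms in \<open>w\<close>, so it is enough to check
  pure tensors, where it is bilinearity of \<open>f\<close> or \<open>g\<close>.\<close>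

lemma outer_balanced:
  assumes "w \<in> carrier T"
  shows "XY.balanced T (\<lambda>x y. inner x y w)"
proof (rule XY.balancedI)
  have X: "module A X" and Y: "module A Y" by (rule XY.module_M XY.module_N)+
  note cl = abelian_monoid.a_closed[OF abelian_group.axioms(1)] module.axioms(2) module.smult_closed
  show "inner x y w \<in> carrier T" if "x \<in> carrier X" "y \<in> carrier Y" for x y
    using hom_in_carrier[OF inner_hom[OF that] assms] .
  show "inner (x \<oplus>\<^bsub>X\<^esub> x') y w = inner x y w \<otimes>\<^bsub>T\<^esub> inner x' y w"
    if "x \<in> carrier X" "x' \<in> carrier X" "y \<in> carrier Y" for x x' y
    by (rule tensor_hom_eqI[where h' = "\<lambda>w. inner x y w \<otimes>\<^bsub>T\<^esub> inner x' y w", OF T.is_group inner_hom _ _ assms])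
      (use that X Y in \<open>auto intro!: T.hom_group_mult inner_hom
        simp: cl inner_pure bilinear_opD[OF f] bilinear_opD[OF g] pure_add_left\<close>)
  show "inner x (y \<oplus>\<^bsub>Y\<^esub> y') w = inner x y w \<otimes>\<^bsub>T\<^esub> inner x y' w"
    if "x \<in> carrier X" "y \<in> carrier Y" "y' \<in> carrier Y" for x y y'
    by (rule tensor_hom_eqI[where h' = "\<lambda>w. inner x y w \<otimes>\<^bsub>T\<^esub> inner x y' w", OF T.is_group inner_hom _ _ assms])
      (use that X Y in \<open>auto intro!: T.hom_group_mult inner_hom
        simp: cl inner_pure bilinear_opD[OF f] bilinear_opD[OF g] pure_add_right\<close>)
  show "inner (a \<odot>\<^bsub>X\<^esub> x) y w = inner x (a \<odot>\<^bsub>Y\<^esub> y) w"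
    if "a \<in> carrier A" "x \<in> carrier X" "y \<in> carrier Y" for a x y
    by (rule tensor_hom_eqI[OF T.is_group inner_hom inner_hom _ assms])
      (use that X Y in \<open>auto simp: cl inner_pure bilinear_opD[OF f] bilinear_opD[OF g] pure_smult\<close>)
qed

abbreviation "pairing \<equiv> tensor_pairing A M N f g"

lemma pairing_hom_left: "w \<in> carrier T \<Longrightarrow> (\<lambda>u. pairing u w) \<in> hom XY.T T"
  unfolding tensor_pairing_def by (rule XY.tensor_lift_hom[OF tensor_group_comm_group outer_balanced])

lemma pairing_pure_left:
  "\<lbrakk> x \<in> carrier X; y \<in> carrier Y; w \<in> carrier T \<rbrakk> \<Longrightarrow> pairing (XY.pt x y) w = inner x y w"
  unfolding tensor_pairing_def by (rule XY.tensor_lift_pure[OF tensor_group_comm_group outer_balanced])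

lemma pairing_pure [simp]:
  "\<lbrakk> x \<in> carrier X; y \<in> carrier Y; x' \<in> carrier M; y' \<in> carrier N \<rbrakk>
   \<Longrightarrow> pairing (XY.pt x y) (pt x' y') = pt (f x x') (g y y')"
  by (simp add: pairing_pure_left inner_pure)

lemma pairing_closed [simp]: "\<lbrakk> u \<in> carrier XY.T; w \<in> carrier T \<rbrakk> \<Longrightarrow> pairing u w \<in> carrier T"
  using hom_in_carrier[OF pairing_hom_left] .

lemma pairing_add_left:
  "\<lbrakk> u \<in> carrier XY.T; v \<in> carrier XY.T; w \<in> carrier T \<rbrakk>
   \<Longrightarrow> pairing (u \<otimes>\<^bsub>XY.T\<^esub> v) w = pairing u w \<otimes>\<^bsub>T\<^esub> pairing v w"
  using hom_mult[OF pairing_hom_left] .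

text \<open>The outer lift is in \<open>u\<close>, so additivity in the other argument is not
  immediate. For fixed \<open>v\<close> and \<open>w\<close> both sides are homomorphisms in
  \<open>u\<close>, and for pure \<open>u\<close> the pairing is the homomorphism
  \<open>inner\<close>.\<close>

lemma pairing_hom_right:
  assumes "u \<in> carrier XY.T"
  shows "(\<lambda>w. pairing u w) \<in> hom T T"
proof (rule homI)
  show "pairing u (v \<otimes>\<^bsub>T\<^esub> w) = pairing u v \<otimes>\<^bsub>T\<^esub> pairing u w" if vw: "v \<in> carrier T" "w \<in> carrier T" for v w
    by (rule XY.tensor_hom_eqI[where h' = "\<lambda>u. pairing u v \<otimes>\<^bsub>T\<^esub> pairing u w", OF T.is_group _ _ _ assms])
      (use vw in \<open>auto intro!: T.hom_group_mult pairing_hom_left simp: pairing_pure_left hom_mult[OF inner_hom]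
        XY.tensor_group_comm_group comm_group.axioms\<close>)
qed (use assms in simp)

end

section \<open>Endomorphism algebras\<close>

lemma restrict_scalars_simps [simp]:
  "carrier (restrict_scalars R P) = carrier P"
  "ring.zero (restrict_scalars R P) = ring.zero P"
  "ring.add (restrict_scalars R P) = ring.add P"
  "smult (restrict_scalars R P) a p = (a \<odot>\<^bsub>R\<^esub> \<one>\<^bsub>R\<^esub>) \<odot>\<^bsub>P\<^esub> p"
  by (simp_all add: restrict_scalars_def)

lemma eval_module_simps [simp]:
  "carrier (eval_module P) = carrier P"
  "ring.zero (eval_module P) = ring.zero P"
  "ring.add (eval_module P) = ring.add P"
  "smult (eval_module P) f p = f p"
  by (simp_all add: eval_module_def)

lemma End_alg_simps:
  "monoid.mult (End_alg R P) f g = compose (carrier P) f g"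
  "\<one>\<^bsub>End_alg R P\<^esub> = (\<lambda>x\<in>carrier P. x)"
  "\<zero>\<^bsub>End_alg R P\<^esub> = (\<lambda>x\<in>carrier P. \<zero>\<^bsub>P\<^esub>)"
  "f \<oplus>\<^bsub>End_alg R P\<^esub> g = (\<lambda>x\<in>carrier P. f x \<oplus>\<^bsub>P\<^esub> g x)"
  "a \<odot>\<^bsub>End_alg R P\<^esub> f = (\<lambda>x\<in>carrier P. (a \<odot>\<^bsub>R\<^esub> \<one>\<^bsub>R\<^esub>) \<odot>\<^bsub>P\<^esub> f x)"
  by (simp_all add: End_alg_def)

lemma End_alg_carrier_iff:
  "f \<in> carrier (End_alg R P) \<longleftrightarrow> f \<in> extensional (carrier P) \<and> (\<forall>x\<in>carrier P. f x \<in> carrier P) \<and>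
    (\<forall>x\<in>carrier P. \<forall>y\<in>carrier P. f (x \<oplus>\<^bsub>P\<^esub> y) = f x \<oplus>\<^bsub>P\<^esub> f y) \<and>
    (\<forall>r\<in>carrier R. \<forall>x\<in>carrier P. f (r \<odot>\<^bsub>P\<^esub> x) = r \<odot>\<^bsub>P\<^esub> f x)"
  by (auto simp: End_alg_def left_module_hom_def)

lemma End_algD:
  assumes "f \<in> carrier (End_alg R P)"
  shows "f \<in> extensional (carrier P)"
    and "x \<in> carrier P \<Longrightarrow> f x \<in> carrier P"
    and "\<lbrakk> x \<in> carrier P; y \<in> carrier P \<rbrakk> \<Longrightarrow> f (x \<oplus>\<^bsub>P\<^esub> y) = f x \<oplus>\<^bsub>P\<^esub> f y"
    and "\<lbrakk> r \<in> carrier R; x \<in> carrier P \<rbrakk> \<Longrightarrow> f (r \<odot>\<^bsub>P\<^esub> x) = r \<odot>\<^bsub>P\<^esub> f x"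
  using assms by (auto simp: End_alg_carrier_iff)

lemma End_algI:
  assumes "f \<in> extensional (carrier P)"
    and "\<And>x. x \<in> carrier P \<Longrightarrow> f x \<in> carrier P"
    and "\<And>x y. \<lbrakk> x \<in> carrier P; y \<in> carrier P \<rbrakk> \<Longrightarrow> f (x \<oplus>\<^bsub>P\<^esub> y) = f x \<oplus>\<^bsub>P\<^esub> f y"
    and "\<And>r x. \<lbrakk> r \<in> carrier R; x \<in> carrier P \<rbrakk> \<Longrightarrow> f (r \<odot>\<^bsub>P\<^esub> x) = r \<odot>\<^bsub>P\<^esub> f x"
  shows "f \<in> carrier (End_alg R P)"
  using assms by (simp add: End_alg_carrier_iff)

locale algebra_module =
  fixes A :: "('a, 'z) ring_scheme" and R :: "('a, 'r) module" and P :: "('r, 'p) module"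
  assumes assoc_algebra: "assoc_algebra A R" and left_module: "left_module R P"
begin

interpretation R: assoc_algebra A R by (rule assoc_algebra)
interpretation P: left_module R P by (rule left_module)

text \<open>The multiple of 1 by \<open>a\<close> is central in \<open>R\<close>, so
  \<open>A\<close> acts on \<open>P\<close> by endomorphisms over \<open>R\<close>.\<close>

lemma scalar_commute:
  assumes "a \<in> carrier A" "r \<in> carrier R" "x \<in> carrier P"
  shows "(a \<odot>\<^bsub>R\<^esub> \<one>\<^bsub>R\<^esub>) \<odot>\<^bsub>P\<^esub> (r \<odot>\<^bsub>P\<^esub> x) = (a \<odot>\<^bsub>R\<^esub> r) \<odot>\<^bsub>P\<^esub> x"
    and "r \<odot>\<^bsub>P\<^esub> ((a \<odot>\<^bsub>R\<^esub> \<one>\<^bsub>R\<^esub>) \<odot>\<^bsub>P\<^esub> x) = (a \<odot>\<^bsub>R\<^esub> r) \<odot>\<^bsub>P\<^esub> x"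
  using assms by (simp_all add: P.smult_assoc[symmetric] R.smult_mult_left R.smult_mult_right)

lemma restrict_scalars_module: "module A (restrict_scalars R P)"
proof (rule moduleI)
  show "cring A" by (rule R.R.is_cring)
  show "abelian_group (restrict_scalars R P)"
    by (rule abelian_groupI) (auto simp: P.M.a_ac intro: P.M.l_neg P.M.a_inv_closed)
  show "(a \<otimes>\<^bsub>A\<^esub> b) \<odot>\<^bsub>restrict_scalars R P\<^esub> x = a \<odot>\<^bsub>restrict_scalars R P\<^esub> (b \<odot>\<^bsub>restrict_scalars R P\<^esub> x)"
    if "a \<in> carrier A" "b \<in> carrier A" "x \<in> carrier (restrict_scalars R P)" for a b x
    using that scalar_commute(1)[of a "b \<odot>\<^bsub>R\<^esub> \<one>\<^bsub>R\<^esub>" x] by (simp add: R.smult_assoc1)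
qed (auto simp: P.smult_closed R.smult_l_distr P.smult_l_distr P.smult_r_distr P.smult_one)

lemma smult_zero: "r \<in> carrier R \<Longrightarrow> r \<odot>\<^bsub>P\<^esub> \<zero>\<^bsub>P\<^esub> = \<zero>\<^bsub>P\<^esub>"
  using P.smult_r_distr[of r "\<zero>\<^bsub>P\<^esub>" "\<zero>\<^bsub>P\<^esub>"] P.smult_closed[of r "\<zero>\<^bsub>P\<^esub>"] by (simp add: P.M.add.r_cancel_one')

lemma End_scalar:
  assumes "f \<in> carrier (End_alg R P)" "a \<in> carrier A" "x \<in> carrier P"
  shows "f ((a \<odot>\<^bsub>R\<^esub> \<one>\<^bsub>R\<^esub>) \<odot>\<^bsub>P\<^esub> x) = (a \<odot>\<^bsub>R\<^esub> \<one>\<^bsub>R\<^esub>) \<odot>\<^bsub>P\<^esub> f x"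
  using assms by (simp add: End_algD)

lemma End_alg_eqI:
  "\<lbrakk> f \<in> carrier (End_alg R P); g \<in> carrier (End_alg R P); \<And>x. x \<in> carrier P \<Longrightarrow> f x = g x \<rbrakk> \<Longrightarrow> f = g"
  by (meson End_algD(1) extensionalityI)

lemma End_alg_closed:
  shows "\<lbrakk> f \<in> carrier (End_alg R P); g \<in> carrier (End_alg R P) \<rbrakk> \<Longrightarrow> f \<oplus>\<^bsub>End_alg R P\<^esub> g \<in> carrier (End_alg R P)"
    and "\<lbrakk> f \<in> carrier (End_alg R P); g \<in> carrier (End_alg R P) \<rbrakk> \<Longrightarrow> f \<otimes>\<^bsub>End_alg R P\<^esub> g \<in> carrier (End_alg R P)"
    and "\<zero>\<^bsub>End_alg R P\<^esub> \<in> carrier (End_alg R P)"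
    and "\<one>\<^bsub>End_alg R P\<^esub> \<in> carrier (End_alg R P)"
    and "\<lbrakk> a \<in> carrier A; f \<in> carrier (End_alg R P) \<rbrakk> \<Longrightarrow> a \<odot>\<^bsub>End_alg R P\<^esub> f \<in> carrier (End_alg R P)"
  subgoal by (rule End_algI) (auto simp: End_alg_simps End_algD P.smult_closed P.smult_r_distr P.M.a_ac)
  subgoal by (rule End_algI) (auto simp: End_alg_simps End_algD compose_def P.smult_closed)
  subgoal by (rule End_algI) (auto simp: End_alg_simps P.smult_closed smult_zero)
  subgoal by (rule End_algI) (auto simp: End_alg_simps P.smult_closed)
  subgoal by (rule End_algI) (auto simp: End_alg_simps End_algD P.smult_closed P.smult_r_distr scalar_commute)
  done

lemma End_alg_abelian_group: "abelian_group (End_alg R P)"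
proof (rule abelian_groupI)
  fix f assume f: "f \<in> carrier (End_alg R P)"
  have m1: "\<ominus>\<^bsub>A\<^esub> \<one>\<^bsub>A\<^esub> \<in> carrier A" by simp
  \<comment> \<open>The negative is taken as a multiple by -1, since closure under scalars is
    already known.\<close>
  let ?g = "(\<ominus>\<^bsub>A\<^esub> \<one>\<^bsub>A\<^esub>) \<odot>\<^bsub>End_alg R P\<^esub> f"
  interpret Q: module A "restrict_scalars R P" by (rule restrict_scalars_module)
  have *: "((\<ominus>\<^bsub>A\<^esub> \<one>\<^bsub>A\<^esub>) \<odot>\<^bsub>R\<^esub> \<one>\<^bsub>R\<^esub>) \<odot>\<^bsub>P\<^esub> x \<oplus>\<^bsub>P\<^esub> x = \<zero>\<^bsub>P\<^esub>" if x: "x \<in> carrier P" for x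
    using Q.smult_l_distr[of "\<ominus>\<^bsub>A\<^esub> \<one>\<^bsub>A\<^esub>" "\<one>\<^bsub>A\<^esub>" x] Q.smult_l_null[of x] Q.smult_one[of x] x
    by (simp add: R.R.l_neg)
  have "?g \<oplus>\<^bsub>End_alg R P\<^esub> f = \<zero>\<^bsub>End_alg R P\<^esub>"
    using f by (intro End_alg_eqI End_alg_closed m1) (simp_all add: End_alg_simps End_algD *)
  then show "\<exists>g\<in>carrier (End_alg R P). g \<oplus>\<^bsub>End_alg R P\<^esub> f = \<zero>\<^bsub>End_alg R P\<^esub>"
    using End_alg_closed(5)[OF m1 f] by blast
next
  fix f assume f: "f \<in> carrier (End_alg R P)"
  show "\<zero>\<^bsub>End_alg R P\<^esub> \<oplus>\<^bsub>End_alg R P\<^esub> f = f"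
    using f by (intro End_alg_eqI End_alg_closed) (simp_all add: End_alg_simps End_algD)
qed (simp_all add: End_alg_closed, auto intro!: ext P.M.a_comm P.M.a_assoc simp: End_alg_simps End_algD)

lemma End_alg_ring: "ring (End_alg R P)"
proof (rule ringI)
  show "monoid (End_alg R P)"
  proof (rule monoidI)
    fix f assume f: "f \<in> carrier (End_alg R P)"
    show "\<one>\<^bsub>End_alg R P\<^esub> \<otimes>\<^bsub>End_alg R P\<^esub> f = f"
      by (rule End_alg_eqI)
        (use f in \<open>simp_all add: End_alg_closed, simp_all add: End_alg_simps compose_def End_algD\<close>)
    show "f \<otimes>\<^bsub>End_alg R P\<^esub> \<one>\<^bsub>End_alg R P\<^esub> = f"
      by (rule End_alg_eqI)
        (use f in \<open>simp_all add: End_alg_closed, simp_all add: End_alg_simps compose_def End_algD\<close>)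
  qed (simp_all add: End_alg_closed, auto intro!: ext simp: End_alg_simps compose_def End_algD)
qed (auto intro!: ext End_alg_abelian_group simp: End_alg_simps compose_def End_algD)

lemma End_alg_module: "module A (End_alg R P)"
proof (rule moduleI)
  interpret Q: module A "restrict_scalars R P" by (rule restrict_scalars_module)
  note Q = Q.smult_l_distr Q.smult_r_distr Q.smult_assoc1 Q.smult_one Q.smult_closed
  note Q' = Q[unfolded restrict_scalars_simps]
  show "cring A" by (rule R.R.is_cring)
  show "abelian_group (End_alg R P)" by (rule End_alg_abelian_group)
  show "a \<odot>\<^bsub>End_alg R P\<^esub> f \<in> carrier (End_alg R P)" if "a \<in> carrier A" "f \<in> carrier (End_alg R P)" for a f
    by (rule End_alg_closed(5)[OF that])
  show "(a \<oplus>\<^bsub>A\<^esub> b) \<odot>\<^bsub>End_alg R P\<^esub> f = a \<odot>\<^bsub>End_alg R P\<^esub> f \<oplus>\<^bsub>End_alg R P\<^esub> b \<odot>\<^bsub>End_alg R P\<^esub> f"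
    if "a \<in> carrier A" "b \<in> carrier A" "f \<in> carrier (End_alg R P)" for a b f
    using that by (auto intro!: ext simp: End_alg_simps End_algD Q')
  show "a \<odot>\<^bsub>End_alg R P\<^esub> (f \<oplus>\<^bsub>End_alg R P\<^esub> g) = a \<odot>\<^bsub>End_alg R P\<^esub> f \<oplus>\<^bsub>End_alg R P\<^esub> a \<odot>\<^bsub>End_alg R P\<^esub> g"
    if "a \<in> carrier A" "f \<in> carrier (End_alg R P)" "g \<in> carrier (End_alg R P)" for a f g
    using that by (auto intro!: ext simp: End_alg_simps End_algD Q')
  show "(a \<otimes>\<^bsub>A\<^esub> b) \<odot>\<^bsub>End_alg R P\<^esub> f = a \<odot>\<^bsub>End_alg R P\<^esub> (b \<odot>\<^bsub>End_alg R P\<^esub> f)"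
    if "a \<in> carrier A" "b \<in> carrier A" "f \<in> carrier (End_alg R P)" for a b f
    using that by (auto intro!: ext simp: End_alg_simps End_algD Q')
  show "\<one>\<^bsub>A\<^esub> \<odot>\<^bsub>End_alg R P\<^esub> f = f" if "f \<in> carrier (End_alg R P)" for f
    using that by (intro End_alg_eqI End_alg_closed) (simp_all add: End_alg_simps End_algD P.smult_one)
qed

lemma End_alg_assoc_algebra: "assoc_algebra A (End_alg R P)"
proof (intro assoc_algebra.intro assoc_algebra_axioms.intro End_alg_module End_alg_ring)
  interpret Q: module A "restrict_scalars R P" by (rule restrict_scalars_module)
  fix a f g
  assume *: "a \<in> carrier A" "f \<in> carrier (End_alg R P)" "g \<in> carrier (End_alg R P)"
  have cl: "(a \<odot>\<^bsub>R\<^esub> \<one>\<^bsub>R\<^esub>) \<odot>\<^bsub>P\<^esub> x \<in> carrier P" if "x \<in> carrier P" for x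
    using Q.smult_closed[of a x] * that by simp
  show "(a \<odot>\<^bsub>End_alg R P\<^esub> f) \<otimes>\<^bsub>End_alg R P\<^esub> g = a \<odot>\<^bsub>End_alg R P\<^esub> (f \<otimes>\<^bsub>End_alg R P\<^esub> g)"
    "f \<otimes>\<^bsub>End_alg R P\<^esub> (a \<odot>\<^bsub>End_alg R P\<^esub> g) = a \<odot>\<^bsub>End_alg R P\<^esub> (f \<otimes>\<^bsub>End_alg R P\<^esub> g)"
    using * cl by (auto intro!: ext simp: End_alg_simps compose_def End_algD End_scalar)
qed

lemma eval_left_module: "left_module (End_alg R P) (eval_module P)"
proof (intro left_module.intro left_module_axioms.intro End_alg_ring)
  show "abelian_group (eval_module P)"
    by (rule abelian_groupI) (auto simp: P.M.a_ac intro: P.M.l_neg P.M.a_inv_closed)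
qed (auto simp: End_algD End_alg_simps compose_def)

text \<open>A double centraliser is an endomorphism algebra over \<open>End_alg R P\<close>. Through
  this instance every fact of the present locale also holds for double centralisers.\<close>

lemma algebra_module_End: "algebra_module A (End_alg R P) (eval_module P)"
  by (intro algebra_module.intro End_alg_assoc_algebra eval_left_module)

end

section \<open>Coordinates on free modules\<close>

lemma hom_finprod:
  assumes "comm_group G" "comm_group H" "h \<in> hom G H" "finite I" "\<And>i. i \<in> I \<Longrightarrow> g i \<in> carrier G"
  shows "h (finprod G g I) = finprod H (\<lambda>i. h (g i)) I"
  using assms(4-)
proof (induction I rule: finite_induct)
  interpret G: comm_group G by fact
  interpret H: comm_group H by fact
  interpret h: group_hom G H h
    by (simp add: group_hom_def group_hom_axioms_def G.is_group H.is_group assms(3))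
  {
    case empty
    then show ?case by simp
  next
    case (insert i I)
    have "finprod G g (insert i I) = g i \<otimes>\<^bsub>G\<^esub> finprod G g I"
      using insert by (intro G.finprod_insert) auto
    moreover have "finprod G g I \<in> carrier G" using insert by (intro G.finprod_closed) auto
    moreover have "finprod H (\<lambda>i. h (g i)) (insert i I) = h (g i) \<otimes>\<^bsub>H\<^esub> finprod H (\<lambda>i. h (g i)) I"
      using insert by (intro H.finprod_insert) auto
    ultimately show ?case using insert by simp
  }
qed

lemma finprod_hom:
  assumes "comm_group H" "\<And>i. i \<in> I \<Longrightarrow> h i \<in> hom G H"
  shows "(\<lambda>x. finprod H (\<lambda>i. h i x) I) \<in> hom G H"
proof (rule homI)
  interpret H: comm_group H by fact
  note cl = hom_in_carrier[OF assms(2)]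
  show "finprod H (\<lambda>i. h i x) I \<in> carrier H" if "x \<in> carrier G" for x
    using cl that by (intro H.finprod_closed) auto
  show "finprod H (\<lambda>i. h i (x \<otimes>\<^bsub>G\<^esub> y)) I = finprod H (\<lambda>i. h i x) I \<otimes>\<^bsub>H\<^esub> finprod H (\<lambda>i. h i y) I"
    if xy: "x \<in> carrier G" "y \<in> carrier G" for x y
  proof -
    have "finprod H (\<lambda>i. h i (x \<otimes>\<^bsub>G\<^esub> y)) I = finprod H (\<lambda>i. h i x \<otimes>\<^bsub>H\<^esub> h i y) I"
      by (rule H.finprod_cong') (use cl xy hom_mult[OF assms(2)] in auto)
    also have "\<dots> = finprod H (\<lambda>i. h i x) I \<otimes>\<^bsub>H\<^esub> finprod H (\<lambda>i. h i y) I"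
      using cl xy by (intro H.finprod_multf) auto
    finally show ?thesis .
  qed
qed

lemma additive_finsum:
  assumes "abelian_group M" "abelian_group N"
    and "\<And>x. x \<in> carrier M \<Longrightarrow> h x \<in> carrier N"
    and "\<And>x y. \<lbrakk> x \<in> carrier M; y \<in> carrier M \<rbrakk> \<Longrightarrow> h (x \<oplus>\<^bsub>M\<^esub> y) = h x \<oplus>\<^bsub>N\<^esub> h y"
    and "finite I" "\<And>i. i \<in> I \<Longrightarrow> g i \<in> carrier M"
  shows "h (\<Oplus>\<^bsub>M\<^esub>i\<in>I. g i) = (\<Oplus>\<^bsub>N\<^esub>i\<in>I. h (g i))"
  unfolding finsum_def
  by (rule hom_finprod) (use assms in \<open>auto intro: abelian_group.a_comm_group homI\<close>)

text \<open>Coordinate functions take the place of the unique coefficient families in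
  \<open>free_of_finite_rank\<close>. Closure and linearity of \<open>co\<close> carry no bound on
  the index, which spares a case distinction at each use.\<close>

locale based_module = module A Q
  for A :: "('a, 'z) ring_scheme" (structure) and Q :: "('a, 'q) module" (structure) +
  fixes n :: nat and e :: "nat \<Rightarrow> 'q" and co :: "'q \<Rightarrow> nat \<Rightarrow> 'a"
  assumes e_closed [simp]: "i < n \<Longrightarrow> e i \<in> carrier Q"
    and co_closed [simp]: "p \<in> carrier Q \<Longrightarrow> co p i \<in> carrier A"
    and co_expand: "p \<in> carrier Q \<Longrightarrow> p = (\<Oplus>\<^bsub>Q\<^esub>i\<in>{..<n}. co p i \<odot>\<^bsub>Q\<^esub> e i)"
    and co_sum: "\<lbrakk> k \<in> {..<n} \<rightarrow> carrier A; i < n \<rbrakk> \<Longrightarrow> co (\<Oplus>\<^bsub>Q\<^esub>j\<in>{..<n}. k j \<odot>\<^bsub>Q\<^esub> e j) i = k i"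
    and co_add: "\<lbrakk> p \<in> carrier Q; q \<in> carrier Q \<rbrakk> \<Longrightarrow> co (p \<oplus>\<^bsub>Q\<^esub> q) i = co p i \<oplus> co q i"
    and co_smult: "\<lbrakk> a \<in> carrier A; p \<in> carrier Q \<rbrakk> \<Longrightarrow> co (a \<odot>\<^bsub>Q\<^esub> p) i = a \<otimes> co p i"

lemma free_of_finite_rank_based:
  assumes "module A Q" "free_of_finite_rank A Q"
  shows "\<exists>n e co. based_module A Q n e co"
proof -
  interpret module A Q by fact
  obtain n e where *: "e \<in> {..<n::nat} \<rightarrow> carrier Q \<and>
    (\<forall>x\<in>carrier Q. \<exists>!c. c \<in> {..<n} \<rightarrow>\<^sub>E carrier A \<and> x = (\<Oplus>\<^bsub>Q\<^esub>i\<in>{..<n}. c i \<odot>\<^bsub>Q\<^esub> e i))"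
    using assms(2) unfolding free_of_finite_rank_def by (elim exE)
  note e = conjunct1[OF *] and ex1 = bspec[OF conjunct2[OF *]]
  define cf where "cf p = (THE c. c \<in> {..<n} \<rightarrow>\<^sub>E carrier A \<and> p = (\<Oplus>\<^bsub>Q\<^esub>i\<in>{..<n}. c i \<odot>\<^bsub>Q\<^esub> e i))" for p
  \<comment> \<open>The value zero beyond \<open>n\<close> makes the clauses without an index bound
    true there.\<close>
  define co where "co p i = (if i < n then cf p i else \<zero>\<^bsub>A\<^esub>)" for p i
  have ei: "e i \<in> carrier Q" if "i < n" for i using e that by auto
  have cf: "cf p \<in> {..<n} \<rightarrow>\<^sub>E carrier A" "p = (\<Oplus>\<^bsub>Q\<^esub>i\<in>{..<n}. cf p i \<odot>\<^bsub>Q\<^esub> e i)" if "p \<in> carrier Q" for p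
    using theI'[OF ex1[OF that]] unfolding cf_def by auto
  have co_closed: "co p i \<in> carrier A" if "p \<in> carrier Q" for p i using cf(1)[OF that] by (auto simp: co_def)
  have expand: "p = (\<Oplus>\<^bsub>Q\<^esub>i\<in>{..<n}. co p i \<odot>\<^bsub>Q\<^esub> e i)" if "p \<in> carrier Q" for p
  proof -
    have "(\<Oplus>\<^bsub>Q\<^esub>i\<in>{..<n}. co p i \<odot>\<^bsub>Q\<^esub> e i) = (\<Oplus>\<^bsub>Q\<^esub>i\<in>{..<n}. cf p i \<odot>\<^bsub>Q\<^esub> e i)"
      using cf(1)[OF that] ei by (intro M.finsum_cong') (auto simp: co_def)
    then show ?thesis using cf(2)[OF that] by simp
  qed
  have co_sum: "co (\<Oplus>\<^bsub>Q\<^esub>j\<in>{..<n}. k j \<odot>\<^bsub>Q\<^esub> e j) i = k i" if k: "k \<in> {..<n} \<rightarrow> carrier A" and i: "i < n" for k i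
  proof -
    let ?p = "\<Oplus>\<^bsub>Q\<^esub>j\<in>{..<n}. k j \<odot>\<^bsub>Q\<^esub> e j"
    have p: "?p \<in> carrier Q" using k ei by (intro M.finsum_closed) auto
    have "?p = (\<Oplus>\<^bsub>Q\<^esub>j\<in>{..<n}. restrict k {..<n} j \<odot>\<^bsub>Q\<^esub> e j)" using k ei by (intro M.finsum_cong') (auto simp: Pi_iff)
    moreover have "restrict k {..<n} \<in> {..<n} \<rightarrow>\<^sub>E carrier A" using k by auto
    ultimately have "cf ?p = restrict k {..<n}" using ex1[OF p] cf[OF p] by blast
    then show ?thesis using i by (simp add: co_def)
  qed
  have co_out: "co p i = \<zero>\<^bsub>A\<^esub>" if "\<not> i < n" for p i using that by (simp add: co_def)
  have "based_module A Q n e co"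
  proof (intro based_module.intro based_module_axioms.intro assms(1) ei co_closed expand co_sum)
    fix p q i assume pq: "p \<in> carrier Q" "q \<in> carrier Q"
    have "p \<oplus>\<^bsub>Q\<^esub> q = (\<Oplus>\<^bsub>Q\<^esub>i\<in>{..<n}. co p i \<odot>\<^bsub>Q\<^esub> e i) \<oplus>\<^bsub>Q\<^esub> (\<Oplus>\<^bsub>Q\<^esub>i\<in>{..<n}. co q i \<odot>\<^bsub>Q\<^esub> e i)"
      using expand pq by simp
    also have "\<dots> = (\<Oplus>\<^bsub>Q\<^esub>i\<in>{..<n}. co p i \<odot>\<^bsub>Q\<^esub> e i \<oplus>\<^bsub>Q\<^esub> co q i \<odot>\<^bsub>Q\<^esub> e i)"
      using ei co_closed pq by (intro M.finsum_addf[symmetric]) auto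
    also have "\<dots> = (\<Oplus>\<^bsub>Q\<^esub>i\<in>{..<n}. (co p i \<oplus>\<^bsub>A\<^esub> co q i) \<odot>\<^bsub>Q\<^esub> e i)"
      using ei co_closed pq by (intro M.finsum_cong') (auto simp: smult_l_distr)
    finally show "co (p \<oplus>\<^bsub>Q\<^esub> q) i = co p i \<oplus>\<^bsub>A\<^esub> co q i"
      using co_sum[of "\<lambda>i. co p i \<oplus>\<^bsub>A\<^esub> co q i" i] co_closed pq co_out by (cases "i < n") auto
  next
    fix a p i assume ap: "a \<in> carrier A" "p \<in> carrier Q"
    have "a \<odot>\<^bsub>Q\<^esub> p = a \<odot>\<^bsub>Q\<^esub> (\<Oplus>\<^bsub>Q\<^esub>i\<in>{..<n}. co p i \<odot>\<^bsub>Q\<^esub> e i)" using expand ap by simp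
    also have "\<dots> = (\<Oplus>\<^bsub>Q\<^esub>i\<in>{..<n}. a \<odot>\<^bsub>Q\<^esub> (co p i \<odot>\<^bsub>Q\<^esub> e i))"
      using ei co_closed ap by (intro finsum_smult_ldistr) auto
    also have "\<dots> = (\<Oplus>\<^bsub>Q\<^esub>i\<in>{..<n}. (a \<otimes>\<^bsub>A\<^esub> co p i) \<odot>\<^bsub>Q\<^esub> e i)"
      using ei co_closed ap by (intro M.finsum_cong') (auto simp: smult_assoc1)
    finally show "co (a \<odot>\<^bsub>Q\<^esub> p) i = a \<otimes>\<^bsub>A\<^esub> co p i"
      using co_sum[of "\<lambda>i. a \<otimes>\<^bsub>A\<^esub> co p i" i] co_closed ap co_out by (cases "i < n") auto
  qed
  then show ?thesis by blast
qed

section \<open>Matrices and linear maps in a basis\<close>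

context based_module
begin

lemma co_eqI:
  assumes "p \<in> carrier Q" "q \<in> carrier Q" "\<And>i. i < n \<Longrightarrow> co p i = co q i"
  shows "p = q"
proof -
  have "(\<Oplus>\<^bsub>Q\<^esub>i\<in>{..<n}. co p i \<odot>\<^bsub>Q\<^esub> e i) = (\<Oplus>\<^bsub>Q\<^esub>i\<in>{..<n}. co q i \<odot>\<^bsub>Q\<^esub> e i)"
    using assms by (intro M.finsum_cong') auto
  then show ?thesis using co_expand assms by metis
qed

lemma co_basis: "\<lbrakk> a < n; b < n \<rbrakk> \<Longrightarrow> co (e a) b = (if b = a then \<one> else \<zero>)"
proof -
  assume ab: "a < n" "b < n"
  have "(\<Oplus>\<^bsub>Q\<^esub>j\<in>{..<n}. (if j = a then \<one> else \<zero>) \<odot>\<^bsub>Q\<^esub> e j) = (\<Oplus>\<^bsub>Q\<^esub>j\<in>{..<n}. if j = a then e j else \<zero>\<^bsub>Q\<^esub>)"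
    by (intro M.finsum_cong') auto
  also have "\<dots> = e a" using M.add.finprod_singleton_swap[of a "{..<n}" e] ab by auto
  finally show ?thesis using co_sum[of "\<lambda>j. if j = a then \<one> else \<zero>" b] ab by auto
qed

text \<open>Index pairs are (row, column): \<open>x (b, a)\<close> is the coefficient of
  \<open>e b\<close> in the image of \<open>e a\<close>.\<close>

definition linmap :: "(nat \<times> nat \<Rightarrow> 'a) \<Rightarrow> 'q \<Rightarrow> 'q"
  where "linmap x = (\<lambda>p\<in>carrier Q. \<Oplus>\<^bsub>Q\<^esub>b\<in>{..<n}. (\<Oplus>a\<in>{..<n}. co p a \<otimes> x (b, a)) \<odot>\<^bsub>Q\<^esub> e b)"

lemma linmap_row_closed:
  "\<lbrakk> x \<in> UNIV \<rightarrow> carrier A; p \<in> carrier Q \<rbrakk> \<Longrightarrow> (\<Oplus>a\<in>{..<n}. co p a \<otimes> x (b, a)) \<in> carrier A"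
  by (intro R.finsum_closed) (auto simp: Pi_iff)

lemma linmap_closed: "\<lbrakk> x \<in> UNIV \<rightarrow> carrier A; p \<in> carrier Q \<rbrakk> \<Longrightarrow> linmap x p \<in> carrier Q"
  unfolding linmap_def by (auto intro!: M.finsum_closed linmap_row_closed)

lemma co_linmap:
  "\<lbrakk> x \<in> UNIV \<rightarrow> carrier A; p \<in> carrier Q; b < n \<rbrakk> \<Longrightarrow> co (linmap x p) b = (\<Oplus>a\<in>{..<n}. co p a \<otimes> x (b, a))"
  unfolding linmap_def by (simp add: co_sum linmap_row_closed Pi_iff)

lemma linmap_add:
  assumes "x \<in> UNIV \<rightarrow> carrier A" "p \<in> carrier Q" "q \<in> carrier Q"
  shows "linmap x (p \<oplus>\<^bsub>Q\<^esub> q) = linmap x p \<oplus>\<^bsub>Q\<^esub> linmap x q"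
proof (rule co_eqI)
  fix b assume b: "b < n"
  have "(\<Oplus>a\<in>{..<n}. (co p a \<oplus> co q a) \<otimes> x (b, a)) = (\<Oplus>a\<in>{..<n}. co p a \<otimes> x (b, a) \<oplus> co q a \<otimes> x (b, a))"
    using assms by (intro R.finsum_cong') (auto simp: Pi_iff R.l_distr)
  also have "\<dots> = (\<Oplus>a\<in>{..<n}. co p a \<otimes> x (b, a)) \<oplus> (\<Oplus>a\<in>{..<n}. co q a \<otimes> x (b, a))"
    using assms by (intro R.finsum_addf) (auto simp: Pi_iff)
  finally show "co (linmap x (p \<oplus>\<^bsub>Q\<^esub> q)) b = co (linmap x p \<oplus>\<^bsub>Q\<^esub> linmap x q) b"
    using assms b by (simp add: co_linmap co_add linmap_closed)
qed (use assms in \<open>auto intro: linmap_closed\<close>)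

lemma linmap_smult:
  assumes "x \<in> UNIV \<rightarrow> carrier A" "p \<in> carrier Q" "k \<in> carrier A"
  shows "linmap x (k \<odot>\<^bsub>Q\<^esub> p) = k \<odot>\<^bsub>Q\<^esub> linmap x p"
proof (rule co_eqI)
  fix b assume b: "b < n"
  have "(\<Oplus>a\<in>{..<n}. (k \<otimes> co p a) \<otimes> x (b, a)) = (\<Oplus>a\<in>{..<n}. k \<otimes> (co p a \<otimes> x (b, a)))"
    using assms by (intro R.finsum_cong') (auto simp: Pi_iff R.m_assoc)
  also have "\<dots> = k \<otimes> (\<Oplus>a\<in>{..<n}. co p a \<otimes> x (b, a))"
    using assms by (intro R.finsum_rdistr[symmetric]) (auto simp: Pi_iff)
  finally show "co (linmap x (k \<odot>\<^bsub>Q\<^esub> p)) b = co (k \<odot>\<^bsub>Q\<^esub> linmap x p) b"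
    using assms b by (simp add: co_linmap co_smult linmap_closed)
qed (use assms in \<open>auto intro: linmap_closed\<close>)

lemma co_linmap_basis:
  assumes "x \<in> UNIV \<rightarrow> carrier A" "a < n" "b < n"
  shows "co (linmap x (e a)) b = x (b, a)"
proof -
  have "(\<Oplus>j\<in>{..<n}. co (e a) j \<otimes> x (b, j)) = (\<Oplus>j\<in>{..<n}. if j = a then x (b, j) else \<zero>)"
    using assms by (intro R.finsum_cong') (auto simp: Pi_iff co_basis)
  also have "\<dots> = x (b, a)" using R.add.finprod_singleton_swap[of a "{..<n}" "\<lambda>j. x (b, j)"] assms by (auto simp: Pi_iff)
  finally show ?thesis using assms by (simp add: co_linmap)
qed

lemma co_additive_map:
  assumes "\<And>p. p \<in> carrier Q \<Longrightarrow> h p \<in> carrier Q"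
    and "\<And>p q. \<lbrakk> p \<in> carrier Q; q \<in> carrier Q \<rbrakk> \<Longrightarrow> h (p \<oplus>\<^bsub>Q\<^esub> q) = h p \<oplus>\<^bsub>Q\<^esub> h q"
    and "\<And>k p. \<lbrakk> k \<in> carrier A; p \<in> carrier Q \<rbrakk> \<Longrightarrow> h (k \<odot>\<^bsub>Q\<^esub> p) = k \<odot>\<^bsub>Q\<^esub> h p"
    and p: "p \<in> carrier Q"
  shows "co (h p) b = (\<Oplus>a\<in>{..<n}. co p a \<otimes> co (h (e a)) b)"
proof -
  have "co (h p) b = co (h (\<Oplus>\<^bsub>Q\<^esub>a\<in>{..<n}. co p a \<odot>\<^bsub>Q\<^esub> e a)) b" using co_expand[OF p] by simp
  also have "\<dots> = (\<Oplus>a\<in>{..<n}. co (h (co p a \<odot>\<^bsub>Q\<^esub> e a)) b)"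
    by (rule additive_finsum[where h = "\<lambda>p. co (h p) b", OF M.abelian_group_axioms R.abelian_group_axioms])
      (use assms in \<open>auto simp: co_add\<close>)
  also have "\<dots> = (\<Oplus>a\<in>{..<n}. co p a \<otimes> co (h (e a)) b)"
    using assms by (intro R.finsum_cong') (auto simp: co_smult)
  finally show ?thesis .
qed

end

section \<open>Coordinates with values in B on the module B \<otimes> Q\<close>

locale based_tensor = based_module A Q n e co + B: assoc_algebra A B
  for A :: "('a, 'z) ring_scheme" (structure) and Q :: "('a, 'q) module" (structure)
    and n :: nat and e :: "nat \<Rightarrow> 'q" and co :: "'q \<Rightarrow> nat \<Rightarrow> 'a" and B :: "('a, 'b) module"

sublocale based_tensor \<subseteq> tensor_factors A B Q
  by (intro tensor_factors.intro module_axioms B.module_axioms)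

context based_tensor
begin

interpretation T: comm_group T by (rule tensor_group_comm_group)

text \<open>The coordinate at 1 \<otimes> \<open>e b\<close> when B \<otimes> Q is regarded as a
  free left module over \<open>B\<close>.\<close>

definition eps :: "nat \<Rightarrow> ('b, 'q) tensor \<Rightarrow> 'b"
  where "eps b = tensor_lift (add_monoid B) (\<lambda>x p. co p b \<odot>\<^bsub>B\<^esub> x)"

lemma B_comm_group: "comm_group (add_monoid B)"
  by (rule B.M.a_comm_group)

lemma eps_balanced: "balanced (add_monoid B) (\<lambda>x p. co p b \<odot>\<^bsub>B\<^esub> x)"
proof (rule balancedI)
  fix a x p assume axp: "a \<in> carrier A" "x \<in> carrier B" "p \<in> carrier Q"
  then show "co p b \<odot>\<^bsub>B\<^esub> (a \<odot>\<^bsub>B\<^esub> x) = co (a \<odot>\<^bsub>Q\<^esub> p) b \<odot>\<^bsub>B\<^esub> x"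
    using B.smult_assoc1[of "co p b" a x] R.m_comm[of a "co p b"] by (simp add: co_smult)
qed (simp_all add: co_add B.smult_l_distr B.smult_r_distr)

lemma eps_hom: "eps b \<in> hom T (add_monoid B)"
  unfolding eps_def by (rule tensor_lift_hom[OF B_comm_group eps_balanced])

lemma eps_pure: "\<lbrakk> x \<in> carrier B; p \<in> carrier Q \<rbrakk> \<Longrightarrow> eps b (pt x p) = co p b \<odot>\<^bsub>B\<^esub> x"
  unfolding eps_def by (rule tensor_lift_pure[OF B_comm_group eps_balanced])

lemma eps_closed [simp]: "u \<in> carrier T \<Longrightarrow> eps b u \<in> carrier B"
  using hom_in_carrier[OF eps_hom] by simp

lemma eps_mult: "\<lbrakk> u \<in> carrier T; v \<in> carrier T \<rbrakk> \<Longrightarrow> eps b (u \<otimes>\<^bsub>T\<^esub> v) = eps b u \<oplus>\<^bsub>B\<^esub> eps b v"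
  using hom_mult[OF eps_hom] by simp

lemma pure_hom_left: "p \<in> carrier Q \<Longrightarrow> (\<lambda>x. pt x p) \<in> hom (add_monoid B) T"
  by (rule homI) (simp_all add: pure_add_left)

lemma pure_hom_right: "x \<in> carrier B \<Longrightarrow> (\<lambda>p. pt x p) \<in> hom (add_monoid Q) T"
  by (rule homI) (simp_all add: pure_add_right)

lemma expand_hom: "(\<lambda>w. finprod T (\<lambda>b. pt (eps b w) (e b)) {..<n}) \<in> hom T T"
proof (rule finprod_hom[OF tensor_group_comm_group])
  fix b assume "b \<in> {..<n}"
  then have "e b \<in> carrier Q" by simp
  from hom_compose[OF eps_hom pure_hom_left[OF this]]
  show "(\<lambda>w. pt (eps b w) (e b)) \<in> hom T T" by (simp add: comp_def)
qed

text \<open>The coordinates of \<open>p\<close> lie in \<open>A\<close> and may cross the tensor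
  sign, which settles pure tensors; both sides are homomorphisms in \<open>w\<close>.\<close>

lemma tensor_expand:
  assumes "w \<in> carrier T"
  shows "w = finprod T (\<lambda>b. pt (eps b w) (e b)) {..<n}"
proof (rule tensor_hom_eqI[where h = "\<lambda>w. w", OF T.is_group _ expand_hom _ assms])
  show "(\<lambda>w. w) \<in> hom T T" by (auto simp: hom_def)
  fix x p assume xp: "x \<in> carrier B" "p \<in> carrier Q"
  have "pt x p = pt x (\<Oplus>\<^bsub>Q\<^esub>i\<in>{..<n}. co p i \<odot>\<^bsub>Q\<^esub> e i)" using co_expand[OF xp(2)] by simp
  also have "\<dots> = finprod T (\<lambda>i. pt x (co p i \<odot>\<^bsub>Q\<^esub> e i)) {..<n}"
    unfolding finsum_def by (rule hom_finprod[OF M.a_comm_group tensor_group_comm_group pure_hom_right]) (use xp in auto)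
  also have "\<dots> = finprod T (\<lambda>b. pt (eps b (pt x p)) (e b)) {..<n}"
    using xp by (intro T.finprod_cong') (auto simp: eps_pure pure_smult)
  finally show "pt x p = finprod T (\<lambda>b. pt (eps b (pt x p)) (e b)) {..<n}" .
qed

lemma eps_eqI:
  assumes "u \<in> carrier T" "w \<in> carrier T" "\<And>b. b < n \<Longrightarrow> eps b u = eps b w"
  shows "u = w"
proof -
  have "finprod T (\<lambda>b. pt (eps b u) (e b)) {..<n} = finprod T (\<lambda>b. pt (eps b w) (e b)) {..<n}"
    using assms by (intro T.finprod_cong') auto
  then show ?thesis by (rule trans[OF tensor_expand[OF assms(1)] trans[OF _ tensor_expand[OF assms(2), symmetric]]])
qed

text \<open>Only additivity is assumed, so the test elements keep an arbitrary factor from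
  \<open>B\<close>; this way the criterion serves for maps linear on either side.\<close>

lemma basis_hom_eqI:
  assumes G: "comm_group G" and h: "h \<in> hom T G" "h' \<in> hom T G"
    and eq: "\<And>x a. \<lbrakk> x \<in> carrier B; a < n \<rbrakk> \<Longrightarrow> h (pt x (e a)) = h' (pt x (e a))"
    and w: "w \<in> carrier T"
  shows "h w = h' w"
proof -
  interpret G: comm_group G by fact
  let ?g = "\<lambda>b. pt (eps b w) (e b)"
  have g: "?g b \<in> carrier T" if "b \<in> {..<n}" for b using that w by auto
  have "h w = h (finprod T ?g {..<n})" by (rule arg_cong[OF tensor_expand[OF w]])
  also have "\<dots> = finprod G (\<lambda>b. h (?g b)) {..<n}"
    by (rule hom_finprod[OF tensor_group_comm_group G h(1) _ g]) auto
  also have "\<dots> = finprod G (\<lambda>b. h' (?g b)) {..<n}"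
    by (rule G.finprod_cong') (use w eq g hom_in_carrier[OF h(2)] in auto)
  also have "\<dots> = h' (finprod T ?g {..<n})"
    by (rule hom_finprod[OF tensor_group_comm_group G h(2) _ g, symmetric]) auto
  also have "\<dots> = h' w" by (rule arg_cong[where f = h', OF tensor_expand[OF w, symmetric]])
  finally show ?thesis .
qed

end

section \<open>Base change of double centralisers\<close>

lemma opposite_simps [simp]:
  "carrier (opposite B) = carrier B" "\<zero>\<^bsub>opposite B\<^esub> = \<zero>\<^bsub>B\<^esub>" "\<one>\<^bsub>opposite B\<^esub> = \<one>\<^bsub>B\<^esub>"
  "ring.add (opposite B) = ring.add B" "smult (opposite B) = smult B"
  "x \<otimes>\<^bsub>opposite B\<^esub> y = y \<otimes>\<^bsub>B\<^esub> x"
  by (simp_all add: opposite_def)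

lemma tensor_kernel_cong:
  assumes "carrier M = carrier M'" "ring.add M = ring.add M'"
    and "\<And>a x. \<lbrakk> a \<in> carrier A; x \<in> carrier M' \<rbrakk> \<Longrightarrow> a \<odot>\<^bsub>M\<^esub> x = a \<odot>\<^bsub>M'\<^esub> x"
    and "carrier N = carrier N'" "ring.add N = ring.add N'"
    and "\<And>a x. \<lbrakk> a \<in> carrier A; x \<in> carrier N' \<rbrakk> \<Longrightarrow> a \<odot>\<^bsub>N\<^esub> x = a \<odot>\<^bsub>N'\<^esub> x"
  shows "tensor_kernel A M N = tensor_kernel A M' N'"
proof -
  have "tensor_relators A M N = tensor_relators A M' N'"
    unfolding tensor_relators_def using assms
    by (intro arg_cong2[where f = "(\<union>)"] Collect_cong ex_cong1) auto
  then show ?thesis using assms by (simp add: tensor_kernel_def)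
qed

text \<open>Tensor products see only carriers, additions and the action of \<open>A\<close>. They do
  not change when \<open>B\<close> is replaced by its opposite, or when \<open>P\<close> is viewed
  over its endomorphism ring instead of over \<open>R\<close>.\<close>

lemma tensor_cong:
  assumes "carrier M = carrier M'" "ring.add M = ring.add M'"
    and "\<And>a x. \<lbrakk> a \<in> carrier A; x \<in> carrier M' \<rbrakk> \<Longrightarrow> a \<odot>\<^bsub>M\<^esub> x = a \<odot>\<^bsub>M'\<^esub> x"
    and "carrier N = carrier N'" "ring.add N = ring.add N'"
    and "\<And>a x. \<lbrakk> a \<in> carrier A; x \<in> carrier N' \<rbrakk> \<Longrightarrow> a \<odot>\<^bsub>N\<^esub> x = a \<odot>\<^bsub>N'\<^esub> x"
  shows "tensor_group A M N = tensor_group A M' N'"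
    and "pure_tensor A M N = pure_tensor A M' N'"
    and "tensor_pairing A M N = tensor_pairing A M' N'"
proof -
  note K = tensor_kernel_cong[of M M' A N N', OF assms]
  show 1: "tensor_group A M N = tensor_group A M' N'"
    by (simp add: tensor_group_def K assms(1,4))
  show 2: "pure_tensor A M N = pure_tensor A M' N'"
    by (simp add: pure_tensor_def K assms(1,4) fun_eq_iff)
  show "tensor_pairing A M N = tensor_pairing A M' N'"
    by (simp add: tensor_pairing_def 1 2 fun_eq_iff)
qed

lemma (in algebra_module) bilinear_op_End:
  "bilinear_op A (End_alg R P) (restrict_scalars R P) (\<lambda>\<alpha> p. \<alpha> p)"
  unfolding bilinear_op_def by (auto simp: End_algD End_alg_simps End_scalar)

lemma (in algebra_module) bilinear_op_smult:
  "bilinear_op A R (restrict_scalars R P) (smult P)"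
proof -
  interpret P: left_module R P by (rule left_module)
  show ?thesis
    unfolding bilinear_op_def by (auto simp: P.smult_closed P.smult_l_distr P.smult_r_distr scalar_commute)
qed

lemma bilinear_op_mult:
  fixes B :: "('a, 'b) module"
  assumes "assoc_algebra A B"
  shows "bilinear_op A B B (\<lambda>x y. x \<otimes>\<^bsub>B\<^esub> y)" "bilinear_op A B B (\<lambda>x y. y \<otimes>\<^bsub>B\<^esub> x)"
proof -
  interpret assoc_algebra A B by fact
  show "bilinear_op A B B (\<lambda>x y. x \<otimes>\<^bsub>B\<^esub> y)" "bilinear_op A B B (\<lambda>x y. y \<otimes>\<^bsub>B\<^esub> x)"
    unfolding bilinear_op_def by (auto simp: l_distr r_distr smult_mult_left smult_mult_right)
qed

text \<open>Surjectivity of \<open>Psi\<close> turns commuting with every endomorphism of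
  \<open>P\<^sub>B\<close> into commuting with the operators given by pure tensors x \<otimes>
  \<alpha>.\<close>

locale base_change = algebra_module A R P + based_tensor A "restrict_scalars R P" n e co B
  for A :: "('a, 'z) ring_scheme" (structure) and R :: "('a, 'r) module" and P :: "('r, 'p) module"
    and n :: nat and e :: "nat \<Rightarrow> 'p" and co :: "'p \<Rightarrow> nat \<Rightarrow> 'a" and B :: "('a, 'b) module" +
  assumes Psi_surj: "Psi A B R P ` carrier (tensor_algebra A (opposite B) (End_alg R P))
    = carrier (End_alg (tensor_algebra A B R) (tensor_module A B R P))"
begin

abbreviation "Q \<equiv> restrict_scalars R P"
abbreviation "\<Lambda> \<equiv> End_alg R P"
abbreviation "\<D> \<equiv> DEnd_alg R P"
abbreviation "P\<^sub>B \<equiv> tensor_module A B R P"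
abbreviation "\<Lambda>\<^sub>B \<equiv> End_alg (tensor_algebra A B R) P\<^sub>B"
abbreviation "\<D>\<^sub>B \<equiv> DEnd_alg (tensor_algebra A B R) P\<^sub>B"

lemma eval_algebra_module: "algebra_module A \<Lambda> (eval_module P)"
  by (rule algebra_module_End)

lemma DEnd_module: "module A \<D>"
  unfolding DEnd_alg_def by (rule algebra_module.End_alg_module[OF eval_algebra_module])

text \<open>\<open>A\<close> acts on \<open>P\<close> through \<open>R\<close> and also through
  \<open>\<Lambda>\<close>. The actions agree, because a multiple of the identity map is
  multiplication by the same multiple of 1 in \<open>R\<close>; so \<open>Q\<close> serves for
  both.\<close>

lemma bilinear_op_DEnd: "bilinear_op A \<D> Q (\<lambda>\<sigma> p. \<sigma> p)"
proof -
  have bil: "bilinear_op A \<D> (restrict_scalars \<Lambda> (eval_module P)) (\<lambda>\<sigma> p. \<sigma> p)"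
    unfolding DEnd_alg_def by (rule algebra_module.bilinear_op_End[OF eval_algebra_module])
  have cl [simp]: "\<sigma> p \<in> carrier P" if "\<sigma> \<in> carrier \<D>" "p \<in> carrier P" for \<sigma> p
    using bilinear_opD(1)[OF bil] that by simp
  show ?thesis
    unfolding bilinear_op_def
    using bilinear_opD(2-5)[OF bil] by (simp add: End_alg_simps)
qed

end

text \<open>Three kinds of operators on B \<otimes> P: \<open>L\<close> multiplies on the right by
  elements of \<open>B\<close> and applies endomorphisms over \<open>R\<close>, \<open>D\<close>
  multiplies on the left and applies double centralisers, and \<open>R\<close> is the action of B
  \<otimes> R. Kinds \<open>L\<close> and \<open>D\<close> commute, by associativity of
  \<open>B\<close> and by the definition of double centralisers.\<close>

sublocale base_change \<subseteq> L: tensor_pairing_factors A B "restrict_scalars R P" B "End_alg R P" "\<lambda>x y. y \<otimes>\<^bsub>B\<^esub> x" "\<lambda>\<alpha> p. \<alpha> p"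
  by (intro tensor_pairing_factors.intro tensor_factors.intro tensor_pairing_factors_axioms.intro
      B.module_axioms restrict_scalars_module End_alg_module bilinear_op_mult[OF B.assoc_algebra_axioms] bilinear_op_End)

sublocale base_change \<subseteq> D: tensor_pairing_factors A B "restrict_scalars R P" B "DEnd_alg R P" "\<lambda>x y. x \<otimes>\<^bsub>B\<^esub> y" "\<lambda>\<alpha> p. \<alpha> p"
  by (intro tensor_pairing_factors.intro tensor_factors.intro tensor_pairing_factors_axioms.intro
      B.module_axioms restrict_scalars_module DEnd_module bilinear_op_mult[OF B.assoc_algebra_axioms] bilinear_op_DEnd)

sublocale base_change \<subseteq> R: tensor_pairing_factors A B "restrict_scalars R P" B R "\<lambda>x y. x \<otimes>\<^bsub>B\<^esub> y" "smult P"
  by (intro tensor_pairing_factors.intro tensor_factors.intro tensor_pairing_factors_axioms.intro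
      B.module_axioms restrict_scalars_module assoc_algebra.axioms(1)[OF assoc_algebra]
      bilinear_op_mult[OF B.assoc_algebra_axioms] bilinear_op_smult)

context base_change
begin

interpretation T: comm_group T by (rule tensor_group_comm_group)

abbreviation "P_id \<equiv> (\<lambda>p\<in>carrier P. p)"

lemma tensor_module_simps [simp]:
  "carrier P\<^sub>B = carrier T" "ring.zero P\<^sub>B = \<one>\<^bsub>T\<^esub>" "ring.add P\<^sub>B = monoid.mult T"
  "smult P\<^sub>B = R.pairing"
  by (simp_all add: tensor_module_def)

lemma tensor_opposite:
  "tensor_group A (opposite B) N = tensor_group A B N" "pure_tensor A (opposite B) N = pure_tensor A B N"
  "tensor_pairing A (opposite B) N = tensor_pairing A B N"
  by (rule tensor_cong; simp)+

lemma carrier_Lambda_B: "carrier \<Lambda>\<^sub>B = Psi A B R P ` carrier L.XY.T"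
  using Psi_surj by (simp add: tensor_algebra_def tensor_opposite)

lemma Psi_eq: "Psi A B R P u = (\<lambda>w\<in>carrier T. L.pairing u w)"
  by (simp add: Psi_def)

lemma P_id_in [simp]: "P_id \<in> carrier \<Lambda>"
  using End_alg_closed(4) by (simp add: End_alg_simps)

lemma eval_tensor:
  "tensor_group A B (restrict_scalars \<Lambda> (eval_module P)) = T"
  "tensor_pairing A B (restrict_scalars \<Lambda> (eval_module P)) = tensor_pairing A B Q"
  by (rule tensor_cong; simp add: End_alg_simps)+

text \<open>Two reversals cancel: \<open>Psi\<close> multiplies on the right, but in
  \<open>opposite B\<close>, and this is multiplication on the left in \<open>B\<close>.\<close>

lemma DEnd_map_eq: "DEnd_map A B R P u = (\<lambda>w\<in>carrier T. D.pairing u w)"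
  by (simp add: DEnd_map_def Psi_def tensor_module_def eval_tensor tensor_opposite)

text \<open>The elements of \<open>\<Lambda>\<^sub>B\<close> are the values of \<open>Psi\<close>.
  As \<open>f\<close> is additive, both sides of the commutation are homomorphisms in the argument
  of \<open>Psi\<close>, so pure tensors suffice.\<close>

lemma DEnd_B_I:
  assumes "f \<in> extensional (carrier T)" "f \<in> hom T T"
    and comm: "\<And>x \<alpha> w. \<lbrakk> x \<in> carrier B; \<alpha> \<in> carrier \<Lambda>; w \<in> carrier T \<rbrakk>
      \<Longrightarrow> f (L.pairing (L.XY.pt x \<alpha>) w) = L.pairing (L.XY.pt x \<alpha>) (f w)"
  shows "f \<in> carrier \<D>\<^sub>B"
  unfolding DEnd_alg_def
proof (rule End_algI)
  note fc = hom_in_carrier[OF assms(2)] and fm = hom_mult[OF assms(2)]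
  show "f (r \<odot>\<^bsub>eval_module P\<^sub>B\<^esub> w) = r \<odot>\<^bsub>eval_module P\<^sub>B\<^esub> f w"
    if r: "r \<in> carrier \<Lambda>\<^sub>B" and "w \<in> carrier (eval_module P\<^sub>B)" for r w
  proof -
    have w: "w \<in> carrier T" using that by simp
    obtain u where u: "u \<in> carrier L.XY.T" "r = Psi A B R P u" using r carrier_Lambda_B by auto
    have "f (L.pairing u w) = L.pairing u (f w)"
      by (rule L.XY.tensor_hom_eqI[where h = "\<lambda>u. f (L.pairing u w)", OF T.is_group _ L.pairing_hom_left[OF fc[OF w]] _ u(1)])
        (use w comm in \<open>auto intro!: homI fc simp: L.pairing_add_left fm\<close>)
    then show ?thesis using w fc[OF w] u(2) by (simp add: Psi_eq)
  qed
qed (use assms in \<open>auto simp: hom_mult hom_in_carrier\<close>)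

lemma DEnd_B_D:
  assumes "f \<in> carrier \<D>\<^sub>B"
  shows "f \<in> extensional (carrier T)" "f \<in> hom T T"
    and "\<lbrakk> x \<in> carrier B; \<alpha> \<in> carrier \<Lambda>; w \<in> carrier T \<rbrakk>
      \<Longrightarrow> f (L.pairing (L.XY.pt x \<alpha>) w) = L.pairing (L.XY.pt x \<alpha>) (f w)"
proof -
  note f = End_algD[OF assms[unfolded DEnd_alg_def], simplified]
  show "f \<in> extensional (carrier T)" by (rule f(1))
  show hom: "f \<in> hom T T" by (rule homI) (use f in auto)
  show "f (L.pairing (L.XY.pt x \<alpha>) w) = L.pairing (L.XY.pt x \<alpha>) (f w)"
    if "x \<in> carrier B" "\<alpha> \<in> carrier \<Lambda>" and w: "w \<in> carrier T"
  proof -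
    have "Psi A B R P (L.XY.pt x \<alpha>) \<in> carrier \<Lambda>\<^sub>B" using that carrier_Lambda_B by blast
    from f(4)[OF this w] show ?thesis using w f(2)[OF w] by (simp add: Psi_eq)
  qed
qed

lemma DEnd_commute: "\<lbrakk> \<sigma> \<in> carrier \<D>; \<alpha> \<in> carrier \<Lambda>; p \<in> carrier P \<rbrakk> \<Longrightarrow> \<sigma> (\<alpha> p) = \<alpha> (\<sigma> p)"
  using End_algD(4)[of \<sigma> \<Lambda> "eval_module P" \<alpha> p] by (simp add: DEnd_alg_def)

lemma DEnd_closed: "\<lbrakk> \<sigma> \<in> carrier \<D>; p \<in> carrier P \<rbrakk> \<Longrightarrow> \<sigma> p \<in> carrier P"
  using bilinear_opD(1)[OF bilinear_op_DEnd] by simp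

text \<open>For z \<otimes> \<sigma>, x \<otimes> \<alpha> and y \<otimes> p both orders of the
  operators give zyx \<otimes> \<sigma>(\<alpha> p). Additivity in \<open>u\<close> and
  \<open>w\<close> reduces the commutation to this case.\<close>

lemma DEnd_map_in:
  assumes u: "u \<in> carrier D.XY.T"
  shows "DEnd_map A B R P u \<in> carrier \<D>\<^sub>B"
proof (rule DEnd_B_I)
  note [simp] = DEnd_closed End_algD(2)
  show "DEnd_map A B R P u \<in> extensional (carrier T)" by (simp add: DEnd_map_eq)
  show hom: "DEnd_map A B R P u \<in> hom T T"
    using D.pairing_hom_right[OF u] by (auto simp: hom_def DEnd_map_eq)
  show "DEnd_map A B R P u (L.pairing (L.XY.pt x \<alpha>) w) = L.pairing (L.XY.pt x \<alpha>) (DEnd_map A B R P u w)"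
    if x: "x \<in> carrier B" and \<alpha>: "\<alpha> \<in> carrier \<Lambda>" and w: "w \<in> carrier T" for x \<alpha> w
  proof -
    have px: "L.XY.pt x \<alpha> \<in> carrier L.XY.T" using x \<alpha> by simp
    note Lhom = L.pairing_hom_right[OF px]
    have "D.pairing u (L.pairing (L.XY.pt x \<alpha>) w) = L.pairing (L.XY.pt x \<alpha>) (D.pairing u w)"
    proof (rule tensor_hom_eqI[where h = "\<lambda>w. D.pairing u (L.pairing (L.XY.pt x \<alpha>) w)", OF T.is_group _ _ _ w])
      show "(\<lambda>w. D.pairing u (L.pairing (L.XY.pt x \<alpha>) w)) \<in> hom T T"
        using hom_compose[OF Lhom D.pairing_hom_right[OF u]] by (simp add: comp_def)
      show "(\<lambda>w. L.pairing (L.XY.pt x \<alpha>) (D.pairing u w)) \<in> hom T T"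
        using hom_compose[OF D.pairing_hom_right[OF u] Lhom] by (simp add: comp_def)
      fix y p assume "y \<in> carrier B" "p \<in> carrier Q"
      then have yp: "y \<in> carrier B" "p \<in> carrier P" by simp_all
      show "D.pairing u (L.pairing (L.XY.pt x \<alpha>) (pt y p)) = L.pairing (L.XY.pt x \<alpha>) (D.pairing u (pt y p))"
      proof (rule D.XY.tensor_hom_eqI[where h = "\<lambda>u. D.pairing u (L.pairing (L.XY.pt x \<alpha>) (pt y p))", OF T.is_group _ _ _ u])
        show "(\<lambda>u. D.pairing u (L.pairing (L.XY.pt x \<alpha>) (pt y p))) \<in> hom D.XY.T T"
          using px yp by (intro D.pairing_hom_left) simp
        show "(\<lambda>u. L.pairing (L.XY.pt x \<alpha>) (D.pairing u (pt y p))) \<in> hom D.XY.T T"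
          using hom_compose[OF D.pairing_hom_left Lhom, of "pt y p"] yp by (simp add: comp_def)
        fix z \<sigma> assume "z \<in> carrier B" "\<sigma> \<in> carrier \<D>"
        then show "D.pairing (D.XY.pt z \<sigma>) (L.pairing (L.XY.pt x \<alpha>) (pt y p))
          = L.pairing (L.XY.pt x \<alpha>) (D.pairing (D.XY.pt z \<sigma>) (pt y p))"
          using x \<alpha> yp by (simp add: DEnd_commute B.m_assoc)
      qed
    qed
    then show ?thesis using w px u by (simp add: DEnd_map_eq)
  qed
qed

end

section \<open>Matrices commuting with the endomorphisms\<close>

text \<open>The coefficients live on row \<open>c\<close> and column \<open>a\<close>, and at the
  crossing both contributions count. The module is arbitrary so that one relation over
  \<open>A\<close> can be evaluated on entries in \<open>A\<close> and on entries in
  \<open>B\<close>.\<close>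

lemma (in module) finsum_cross:
  assumes c: "c < n" and a: "a < n" and u: "\<And>j. j < n \<Longrightarrow> u j \<in> carrier R" and v: "\<And>i. i < n \<Longrightarrow> v i \<in> carrier R"
    and z: "z \<in> {..<n} \<times> {..<n} \<rightarrow> carrier M"
  shows "(\<Oplus>\<^bsub>M\<^esub>p\<in>{..<n::nat} \<times> {..<n}. ((if fst p = c then u (snd p) else \<zero>) \<ominus> (if snd p = a then v (fst p) else \<zero>)) \<odot>\<^bsub>M\<^esub> z p)
    = (\<Oplus>\<^bsub>M\<^esub>j\<in>{..<n}. u j \<odot>\<^bsub>M\<^esub> z (c, j)) \<ominus>\<^bsub>M\<^esub> (\<Oplus>\<^bsub>M\<^esub>i\<in>{..<n}. v i \<odot>\<^bsub>M\<^esub> z (i, a))"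
proof -
  let ?I = "{..<n} \<times> {..<n}"
  have zc: "z p \<in> carrier M" if "p \<in> ?I" for p using z that by blast
  let ?g = "\<lambda>p. if fst p = c then u (snd p) \<odot>\<^bsub>M\<^esub> z p else \<zero>\<^bsub>M\<^esub>"
  let ?h = "\<lambda>p. if snd p = a then v (fst p) \<odot>\<^bsub>M\<^esub> z p else \<zero>\<^bsub>M\<^esub>"
  have g: "?g p \<in> carrier M" and h: "?h p \<in> carrier M" if "p \<in> ?I" for p
    using that zc[OF that] u v by auto
  have mz: "\<ominus>\<^bsub>M\<^esub> \<zero>\<^bsub>M\<^esub> = \<zero>\<^bsub>M\<^esub>" using M.l_neg[OF M.zero_closed] by simp
  have row: "(\<Oplus>\<^bsub>M\<^esub>j\<in>{..<n}. u j \<odot>\<^bsub>M\<^esub> z (c, j)) = (\<Oplus>\<^bsub>M\<^esub>p\<in>?I. ?g p)"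
  proof -
    have "(\<Oplus>\<^bsub>M\<^esub>p\<in>Pair c ` {..<n}. u (snd p) \<odot>\<^bsub>M\<^esub> z p) = (\<Oplus>\<^bsub>M\<^esub>j\<in>{..<n}. u (snd (c, j)) \<odot>\<^bsub>M\<^esub> z (c, j))"
      using c u zc by (intro M.add.finprod_reindex) (auto simp: inj_on_def)
    moreover have "(\<Oplus>\<^bsub>M\<^esub>p\<in>Pair c ` {..<n}. u (snd p) \<odot>\<^bsub>M\<^esub> z p) = (\<Oplus>\<^bsub>M\<^esub>p\<in>?I. ?g p)"
      by (rule M.add.finprod_mono_neutral_cong_left) (use c g in auto)
    ultimately show ?thesis by simp
  qed
  have col: "(\<Oplus>\<^bsub>M\<^esub>i\<in>{..<n}. v i \<odot>\<^bsub>M\<^esub> z (i, a)) = (\<Oplus>\<^bsub>M\<^esub>p\<in>?I. ?h p)"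
  proof -
    have "(\<Oplus>\<^bsub>M\<^esub>p\<in>(\<lambda>i. (i, a)) ` {..<n}. v (fst p) \<odot>\<^bsub>M\<^esub> z p) = (\<Oplus>\<^bsub>M\<^esub>i\<in>{..<n}. v (fst (i, a)) \<odot>\<^bsub>M\<^esub> z (i, a))"
      using a v zc by (intro M.add.finprod_reindex) (auto simp: inj_on_def)
    moreover have "(\<Oplus>\<^bsub>M\<^esub>p\<in>(\<lambda>i. (i, a)) ` {..<n}. v (fst p) \<odot>\<^bsub>M\<^esub> z p) = (\<Oplus>\<^bsub>M\<^esub>p\<in>?I. ?h p)"
      by (rule M.add.finprod_mono_neutral_cong_left) (use a h in auto)
    ultimately show ?thesis by simp
  qed
  have "(\<Oplus>\<^bsub>M\<^esub>p\<in>?I. ((if fst p = c then u (snd p) else \<zero>) \<ominus> (if snd p = a then v (fst p) else \<zero>)) \<odot>\<^bsub>M\<^esub> z p)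
    = (\<Oplus>\<^bsub>M\<^esub>p\<in>?I. ?g p \<oplus>\<^bsub>M\<^esub> \<ominus>\<^bsub>M\<^esub> ?h p)"
  proof (rule M.finsum_cong')
    fix p assume p: "p \<in> ?I"
    then show "((if fst p = c then u (snd p) else \<zero>) \<ominus> (if snd p = a then v (fst p) else \<zero>)) \<odot>\<^bsub>M\<^esub> z p
      = ?g p \<oplus>\<^bsub>M\<^esub> \<ominus>\<^bsub>M\<^esub> ?h p"
      using zc[OF p] u v by (auto simp: R.minus_eq smult_l_distr smult_l_minus mz)
  qed (use g h in auto)
  also have "\<dots> = (\<Oplus>\<^bsub>M\<^esub>p\<in>?I. ?g p) \<oplus>\<^bsub>M\<^esub> (\<Oplus>\<^bsub>M\<^esub>p\<in>?I. \<ominus>\<^bsub>M\<^esub> ?h p)"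
    using g h by (intro M.finsum_addf) auto
  also have "(\<Oplus>\<^bsub>M\<^esub>p\<in>?I. \<ominus>\<^bsub>M\<^esub> ?h p) = \<ominus>\<^bsub>M\<^esub> (\<Oplus>\<^bsub>M\<^esub>p\<in>?I. ?h p)"
    by (rule additive_finsum[symmetric, where h = "\<lambda>x. \<ominus>\<^bsub>M\<^esub> x", OF M.abelian_group_axioms M.abelian_group_axioms])
      (use h in \<open>auto simp: M.minus_add\<close>)
  finally show ?thesis unfolding row col by (simp add: M.minus_eq)
qed

text \<open>The ring as a module over itself; it transfers sums with entries in a module to entries
  in the ring.\<close>

definition regular_module :: "('a, 'z) ring_scheme \<Rightarrow> ('a, 'a) module"
  where "regular_module A = \<lparr>carrier = carrier A, monoid.mult = monoid.mult A, monoid.one = monoid.one A,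
    ring.zero = ring.zero A, ring.add = ring.add A, smult = monoid.mult A\<rparr>"

lemma regular_module_simps [simp]:
  "carrier (regular_module A) = carrier A" "ring.zero (regular_module A) = ring.zero A"
  "ring.add (regular_module A) = ring.add A" "smult (regular_module A) = monoid.mult A"
  by (simp_all add: regular_module_def)

lemma finsum_regular_module: "finsum (regular_module A) = finsum A"
  by (simp add: finsum_def finprod_def fun_eq_iff)

lemma (in cring) a_inv_regular_module: "a_inv (regular_module R) = a_inv R"
  by (simp add: a_inv_def fun_eq_iff m_inv_def)

lemma (in cring) regular_module: "module R (regular_module R)"
proof (rule moduleI)
  show "abelian_group (regular_module R)"
    by (rule abelian_groupI) (auto simp: a_ac intro: l_neg a_inv_closed)
qed (auto simp: is_cring l_distr r_distr m_assoc)

locale based_algebra_module = algebra_module A R P + based_module A "restrict_scalars R P" n e co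
  for A :: "('a, 'z) ring_scheme" (structure) and R :: "('a, 'r) module" and P :: "('r, 'p) module"
    and n :: nat and e :: "nat \<Rightarrow> 'p" and co :: "'p \<Rightarrow> nat \<Rightarrow> 'a"
begin

abbreviation "I \<equiv> {..<n} \<times> {..<n}"

text \<open>A matrix \<open>z\<close> commutes with the matrix of \<open>\<alpha>\<close> iff it is orthogonal to all \<open>gen \<alpha> c a\<close>.\<close>

definition gen :: "('p \<Rightarrow> 'p) \<Rightarrow> nat \<Rightarrow> nat \<Rightarrow> nat \<times> nat \<Rightarrow> 'a"
  where "gen \<alpha> c a p = (if fst p < n \<and> snd p < n then
    (if fst p = c then co (\<alpha> (e a)) (snd p) else \<zero>) \<ominus> (if snd p = a then co (\<alpha> (e (fst p))) c else \<zero>) else \<zero>)"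

text \<open>The value zero outside \<open>I\<close> makes a matrix a vector with values in
  \<open>A\<close> at all index pairs, as required of solutions in the results on linear
  systems.\<close>

definition mat :: "('p \<Rightarrow> 'p) \<Rightarrow> nat \<times> nat \<Rightarrow> 'a"
  where "mat \<sigma> p = (if fst p < n \<and> snd p < n then co (\<sigma> (e (snd p))) (fst p) else \<zero>)"

lemma e_closed' [simp]: "i < n \<Longrightarrow> e i \<in> carrier P"
  using e_closed by simp

lemma gen_closed: "\<lbrakk> \<alpha> \<in> carrier (End_alg R P); c < n; a < n \<rbrakk> \<Longrightarrow> gen \<alpha> c a \<in> UNIV \<rightarrow> carrier A"
  by (auto simp: gen_def End_algD)

text \<open>Writing \<alpha> also for its matrix, the right-hand side is the entry at (c, a) of
  z\<alpha> - \<alpha>z, where the entries of z lie in any module over \<open>A\<close>.\<close>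

lemma finsum_gen:
  assumes X: "module A X" and \<alpha>: "\<alpha> \<in> carrier (End_alg R P)" and c: "c < n" and a: "a < n" and z: "z \<in> I \<rightarrow> carrier X"
  shows "(\<Oplus>\<^bsub>X\<^esub>p\<in>I. gen \<alpha> c a p \<odot>\<^bsub>X\<^esub> z p)
    = (\<Oplus>\<^bsub>X\<^esub>j\<in>{..<n}. co (\<alpha> (e a)) j \<odot>\<^bsub>X\<^esub> z (c, j)) \<ominus>\<^bsub>X\<^esub> (\<Oplus>\<^bsub>X\<^esub>i\<in>{..<n}. co (\<alpha> (e i)) c \<odot>\<^bsub>X\<^esub> z (i, a))"
proof -
  interpret X: module A X by fact
  have "(\<Oplus>\<^bsub>X\<^esub>p\<in>I. gen \<alpha> c a p \<odot>\<^bsub>X\<^esub> z p) = (\<Oplus>\<^bsub>X\<^esub>p\<in>I.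
      ((if fst p = c then co (\<alpha> (e a)) (snd p) else \<zero>) \<ominus> (if snd p = a then co (\<alpha> (e (fst p))) c else \<zero>)) \<odot>\<^bsub>X\<^esub> z p)"
    by (rule X.M.finsum_cong') (use z \<alpha> c a in \<open>auto simp: gen_def End_algD Pi_iff\<close>)
  also have "\<dots> = (\<Oplus>\<^bsub>X\<^esub>j\<in>{..<n}. co (\<alpha> (e a)) j \<odot>\<^bsub>X\<^esub> z (c, j)) \<ominus>\<^bsub>X\<^esub> (\<Oplus>\<^bsub>X\<^esub>i\<in>{..<n}. co (\<alpha> (e i)) c \<odot>\<^bsub>X\<^esub> z (i, a))"
    by (rule X.finsum_cross[OF c a _ _ z]) (use \<alpha> a in \<open>auto simp: End_algD\<close>)
  finally show ?thesis .
qed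

lemma dot_gen:
  assumes \<alpha>: "\<alpha> \<in> carrier (End_alg R P)" and c: "c < n" and a: "a < n" and z: "z \<in> UNIV \<rightarrow> carrier A"
  shows "R.dot I (gen \<alpha> c a) z
    = (\<Oplus>j\<in>{..<n}. co (\<alpha> (e a)) j \<otimes> z (c, j)) \<ominus> (\<Oplus>i\<in>{..<n}. co (\<alpha> (e i)) c \<otimes> z (i, a))"
  using finsum_gen[OF R.regular_module \<alpha> c a, of z] z
  by (simp add: finsum_regular_module R.dot_def a_minus_def R.a_inv_regular_module Pi_iff)

lemma End_linear:
  assumes "\<alpha> \<in> carrier (End_alg R P)" "p \<in> carrier P"
  shows "co (\<alpha> p) b = (\<Oplus>a\<in>{..<n}. co p a \<otimes> co (\<alpha> (e a)) b)"
  by (rule co_additive_map) (use assms in \<open>auto simp: End_algD End_scalar\<close>)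

lemma DEnd_iff:
  "\<sigma> \<in> carrier (DEnd_alg R P) \<longleftrightarrow> \<sigma> \<in> extensional (carrier P) \<and> (\<forall>p\<in>carrier P. \<sigma> p \<in> carrier P) \<and>
    (\<forall>p\<in>carrier P. \<forall>q\<in>carrier P. \<sigma> (p \<oplus>\<^bsub>P\<^esub> q) = \<sigma> p \<oplus>\<^bsub>P\<^esub> \<sigma> q) \<and>
    (\<forall>\<alpha>\<in>carrier (End_alg R P). \<forall>p\<in>carrier P. \<sigma> (\<alpha> p) = \<alpha> (\<sigma> p))"
  by (simp add: DEnd_alg_def End_alg_carrier_iff[of _ "End_alg R P"])

text \<open>Multiplication by \<open>k\<close> is itself an endomorphism over \<open>R\<close>, so
  linearity over \<open>A\<close> is a case of commutation.\<close>

lemma DEnd_scalar: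
  assumes "\<sigma> \<in> carrier (DEnd_alg R P)" "k \<in> carrier A" "p \<in> carrier P"
  shows "\<sigma> (k \<odot>\<^bsub>restrict_scalars R P\<^esub> p) = k \<odot>\<^bsub>restrict_scalars R P\<^esub> \<sigma> p"
proof -
  let ?k = "k \<odot>\<^bsub>End_alg R P\<^esub> \<one>\<^bsub>End_alg R P\<^esub>"
  have "?k \<in> carrier (End_alg R P)" using End_alg_closed(4,5) assms(2) by blast
  then have "\<sigma> (?k p) = ?k (\<sigma> p)" using assms by (simp add: DEnd_iff)
  then show ?thesis using assms by (simp add: End_alg_simps DEnd_iff)
qed

lemma DEnd_linear:
  assumes "\<sigma> \<in> carrier (DEnd_alg R P)" "p \<in> carrier P"
  shows "co (\<sigma> p) b = (\<Oplus>a\<in>{..<n}. co p a \<otimes> co (\<sigma> (e a)) b)"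
  by (rule co_additive_map) (use assms DEnd_scalar[OF assms(1)] in \<open>auto simp: DEnd_iff\<close>)

lemma mat_closed: "\<sigma> \<in> carrier (DEnd_alg R P) \<Longrightarrow> mat \<sigma> \<in> UNIV \<rightarrow> carrier A"
  by (auto simp: mat_def DEnd_iff)

lemma mat_eqI:
  assumes "\<sigma> \<in> carrier (DEnd_alg R P)" "\<tau> \<in> carrier (DEnd_alg R P)" "\<And>p. p \<in> I \<Longrightarrow> mat \<sigma> p = mat \<tau> p"
  shows "\<sigma> = \<tau>"
proof (rule extensionalityI[of _ "carrier P"])
  fix p assume p: "p \<in> carrier P"
  show "\<sigma> p = \<tau> p"
  proof (rule co_eqI)
    fix b assume b: "b < n"
    have "(\<Oplus>a\<in>{..<n}. co p a \<otimes> co (\<sigma> (e a)) b) = (\<Oplus>a\<in>{..<n}. co p a \<otimes> co (\<tau> (e a)) b)"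
    proof (rule R.finsum_cong')
      fix a assume "a \<in> {..<n}"
      then show "co p a \<otimes> co (\<sigma> (e a)) b = co p a \<otimes> co (\<tau> (e a)) b"
        using assms(3)[of "(b, a)"] b by (simp add: mat_def)
    qed (use assms p in \<open>auto simp: DEnd_iff\<close>)
    then show "co (\<sigma> p) b = co (\<tau> p) b" using DEnd_linear assms p by simp
  qed (use assms p in \<open>auto simp: DEnd_iff\<close>)
qed (use assms in \<open>auto simp: DEnd_iff\<close>)

lemma dot_gen_mat:
  assumes \<sigma>: "\<sigma> \<in> carrier (DEnd_alg R P)" and \<alpha>: "\<alpha> \<in> carrier (End_alg R P)" and c: "c < n" and a: "a < n"
  shows "R.dot I (gen \<alpha> c a) (mat \<sigma>) = \<zero>"
proof -
  have "(\<Oplus>j\<in>{..<n}. co (\<alpha> (e a)) j \<otimes> mat \<sigma> (c, j)) = co (\<sigma> (\<alpha> (e a))) c"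
    unfolding DEnd_linear[OF \<sigma> End_algD(2)[OF \<alpha> e_closed'[OF a]]]
    by (rule R.finsum_cong') (use \<sigma> \<alpha> c a in \<open>auto simp: mat_def DEnd_iff End_algD\<close>)
  moreover have "(\<Oplus>i\<in>{..<n}. co (\<alpha> (e i)) c \<otimes> mat \<sigma> (i, a)) = co (\<alpha> (\<sigma> (e a))) c"
  proof -
    have "\<sigma> (e a) \<in> carrier P" using \<sigma> a by (simp add: DEnd_iff)
    from End_linear[OF \<alpha> this] show ?thesis
      by (simp, intro R.finsum_cong') (use \<sigma> \<alpha> c a in \<open>auto simp: mat_def DEnd_iff End_algD R.m_comm\<close>)
  qed
  ultimately show ?thesis
    using \<sigma> \<alpha> a by (simp add: dot_gen[OF \<alpha> c a mat_closed[OF \<sigma>]] DEnd_iff End_algD R.minus_eq R.r_neg)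
qed

lemma linmap_commute_basis:
  assumes x: "x \<in> UNIV \<rightarrow> carrier A" and \<alpha>: "\<alpha> \<in> carrier (End_alg R P)" and c: "c < n" and a: "a < n"
  shows "co (linmap x (\<alpha> (e a))) c = (\<Oplus>j\<in>{..<n}. co (\<alpha> (e a)) j \<otimes> x (c, j))"
    and "co (\<alpha> (linmap x (e a))) c = (\<Oplus>i\<in>{..<n}. co (\<alpha> (e i)) c \<otimes> x (i, a))"
proof -
  show "co (linmap x (\<alpha> (e a))) c = (\<Oplus>j\<in>{..<n}. co (\<alpha> (e a)) j \<otimes> x (c, j))"
    using assms by (intro co_linmap) (auto simp: End_algD)
  have "linmap x (e a) \<in> carrier P" using linmap_closed[OF x e_closed[OF a]] by simp
  from End_linear[OF \<alpha> this]
  show "co (\<alpha> (linmap x (e a))) c = (\<Oplus>i\<in>{..<n}. co (\<alpha> (e i)) c \<otimes> x (i, a))"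
    by (simp, intro R.finsum_cong') (use x \<alpha> c a in \<open>auto simp: co_linmap_basis End_algD R.m_comm Pi_iff\<close>)
qed

text \<open>The relation for (c, a) says that the two composites of \<open>linmap x\<close> and
  \<open>\<alpha>\<close> agree at \<open>e a\<close> in coordinate \<open>c\<close>. Both
  composites are linear over \<open>A\<close>, so agreement on the basis is enough.\<close>

lemma linmap_in_DEnd:
  assumes x: "x \<in> UNIV \<rightarrow> carrier A"
    and gen: "\<And>\<alpha> c a. \<lbrakk> \<alpha> \<in> carrier (End_alg R P); c < n; a < n \<rbrakk> \<Longrightarrow> R.dot I (gen \<alpha> c a) x = \<zero>"
  shows "linmap x \<in> carrier (DEnd_alg R P)"
  unfolding DEnd_iff
proof (intro conjI ballI)
  have cl: "linmap x p \<in> carrier P" if "p \<in> carrier P" for p using linmap_closed[OF x] that by simp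
  then show "linmap x p \<in> carrier P" if "p \<in> carrier P" for p using that .
  show "linmap x \<in> extensional (carrier P)" by (simp add: linmap_def)
  show "linmap x (p \<oplus>\<^bsub>P\<^esub> q) = linmap x p \<oplus>\<^bsub>P\<^esub> linmap x q" if "p \<in> carrier P" "q \<in> carrier P" for p q
    using linmap_add[OF x] that by simp
  fix \<alpha> p assume \<alpha>: "\<alpha> \<in> carrier (End_alg R P)" and p: "p \<in> carrier P"
  have basis: "linmap x (\<alpha> (e a)) = \<alpha> (linmap x (e a))" if a: "a < n" for a
  proof (rule co_eqI)
    fix c assume c: "c < n"
    have "(\<Oplus>j\<in>{..<n}. co (\<alpha> (e a)) j \<otimes> x (c, j)) \<in> carrier A" "(\<Oplus>i\<in>{..<n}. co (\<alpha> (e i)) c \<otimes> x (i, a)) \<in> carrier A"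
      using \<alpha> a x by (auto intro!: R.finsum_closed simp: End_algD Pi_iff)
    then show "co (linmap x (\<alpha> (e a))) c = co (\<alpha> (linmap x (e a))) c"
      using gen[OF \<alpha> c a] dot_gen[OF \<alpha> c a x] linmap_commute_basis[OF x \<alpha> c a] by simp
  qed (use \<alpha> a cl in \<open>auto simp: End_algD\<close>)
  have sm: "linmap x (k \<odot>\<^bsub>restrict_scalars R P\<^esub> p) = k \<odot>\<^bsub>restrict_scalars R P\<^esub> linmap x p"
    if "k \<in> carrier A" "p \<in> carrier P" for k p using linmap_smult[OF x _ that(1)] that by simp
  have ad: "linmap x (p \<oplus>\<^bsub>P\<^esub> q) = linmap x p \<oplus>\<^bsub>P\<^esub> linmap x q" if "p \<in> carrier P" "q \<in> carrier P" for p q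
    using linmap_add[OF x] that by simp
  show "linmap x (\<alpha> p) = \<alpha> (linmap x p)"
  proof (rule co_eqI)
    fix c assume c: "c < n"
    have "co (linmap x (\<alpha> p)) c = (\<Oplus>a\<in>{..<n}. co p a \<otimes> co (linmap x (\<alpha> (e a))) c)"
      by (rule co_additive_map[where h = "\<lambda>p. linmap x (\<alpha> p)"])
        (use p \<alpha> cl sm ad in \<open>auto simp: End_algD End_scalar\<close>)
    also have "\<dots> = (\<Oplus>a\<in>{..<n}. co p a \<otimes> co (\<alpha> (linmap x (e a))) c)"
      by (rule R.finsum_cong') (use p \<alpha> cl basis in \<open>auto simp: End_algD\<close>)
    also have "\<dots> = co (\<alpha> (linmap x p)) c"
      by (rule co_additive_map[where h = "\<lambda>p. \<alpha> (linmap x p)", symmetric])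
        (use p \<alpha> cl sm ad in \<open>auto simp: End_algD End_scalar\<close>)
    finally show "co (linmap x (\<alpha> p)) c = co (\<alpha> (linmap x p)) c" .
  qed (use \<alpha> p cl in \<open>auto simp: End_algD\<close>)
qed

lemma mat_linmap: "\<lbrakk> x \<in> UNIV \<rightarrow> carrier A; p \<in> I \<rbrakk> \<Longrightarrow> mat (linmap x) p = x p"
  by (auto simp: mat_def co_linmap_basis)

end

section \<open>Bijectivity of the base change map\<close>

text \<open>The product of a vector with one row of the identity matrix minus another matrix. It is
  used with entries in \<open>B\<close> and, through \<open>regular_module\<close>, with entries in
  \<open>A\<close>.\<close>

lemma (in module) finsum_delta_diff:
  assumes "finite I" and j: "j \<in> I" and t: "t \<in> I \<rightarrow> carrier R" and z: "z \<in> I \<rightarrow> carrier M"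
  shows "(\<Oplus>\<^bsub>M\<^esub>i\<in>I. ((if i = j then \<one> else \<zero>) \<ominus> t i) \<odot>\<^bsub>M\<^esub> z i) = z j \<ominus>\<^bsub>M\<^esub> (\<Oplus>\<^bsub>M\<^esub>i\<in>I. t i \<odot>\<^bsub>M\<^esub> z i)"
proof -
  have tz: "t i \<in> carrier R" "z i \<in> carrier M" if "i \<in> I" for i using t z that by auto
  have "(\<Oplus>\<^bsub>M\<^esub>i\<in>I. ((if i = j then \<one> else \<zero>) \<ominus> t i) \<odot>\<^bsub>M\<^esub> z i)
    = (\<Oplus>\<^bsub>M\<^esub>i\<in>I. (if i = j then z i else \<zero>\<^bsub>M\<^esub>) \<oplus>\<^bsub>M\<^esub> \<ominus>\<^bsub>M\<^esub> (t i \<odot>\<^bsub>M\<^esub> z i))"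
    by (rule M.finsum_cong') (use tz in \<open>auto simp: R.minus_eq smult_l_distr smult_l_minus\<close>)
  also have "\<dots> = (\<Oplus>\<^bsub>M\<^esub>i\<in>I. if i = j then z i else \<zero>\<^bsub>M\<^esub>) \<oplus>\<^bsub>M\<^esub> (\<Oplus>\<^bsub>M\<^esub>i\<in>I. \<ominus>\<^bsub>M\<^esub> (t i \<odot>\<^bsub>M\<^esub> z i))"
    using tz by (intro M.finsum_addf) auto
  also have "(\<Oplus>\<^bsub>M\<^esub>i\<in>I. if i = j then z i else \<zero>\<^bsub>M\<^esub>) = z j"
    by (rule M.add.finprod_singleton_swap[OF j \<open>finite I\<close> z])
  also have "(\<Oplus>\<^bsub>M\<^esub>i\<in>I. \<ominus>\<^bsub>M\<^esub> (t i \<odot>\<^bsub>M\<^esub> z i)) = \<ominus>\<^bsub>M\<^esub> (\<Oplus>\<^bsub>M\<^esub>i\<in>I. t i \<odot>\<^bsub>M\<^esub> z i)"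
    by (rule additive_finsum[symmetric, where h = "\<lambda>x. \<ominus>\<^bsub>M\<^esub> x", OF M.abelian_group_axioms M.abelian_group_axioms])
      (use tz \<open>finite I\<close> in \<open>auto simp: M.minus_add\<close>)
  finally show ?thesis by (simp add: M.minus_eq)
qed

lemma (in cring) dot_delta_diff:
  assumes "finite I" "j \<in> I" "t \<in> I \<rightarrow> carrier R" "z \<in> I \<rightarrow> carrier R"
  shows "dot I z (\<lambda>i. (if i = j then \<one> else \<zero>) \<ominus> t i) = z j \<ominus> dot I z t"
proof -
  have "dot I (\<lambda>i. (if i = j then \<one> else \<zero>) \<ominus> t i) z = z j \<ominus> dot I t z"
    using module.finsum_delta_diff[OF regular_module, of I j t z] assms
    by (simp add: finsum_regular_module dot_def a_minus_def a_inv_regular_module)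
  moreover have "dot I z (\<lambda>i. (if i = j then \<one> else \<zero>) \<ominus> t i) = dot I (\<lambda>i. (if i = j then \<one> else \<zero>) \<ominus> t i) z"
    using assms by (intro dot_commute) auto
  ultimately show ?thesis using dot_commute[of z I t] assms by simp
qed

sublocale base_change \<subseteq> based_algebra_module A R P n e co ..

section \<open>Matrices over B of the double centraliser of P_B\<close>

context base_change
begin

interpretation T: comm_group T by (rule tensor_group_comm_group)

text \<open>The matrix of \<open>f\<close> with entries in \<open>B\<close>. It records
  \<open>f\<close> only on the elements 1 \<otimes> \<open>e a\<close>, which is enough for members
  of \<open>\<D>\<^sub>B\<close>.\<close>

definition Y :: "(('b, 'p) tensor \<Rightarrow> ('b, 'p) tensor) \<Rightarrow> nat \<times> nat \<Rightarrow> 'b"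
  where "Y f p = eps (fst p) (f (pt \<one>\<^bsub>B\<^esub> (e (snd p))))"

lemma Y_closed: "\<lbrakk> f \<in> hom T T; p \<in> I \<rbrakk> \<Longrightarrow> Y f p \<in> carrier B"
  unfolding Y_def by (rule eps_closed) (auto intro!: hom_in_carrier[of f])

text \<open>Right multiplication by \<open>x\<close> is the operator of x \<otimes> id and so
  belongs to \<open>\<Lambda>\<^sub>B\<close>. As \<open>f\<close> commutes with it, the value at x
  \<otimes> \<open>e a\<close> is the value at 1 \<otimes> \<open>e a\<close> multiplied by
  \<open>x\<close> on the right.\<close>

lemma DEnd_B_eqI:
  assumes f: "f \<in> carrier \<D>\<^sub>B" and g: "g \<in> carrier \<D>\<^sub>B" and Y: "\<And>p. p \<in> I \<Longrightarrow> Y f p = Y g p"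
  shows "f = g"
proof (rule extensionalityI[OF DEnd_B_D(1)[OF f] DEnd_B_D(1)[OF g]])
  note fh = DEnd_B_D(2)[OF f] and gh = DEnd_B_D(2)[OF g]
  fix w assume w: "w \<in> carrier T"
  show "f w = g w"
  proof (rule basis_hom_eqI[OF tensor_group_comm_group fh gh _ w])
    fix x a assume x: "x \<in> carrier B" and a: "a < n"
    have 1: "pt \<one>\<^bsub>B\<^esub> (e a) \<in> carrier T" using a by auto
    have "f (pt \<one>\<^bsub>B\<^esub> (e a)) = g (pt \<one>\<^bsub>B\<^esub> (e a))"
      by (rule eps_eqI) (use Y[of "(_, a)"] a hom_in_carrier[OF fh 1] hom_in_carrier[OF gh 1] in \<open>auto simp: Y_def\<close>)
    moreover have "pt x (e a) = L.pairing (L.XY.pt x P_id) (pt \<one>\<^bsub>B\<^esub> (e a))"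
      using x a P_id_in by (subst L.pairing_pure) auto
    ultimately show "f (pt x (e a)) = g (pt x (e a))"
      using DEnd_B_D(3)[OF f x P_id_in 1] DEnd_B_D(3)[OF g x P_id_in 1] by simp
  qed
qed

lemma Y_DEnd_map_hom:
  assumes p: "p \<in> I"
  shows "(\<lambda>u. Y (DEnd_map A B R P u) p) \<in> hom D.XY.T (add_monoid B)"
proof -
  have 1: "pt \<one>\<^bsub>B\<^esub> (e (snd p)) \<in> carrier T" using p by auto
  have "(\<lambda>u. Y (DEnd_map A B R P u) p) = eps (fst p) \<circ> (\<lambda>u. D.pairing u (pt \<one>\<^bsub>B\<^esub> (e (snd p))))"
    using 1 by (simp add: Y_def DEnd_map_eq fun_eq_iff)
  then show ?thesis using hom_compose[OF D.pairing_hom_left[OF 1] eps_hom] by simp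
qed

lemma Y_DEnd_map_pure:
  "\<lbrakk> x \<in> carrier B; \<sigma> \<in> carrier \<D>; p \<in> I \<rbrakk> \<Longrightarrow> Y (DEnd_map A B R P (D.XY.pt x \<sigma>)) p = mat \<sigma> p \<odot>\<^bsub>B\<^esub> x"
  by (auto simp: Y_def DEnd_map_eq mat_def eps_pure DEnd_closed)

lemma eps_right_mult:
  assumes x: "x \<in> carrier B" and w: "w \<in> carrier T"
  shows "eps b (L.pairing (L.XY.pt x P_id) w) = eps b w \<otimes>\<^bsub>B\<^esub> x"
proof (rule basis_hom_eqI[OF B_comm_group _ _ _ w])
  have px: "L.XY.pt x P_id \<in> carrier L.XY.T" using x P_id_in by blast
  show "(\<lambda>w. eps b (L.pairing (L.XY.pt x P_id) w)) \<in> hom T (add_monoid B)"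
    using hom_compose[OF L.pairing_hom_right[OF px] eps_hom] by (simp add: comp_def)
  show "(\<lambda>w. eps b w \<otimes>\<^bsub>B\<^esub> x) \<in> hom T (add_monoid B)"
    by (rule homI) (use x in \<open>auto simp: eps_mult B.l_distr\<close>)
  fix y a assume y: "y \<in> carrier B" and a: "a < n"
  have "L.pairing (L.XY.pt x P_id) (pt y (e a)) = pt (y \<otimes>\<^bsub>B\<^esub> x) (e a)"
    using x y a P_id_in by (subst L.pairing_pure) auto
  then show "eps b (L.pairing (L.XY.pt x P_id) (pt y (e a))) = eps b (pt y (e a)) \<otimes>\<^bsub>B\<^esub> x"
    using x y a by (simp add: eps_pure B.smult_mult_left)
qed

lemma eps_Lambda:
  assumes \<alpha>: "\<alpha> \<in> carrier \<Lambda>" and w: "w \<in> carrier T"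
  shows "eps c (L.pairing (L.XY.pt \<one>\<^bsub>B\<^esub> \<alpha>) w) = (\<Oplus>\<^bsub>B\<^esub>b\<in>{..<n}. co (\<alpha> (e b)) c \<odot>\<^bsub>B\<^esub> eps b w)"
  unfolding finsum_def
proof (rule basis_hom_eqI[where h' = "\<lambda>w. finprod (add_monoid B) (\<lambda>b. co (\<alpha> (e b)) c \<odot>\<^bsub>B\<^esub> eps b w) {..<n}", OF B_comm_group _ _ _ w])
  have p\<alpha>: "L.XY.pt \<one>\<^bsub>B\<^esub> \<alpha> \<in> carrier L.XY.T" using \<alpha> by blast
  have k: "co (\<alpha> (e b)) c \<in> carrier A" if "b < n" for b using \<alpha> that by (simp add: End_algD)
  show "(\<lambda>w. eps c (L.pairing (L.XY.pt \<one>\<^bsub>B\<^esub> \<alpha>) w)) \<in> hom T (add_monoid B)"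
    using hom_compose[OF L.pairing_hom_right[OF p\<alpha>] eps_hom] by (simp add: comp_def)
  show "(\<lambda>w. finprod (add_monoid B) (\<lambda>b. co (\<alpha> (e b)) c \<odot>\<^bsub>B\<^esub> eps b w) {..<n}) \<in> hom T (add_monoid B)"
    by (rule finprod_hom[OF B_comm_group], rule homI) (use k in \<open>auto simp: eps_mult B.smult_r_distr\<close>)
  fix y a assume y: "y \<in> carrier B" and a: "a < n"
  have "(\<Oplus>\<^bsub>B\<^esub>b\<in>{..<n}. co (\<alpha> (e b)) c \<odot>\<^bsub>B\<^esub> eps b (pt y (e a)))
    = (\<Oplus>\<^bsub>B\<^esub>b\<in>{..<n}. if b = a then co (\<alpha> (e b)) c \<odot>\<^bsub>B\<^esub> y else \<zero>\<^bsub>B\<^esub>)"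
    by (rule B.M.finsum_cong') (use k y a in \<open>auto simp: eps_pure co_basis\<close>)
  also have "\<dots> = co (\<alpha> (e a)) c \<odot>\<^bsub>B\<^esub> y"
    using k y a by (intro B.M.add.finprod_singleton_swap) auto
  finally show "eps c (L.pairing (L.XY.pt \<one>\<^bsub>B\<^esub> \<alpha>) (pt y (e a)))
    = finprod (add_monoid B) (\<lambda>b. co (\<alpha> (e b)) c \<odot>\<^bsub>B\<^esub> eps b (pt y (e a))) {..<n}"
    using \<alpha> y a by (simp add: finsum_def eps_pure End_algD)
qed

text \<open>Coordinate \<open>c\<close> of the value of \<open>f\<close> at 1 \<otimes> \<alpha>(e
  a) is computed twice: by expanding \<alpha>(e a) in the basis, and by moving \<open>f\<close> past
  the operator of 1 \<otimes> \<alpha>. The difference of the results is the commutator entry at (c,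
  a).\<close>

lemma Y_gen:
  assumes f: "f \<in> carrier \<D>\<^sub>B" and \<alpha>: "\<alpha> \<in> carrier \<Lambda>" and c: "c < n" and a: "a < n"
  shows "(\<Oplus>\<^bsub>B\<^esub>p\<in>I. gen \<alpha> c a p \<odot>\<^bsub>B\<^esub> Y f p) = \<zero>\<^bsub>B\<^esub>"
proof -
  note fh = DEnd_B_D(2)[OF f]
  have Yc: "Y f p \<in> carrier B" if "p \<in> I" for p using Y_closed[OF fh that] .
  have 1: "pt \<one>\<^bsub>B\<^esub> p \<in> carrier T" if "p \<in> carrier P" for p using that by auto
  have \<alpha>e: "\<alpha> (e a) \<in> carrier P" using \<alpha> a by (simp add: End_algD)
  let ?h = "\<lambda>p. eps c (f (pt \<one>\<^bsub>B\<^esub> p))"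
  have hc: "?h p \<in> carrier B" if "p \<in> carrier P" for p using hom_in_carrier[OF fh 1[OF that]] by simp
  \<comment> \<open>Linearity over \<open>A\<close> comes from commutation as well: the scalar
    \<open>k\<close> acts as right multiplication by k times 1, and \<open>f\<close> commutes with
    right multiplications.\<close>
  have hs: "?h (k \<odot>\<^bsub>Q\<^esub> p) = k \<odot>\<^bsub>B\<^esub> ?h p" if k: "k \<in> carrier A" and p: "p \<in> carrier P" for k p
  proof -
    have k1: "k \<odot>\<^bsub>B\<^esub> \<one>\<^bsub>B\<^esub> \<in> carrier B" using k by simp
    have "pt \<one>\<^bsub>B\<^esub> (k \<odot>\<^bsub>Q\<^esub> p) = pt (k \<odot>\<^bsub>B\<^esub> \<one>\<^bsub>B\<^esub>) p" using k p by (intro pure_smult[symmetric]) auto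
    also have "\<dots> = L.pairing (L.XY.pt (k \<odot>\<^bsub>B\<^esub> \<one>\<^bsub>B\<^esub>) P_id) (pt \<one>\<^bsub>B\<^esub> p)"
      using k p P_id_in by (subst L.pairing_pure) auto
    finally have "?h (k \<odot>\<^bsub>Q\<^esub> p) = ?h p \<otimes>\<^bsub>B\<^esub> (k \<odot>\<^bsub>B\<^esub> \<one>\<^bsub>B\<^esub>)"
      using DEnd_B_D(3)[OF f k1 P_id_in 1[OF p]] eps_right_mult[OF k1 hom_in_carrier[OF fh 1[OF p]]] by simp
    then show ?thesis using k hc[OF p] by (simp add: B.smult_mult_right)
  qed
  have "?h (\<alpha> (e a)) = ?h (\<Oplus>\<^bsub>Q\<^esub>b\<in>{..<n}. co (\<alpha> (e a)) b \<odot>\<^bsub>Q\<^esub> e b)"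
    using co_expand[of "\<alpha> (e a)"] \<alpha>e by simp
  also have "\<dots> = (\<Oplus>\<^bsub>B\<^esub>b\<in>{..<n}. ?h (co (\<alpha> (e a)) b \<odot>\<^bsub>Q\<^esub> e b))"
  proof (rule additive_finsum[where h = ?h, OF M.abelian_group_axioms B.M.abelian_group_axioms])
    fix p q assume "p \<in> carrier Q" "q \<in> carrier Q"
    then show "?h (p \<oplus>\<^bsub>Q\<^esub> q) = ?h p \<oplus>\<^bsub>B\<^esub> ?h q"
      using pure_add_right[of "\<one>\<^bsub>B\<^esub>" p q] hom_mult[OF fh] by (simp add: 1 hom_in_carrier[OF fh] eps_mult)
  next
    show "co (\<alpha> (e a)) b \<odot>\<^bsub>Q\<^esub> e b \<in> carrier Q" if "b \<in> {..<n}" for b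
      by (rule smult_closed) (use that \<alpha>e in auto)
  qed (use hc in auto)
  also have "\<dots> = (\<Oplus>\<^bsub>B\<^esub>b\<in>{..<n}. co (\<alpha> (e a)) b \<odot>\<^bsub>B\<^esub> Y f (c, b))"
    by (rule B.M.finsum_cong') (use \<alpha>e hs Yc c in \<open>auto simp: Y_def simp del: restrict_scalars_simps(4)\<close>)
  finally have lhs: "?h (\<alpha> (e a)) = (\<Oplus>\<^bsub>B\<^esub>b\<in>{..<n}. co (\<alpha> (e a)) b \<odot>\<^bsub>B\<^esub> Y f (c, b))" .
  have "pt \<one>\<^bsub>B\<^esub> (\<alpha> (e a)) = L.pairing (L.XY.pt \<one>\<^bsub>B\<^esub> \<alpha>) (pt \<one>\<^bsub>B\<^esub> (e a))"
    using \<alpha> a by simp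
  then have "?h (\<alpha> (e a)) = eps c (L.pairing (L.XY.pt \<one>\<^bsub>B\<^esub> \<alpha>) (f (pt \<one>\<^bsub>B\<^esub> (e a))))"
    using DEnd_B_D(3)[OF f _ \<alpha> 1[OF e_closed'[OF a]]] by simp
  also have "\<dots> = (\<Oplus>\<^bsub>B\<^esub>b\<in>{..<n}. co (\<alpha> (e b)) c \<odot>\<^bsub>B\<^esub> Y f (b, a))"
    using eps_Lambda[OF \<alpha> hom_in_carrier[OF fh 1[OF e_closed'[OF a]]]] by (simp add: Y_def)
  finally have "(\<Oplus>\<^bsub>B\<^esub>b\<in>{..<n}. co (\<alpha> (e a)) b \<odot>\<^bsub>B\<^esub> Y f (c, b)) = (\<Oplus>\<^bsub>B\<^esub>b\<in>{..<n}. co (\<alpha> (e b)) c \<odot>\<^bsub>B\<^esub> Y f (b, a))"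
    using lhs by simp
  moreover have "(\<Oplus>\<^bsub>B\<^esub>b\<in>{..<n}. co (\<alpha> (e b)) c \<odot>\<^bsub>B\<^esub> Y f (b, a)) \<in> carrier B"
    using Yc \<alpha> a by (intro B.M.finsum_closed) (auto simp: End_algD)
  ultimately show ?thesis
    using finsum_gen[OF B.module_axioms \<alpha> c a, of "Y f"] Yc by (simp add: B.M.minus_eq B.M.r_neg Pi_iff)
qed

end

section \<open>Residue fields\<close>

lemma residue_algebra_simps [simp]:
  "carrier (residue_algebra A m) = carrier (A Quot m)" "ring.zero (residue_algebra A m) = ring.zero (A Quot m)"
  "ring.add (residue_algebra A m) = ring.add (A Quot m)" "monoid.mult (residue_algebra A m) = monoid.mult (A Quot m)"
  "\<one>\<^bsub>residue_algebra A m\<^esub> = \<one>\<^bsub>A Quot m\<^esub>"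
  "a \<odot>\<^bsub>residue_algebra A m\<^esub> u = (m +>\<^bsub>A\<^esub> a) \<otimes>\<^bsub>A Quot m\<^esub> u"
  by (simp_all add: residue_algebra_def)

lemma residue_assoc_algebra:
  assumes "cring A" "ideal m A"
  shows "assoc_algebra A (residue_algebra A m)"
proof -
  interpret A: cring A by fact
  interpret m: ideal m A by fact
  interpret F: cring "A Quot m" by (rule m.quotient_is_cring[OF assms(1)])
  note hom = m.rcos_ring_hom
  note cl = ring_hom_closed[OF hom]
  have ag: "abelian_group (residue_algebra A m)"
    by (rule abelian_groupI) (auto simp: F.a_ac intro: F.l_neg F.a_inv_closed)
  have "module A (residue_algebra A m)"
    by (rule moduleI[OF assms(1) ag])
      (use cl ring_hom_add[OF hom] ring_hom_mult[OF hom] ring_hom_one[OF hom] in \<open>auto simp: F.l_distr F.r_distr F.m_assoc\<close>)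
  moreover have "ring (residue_algebra A m)"
    by (intro ringI ag monoidI) (auto simp: F.m_assoc F.l_distr F.r_distr)
  ultimately show ?thesis
    by (intro assoc_algebra.intro assoc_algebra_axioms.intro) (use cl in \<open>auto simp: F.m_ac\<close>)
qed

text \<open>A matrix that commutes only modulo \<open>m\<close> need not give a double centraliser
  of \<open>P\<close>, but id \<otimes> \<open>linmap x\<close> is one for F \<otimes> P. By
  surjectivity it has a preimage, which can be written 1 \<otimes> \<sigma> because \<open>A\<close>
  maps onto F. Comparison of matrices over F then shows that \<sigma> lifts
  \<open>x\<close>.\<close>

lemma (in based_algebra_module) residue_lift:
  assumes m: "ideal m A"
    and bc: "base_change A R P n e co (residue_algebra A m)"
    and surj: "carrier (DEnd_alg (tensor_algebra A (residue_algebra A m) R) (tensor_module A (residue_algebra A m) R P))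
      \<subseteq> DEnd_map A (residue_algebra A m) R P ` carrier (tensor_algebra A (residue_algebra A m) (DEnd_alg R P))"
    and x: "x \<in> UNIV \<rightarrow> carrier A"
    and gen: "\<And>\<alpha> c a. \<lbrakk> \<alpha> \<in> carrier (End_alg R P); c < n; a < n \<rbrakk> \<Longrightarrow> R.dot I (gen \<alpha> c a) x \<in> m"
  shows "\<exists>\<sigma>\<in>carrier (DEnd_alg R P). \<forall>p\<in>I. mat \<sigma> p \<ominus> x p \<in> m"
proof -
  let ?F = "residue_algebra A m"
  interpret F: base_change A R P n e co ?F by (rule bc)
  interpret m: ideal m A by fact
  interpret T: comm_group F.T by (rule F.tensor_group_comm_group)
  have same: "a \<ominus> b \<in> m \<longleftrightarrow> m +> a = m +> b" if "a \<in> carrier A" "b \<in> carrier A" for a b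
    using that R.quotient_eq_iff_same_a_r_cos[OF m] by auto
  have Sc: "linmap x p \<in> carrier P" if "p \<in> carrier P" for p using linmap_closed[OF x] that by simp
  let ?g = "\<lambda>u p. F.pt u (linmap x p)"
  have bal: "F.balanced F.T ?g"
  proof (rule F.balancedI)
    show "F.pt u (linmap x p) \<in> carrier F.T" if "u \<in> carrier ?F" "p \<in> carrier F.Q" for u p
      using that Sc by (intro F.pure_closed) auto
    show "F.pt (u \<oplus>\<^bsub>?F\<^esub> v) (linmap x p) = F.pt u (linmap x p) \<otimes>\<^bsub>F.T\<^esub> F.pt v (linmap x p)"
      if "u \<in> carrier ?F" "v \<in> carrier ?F" "p \<in> carrier F.Q" for u v p
      using that Sc by (intro F.pure_add_left) auto
    show "F.pt u (linmap x (p \<oplus>\<^bsub>F.Q\<^esub> q)) = F.pt u (linmap x p) \<otimes>\<^bsub>F.T\<^esub> F.pt u (linmap x q)"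
      if "u \<in> carrier ?F" "p \<in> carrier F.Q" "q \<in> carrier F.Q" for u p q
      unfolding linmap_add[OF x that(2,3)] using that Sc by (intro F.pure_add_right) auto
    show "F.pt (k \<odot>\<^bsub>?F\<^esub> u) (linmap x p) = F.pt u (linmap x (k \<odot>\<^bsub>F.Q\<^esub> p))"
      if "k \<in> carrier A" "u \<in> carrier ?F" "p \<in> carrier F.Q" for k u p
      unfolding linmap_smult[OF x that(3,1)] using that Sc by (intro F.pure_smult) auto
  qed
  let ?h = "tensor_lift F.T ?g"
  have h_hom: "?h \<in> hom F.T F.T" by (rule F.tensor_lift_hom[OF F.tensor_group_comm_group bal])
  have h_pure: "?h (F.pt u p) = F.pt u (linmap x p)" if "u \<in> carrier ?F" "p \<in> carrier P" for u p
    using F.tensor_lift_pure[OF F.tensor_group_comm_group bal, of u p] that by simp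
  define f where "f = (\<lambda>w\<in>carrier F.T. ?h w)"
  have f_hom: "f \<in> hom F.T F.T" using h_hom by (auto simp: f_def hom_def)
  have f_pure: "f (F.pt u p) = F.pt u (linmap x p)" if "u \<in> carrier ?F" "p \<in> carrier P" for u p
    using h_pure[OF that] F.pure_closed[of u p] that by (simp add: f_def)
  have "f \<in> carrier F.\<D>\<^sub>B"
  proof (rule F.DEnd_B_I[OF _ f_hom])
    show "f \<in> extensional (carrier F.T)" by (simp add: f_def)
    fix y \<alpha> w assume y: "y \<in> carrier ?F" and \<alpha>: "\<alpha> \<in> carrier F.\<Lambda>" and w: "w \<in> carrier F.T"
    have py: "F.L.XY.pt y \<alpha> \<in> carrier F.L.XY.T" using y \<alpha> by (intro F.L.XY.pure_closed)
    note Lhom = F.L.pairing_hom_right[OF py]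
    show "f (F.L.pairing (F.L.XY.pt y \<alpha>) w) = F.L.pairing (F.L.XY.pt y \<alpha>) (f w)"
    proof (rule F.basis_hom_eqI[OF F.tensor_group_comm_group _ _ _ w])
      show "(\<lambda>w. f (F.L.pairing (F.L.XY.pt y \<alpha>) w)) \<in> hom F.T F.T"
        using hom_compose[OF Lhom f_hom] by (simp add: comp_def)
      show "(\<lambda>w. F.L.pairing (F.L.XY.pt y \<alpha>) (f w)) \<in> hom F.T F.T"
        using hom_compose[OF f_hom Lhom] by (simp add: comp_def)
      fix u a assume u: "u \<in> carrier ?F" and a: "a < n"
      define v where "v = u \<otimes>\<^bsub>?F\<^esub> y"
      have v: "v \<in> carrier ?F" unfolding v_def by (rule F.B.m_closed[OF u y])
      have ea: "e a \<in> carrier P" "\<alpha> (e a) \<in> carrier P" "linmap x (e a) \<in> carrier P"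
        "linmap x (\<alpha> (e a)) \<in> carrier P" "\<alpha> (linmap x (e a)) \<in> carrier P"
        using a \<alpha> Sc by (auto simp: End_algD)
      have L: "F.L.pairing (F.L.XY.pt y \<alpha>) (F.pt u p) = F.pt v (\<alpha> p)" if "p \<in> carrier P" for p
        unfolding v_def using that y \<alpha> u by (intro F.L.pairing_pure) auto
      have "F.pt v (linmap x (\<alpha> (e a))) = F.pt v (\<alpha> (linmap x (e a)))"
      proof (rule F.eps_eqI)
        fix c assume c: "c < n"
        let ?k = "co (linmap x (\<alpha> (e a))) c" and ?l = "co (\<alpha> (linmap x (e a))) c"
        \<comment> \<open>This difference is the commutator entry at (c, a); lying in
          \<open>m\<close>, it vanishes in the residue field.\<close>
        have "?k \<ominus> ?l \<in> m"
          using gen[OF \<alpha> c a] unfolding dot_gen[OF \<alpha> c a x] linmap_commute_basis[OF x \<alpha> c a] .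
        then have "m +> ?k = m +> ?l" using same ea by simp
        then show "F.eps c (F.pt v (linmap x (\<alpha> (e a)))) = F.eps c (F.pt v (\<alpha> (linmap x (e a))))"
          using v ea by (subst (1 2) F.eps_pure) auto
      qed (use v ea in \<open>auto intro!: F.pure_closed\<close>)
      then show "f (F.L.pairing (F.L.XY.pt y \<alpha>) (F.pt u (e a))) = F.L.pairing (F.L.XY.pt y \<alpha>) (f (F.pt u (e a)))"
        using u v ea by (simp only: L f_pure)
    qed
  qed
  then obtain t where t: "t \<in> carrier F.D.XY.T" "f = DEnd_map A ?F R P t"
    using surj by (auto simp: tensor_algebra_def)
  have one: "\<one>\<^bsub>?F\<^esub> \<in> carrier ?F" by (rule F.B.one_closed)
  interpret D: module A "DEnd_alg R P" by (rule F.DEnd_module)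
  interpret DT: comm_group F.D.XY.T by (rule F.D.XY.tensor_group_comm_group)
  \<comment> \<open>An element of the residue field is the image of some \<open>k\<close> in
    \<open>A\<close>, and \<open>k\<close> may cross the tensor sign. So all first factors become 1,
    and tensors with first factor 1 add up to such a tensor.\<close>
  have "\<exists>\<sigma>\<in>carrier (DEnd_alg R P). t = F.D.XY.pt \<one>\<^bsub>?F\<^esub> \<sigma>"
    using t(1)
  proof (induction rule: F.D.XY.tensor_induct)
    case one
    have "F.D.XY.pt \<one>\<^bsub>?F\<^esub> \<zero>\<^bsub>DEnd_alg R P\<^esub> \<otimes>\<^bsub>F.D.XY.T\<^esub> F.D.XY.pt \<one>\<^bsub>?F\<^esub> \<zero>\<^bsub>DEnd_alg R P\<^esub> = F.D.XY.pt \<one>\<^bsub>?F\<^esub> \<zero>\<^bsub>DEnd_alg R P\<^esub>"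
      using F.D.XY.pure_add_right[OF F.B.one_closed D.M.zero_closed D.M.zero_closed] by simp
    then have "F.D.XY.pt \<one>\<^bsub>?F\<^esub> \<zero>\<^bsub>DEnd_alg R P\<^esub> = \<one>\<^bsub>F.D.XY.T\<^esub>"
      using F.D.XY.pure_closed[OF F.B.one_closed D.M.zero_closed] by (metis DT.l_cancel_one')
    then show ?case using D.M.zero_closed by metis
  next
    case (pure y \<sigma>)
    then obtain k where k: "k \<in> carrier A" "y = m +> k"
      by (auto simp: FactRing_def A_RCOSETS_def' )
    have "y = k \<odot>\<^bsub>?F\<^esub> \<one>\<^bsub>?F\<^esub>"
      using pure(1) monoid.r_one[OF ring.axioms(2)[OF m.quotient_is_ring]] k by simp
    then have "F.D.XY.pt y \<sigma> = F.D.XY.pt \<one>\<^bsub>?F\<^esub> (k \<odot>\<^bsub>DEnd_alg R P\<^esub> \<sigma>)"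
      using F.D.XY.pure_smult[OF k(1) F.B.one_closed pure(2)] by simp
    then show ?case using k pure by blast
  next
    case (mult u v)
    then show ?case using F.D.XY.pure_add_right[OF F.B.one_closed, symmetric] D.M.a_closed by metis
  qed
  then obtain \<sigma> where \<sigma>: "\<sigma> \<in> carrier (DEnd_alg R P)" "t = F.D.XY.pt \<one>\<^bsub>?F\<^esub> \<sigma>" by blast
  have "mat \<sigma> p \<ominus> x p \<in> m" if p: "p \<in> I" for p
  proof -
    have xp: "x p \<in> carrier A" "mat \<sigma> p \<in> carrier A" using x mat_closed[OF \<sigma>(1)] by auto
    have "F.Y f p = x p \<odot>\<^bsub>?F\<^esub> \<one>\<^bsub>?F\<^esub>"
    proof -
      have sp: "snd p < n" "fst p < n" using p by auto
      have "F.Y f p = F.eps (fst p) (F.pt \<one>\<^bsub>?F\<^esub> (linmap x (e (snd p))))"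
        unfolding F.Y_def using f_pure[OF one e_closed'[OF sp(1)]] by simp
      also have "\<dots> = co (linmap x (e (snd p))) (fst p) \<odot>\<^bsub>?F\<^esub> \<one>\<^bsub>?F\<^esub>"
        by (rule F.eps_pure[OF one]) (use Sc sp in simp)
      finally show ?thesis using co_linmap_basis[OF x sp] by simp
    qed
    moreover have "F.Y f p = mat \<sigma> p \<odot>\<^bsub>?F\<^esub> \<one>\<^bsub>?F\<^esub>"
      unfolding t(2) \<sigma>(2) by (rule F.Y_DEnd_map_pure[OF one \<sigma>(1) p])
    moreover have "(m +> k) \<otimes>\<^bsub>A Quot m\<^esub> \<one>\<^bsub>A Quot m\<^esub> = m +> k" if "k \<in> carrier A" for k
      using monoid.r_one[OF ring.axioms(2)[OF m.quotient_is_ring]] ring_hom_closed[OF m.rcos_ring_hom that] by simp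
    ultimately have "m +> mat \<sigma> p = m +> x p" using xp by simp
    then show ?thesis using same xp by blast
  qed
  then show ?thesis using \<sigma>(1) by blast
qed

section \<open>The inverse of the base change map\<close>

context base_change
begin

interpretation T: comm_group T by (rule tensor_group_comm_group)

text \<open>A dual basis, as for finitely generated projective modules: the elements
  \<open>s i\<close> together with the functionals taking matrix entry \<open>i\<close> reproduce
  every double centraliser of \<open>P\<close>. The same \<open>s\<close>, defined over
  \<open>A\<close>, also reproduces the matrices over \<open>B\<close>, and this inverts the base
  change map.\<close>

lemma exists_dual_system:
  assumes dom: "domain A"
    and lift: "\<And>m x. \<lbrakk> maximalideal m A; x \<in> UNIV \<rightarrow> carrier A;
        \<And>\<alpha> c a. \<lbrakk> \<alpha> \<in> carrier \<Lambda>; c < n; a < n \<rbrakk> \<Longrightarrow> R.dot I (gen \<alpha> c a) x \<in> m \<rbrakk>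
      \<Longrightarrow> \<exists>\<sigma>\<in>carrier \<D>. \<forall>p\<in>I. mat \<sigma> p \<ominus> x p \<in> m"
  shows "\<exists>s. (\<forall>i\<in>I. s i \<in> carrier \<D>) \<and>
    (\<forall>\<sigma>\<in>carrier \<D>. \<forall>j\<in>I. (\<Oplus>i\<in>I. mat \<sigma> i \<otimes> mat (s i) j) = mat \<sigma> j) \<and>
    (\<forall>f\<in>carrier \<D>\<^sub>B. \<forall>j\<in>I. (\<Oplus>\<^bsub>B\<^esub>i\<in>I. mat (s i) j \<odot>\<^bsub>B\<^esub> Y f i) = Y f j)"
proof -
  \<comment> \<open>The linear relations satisfied by all double centraliser matrices, over \<open>A\<close> and over \<open>B\<close>.
    The span of \<open>\<Phi>\<close> has a complementary projection \<open>S\<close>, whose rows are again such matrices over \<open>A\<close>.\<close>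
  define \<Phi> where "\<Phi> = {c \<in> UNIV \<rightarrow> carrier A. (\<forall>\<sigma>\<in>carrier \<D>. R.dot I c (mat \<sigma>) = \<zero>) \<and>
    (\<forall>f\<in>carrier \<D>\<^sub>B. (\<Oplus>\<^bsub>B\<^esub>i\<in>I. c i \<odot>\<^bsub>B\<^esub> Y f i) = \<zero>\<^bsub>B\<^esub>)}"
  have fin: "finite I" by simp
  have Yc: "Y f i \<in> carrier B" if "f \<in> carrier \<D>\<^sub>B" "i \<in> I" for f i
    using Y_closed[OF DEnd_B_D(2)[OF that(1)] that(2)] .
  have gen_Phi: "gen \<alpha> c a \<in> \<Phi>" if "\<alpha> \<in> carrier \<Lambda>" "c < n" "a < n" for \<alpha> c a
    unfolding \<Phi>_def using that gen_closed dot_gen_mat Y_gen by blast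
  have "\<exists>T. (\<forall>i\<in>I. T i \<in> \<Phi>) \<and> (\<forall>c\<in>\<Phi>. \<forall>j\<in>I. R.dot I c (\<lambda>i. T i j) = c j)"
  proof (rule domain.splitting[OF dom fin])
    show "\<Phi> \<subseteq> UNIV \<rightarrow> carrier A" by (auto simp: \<Phi>_def)
    have "(\<lambda>_. \<zero>) \<in> \<Phi>"
    proof -
      have "R.dot I (\<lambda>_. \<zero>) (mat \<sigma>) = \<zero>" if "\<sigma> \<in> carrier \<D>" for \<sigma>
      proof -
        have "R.dot I (\<lambda>_. \<zero>) (mat \<sigma>) = (\<Oplus>i\<in>I. \<zero>)"
          unfolding R.dot_def by (rule R.finsum_cong') (use mat_closed[OF that] in \<open>auto simp: Pi_iff\<close>)
        then show ?thesis by (simp add: R.finsum_zero)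
      qed
      moreover have "(\<Oplus>\<^bsub>B\<^esub>i\<in>I. \<zero> \<odot>\<^bsub>B\<^esub> Y f i) = \<zero>\<^bsub>B\<^esub>" if "f \<in> carrier \<D>\<^sub>B" for f
      proof -
        have "(\<Oplus>\<^bsub>B\<^esub>i\<in>I. \<zero> \<odot>\<^bsub>B\<^esub> Y f i) = (\<Oplus>\<^bsub>B\<^esub>i\<in>I. \<zero>\<^bsub>B\<^esub>)"
          by (rule B.M.finsum_cong') (use Yc[OF that] in auto)
        then show ?thesis by (simp add: B.M.finsum_zero)
      qed
      ultimately show ?thesis by (simp add: \<Phi>_def)
    qed
    then show "\<Phi> \<noteq> {}" by blast
    show "(\<lambda>i. a \<otimes> c i \<oplus> b \<otimes> d i) \<in> \<Phi>"
      if cd: "c \<in> \<Phi>" "d \<in> \<Phi>" and ab: "a \<in> carrier A" "b \<in> carrier A" for c d a b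
    proof -
      have c: "c i \<in> carrier A" and d: "d i \<in> carrier A" for i using cd by (auto simp: \<Phi>_def)
      have "R.dot I (\<lambda>i. a \<otimes> c i \<oplus> b \<otimes> d i) (mat \<sigma>) = \<zero>" if "\<sigma> \<in> carrier \<D>" for \<sigma>
      proof -
        have "R.dot I (\<lambda>i. a \<otimes> c i \<oplus> b \<otimes> d i) (mat \<sigma>) = a \<otimes> R.dot I c (mat \<sigma>) \<oplus> b \<otimes> R.dot I d (mat \<sigma>)"
          by (rule R.dot_lincomb_left) (use c d ab mat_closed[OF that] in auto)
        then show ?thesis using cd that ab by (simp add: \<Phi>_def)
      qed
      moreover have "(\<Oplus>\<^bsub>B\<^esub>i\<in>I. (a \<otimes> c i \<oplus> b \<otimes> d i) \<odot>\<^bsub>B\<^esub> Y f i) = \<zero>\<^bsub>B\<^esub>" if f: "f \<in> carrier \<D>\<^sub>B" for f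
      proof -
        have "(\<Oplus>\<^bsub>B\<^esub>i\<in>I. (a \<otimes> c i \<oplus> b \<otimes> d i) \<odot>\<^bsub>B\<^esub> Y f i)
          = (\<Oplus>\<^bsub>B\<^esub>i\<in>I. a \<odot>\<^bsub>B\<^esub> (c i \<odot>\<^bsub>B\<^esub> Y f i) \<oplus>\<^bsub>B\<^esub> b \<odot>\<^bsub>B\<^esub> (d i \<odot>\<^bsub>B\<^esub> Y f i))"
          by (rule B.M.finsum_cong') (use c d ab Yc[OF f] in \<open>auto simp: B.smult_l_distr B.smult_assoc1\<close>)
        also have "\<dots> = (\<Oplus>\<^bsub>B\<^esub>i\<in>I. a \<odot>\<^bsub>B\<^esub> (c i \<odot>\<^bsub>B\<^esub> Y f i)) \<oplus>\<^bsub>B\<^esub> (\<Oplus>\<^bsub>B\<^esub>i\<in>I. b \<odot>\<^bsub>B\<^esub> (d i \<odot>\<^bsub>B\<^esub> Y f i))"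
          by (rule B.M.finsum_addf) (use c d ab Yc[OF f] in auto)
        also have "(\<Oplus>\<^bsub>B\<^esub>i\<in>I. a \<odot>\<^bsub>B\<^esub> (c i \<odot>\<^bsub>B\<^esub> Y f i)) = a \<odot>\<^bsub>B\<^esub> (\<Oplus>\<^bsub>B\<^esub>i\<in>I. c i \<odot>\<^bsub>B\<^esub> Y f i)"
          by (rule B.finsum_smult_ldistr[symmetric]) (use c ab Yc[OF f] in auto)
        also have "(\<Oplus>\<^bsub>B\<^esub>i\<in>I. b \<odot>\<^bsub>B\<^esub> (d i \<odot>\<^bsub>B\<^esub> Y f i)) = b \<odot>\<^bsub>B\<^esub> (\<Oplus>\<^bsub>B\<^esub>i\<in>I. d i \<odot>\<^bsub>B\<^esub> Y f i)"
          by (rule B.finsum_smult_ldistr[symmetric]) (use d ab Yc[OF f] in auto)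
        finally show ?thesis using cd f ab by (simp add: \<Phi>_def)
      qed
      ultimately show ?thesis using c d ab by (simp add: \<Phi>_def)
    qed
    show "\<exists>w\<in>UNIV \<rightarrow> carrier A. (\<forall>c\<in>\<Phi>. R.dot I c w = \<zero>) \<and> (\<forall>i\<in>I. w i \<ominus> x i \<in> m)"
      if m: "maximalideal m A" and x: "x \<in> UNIV \<rightarrow> carrier A" and xm: "\<And>c. c \<in> \<Phi> \<Longrightarrow> R.dot I c x \<in> m" for m x
    proof -
      \<comment> \<open>Orthogonality modulo \<open>m\<close> is applied to the relations
        \<open>gen\<close>, which belong to \<open>\<Phi>\<close>. The lift obtained is orthogonal
        to all of \<open>\<Phi>\<close>, since membership in \<open>\<Phi>\<close> demands
        orthogonality to every \<open>mat \<sigma>\<close>.\<close>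
      obtain \<sigma> where \<sigma>: "\<sigma> \<in> carrier \<D>" "\<forall>p\<in>I. mat \<sigma> p \<ominus> x p \<in> m"
        using lift[OF m x xm[OF gen_Phi]] by blast
      then have "\<forall>c\<in>\<Phi>. R.dot I c (mat \<sigma>) = \<zero>" by (auto simp: \<Phi>_def)
      then show ?thesis using \<sigma>(2) mat_closed[OF \<sigma>(1)] by blast
    qed
  qed
  then obtain T where *: "(\<forall>i\<in>I. T i \<in> \<Phi>) \<and> (\<forall>c\<in>\<Phi>. \<forall>j\<in>I. R.dot I c (\<lambda>i. T i j) = c j)"
    by (rule exE)
  note T = bspec[OF conjunct1[OF *]] and proj = bspec[OF bspec[OF conjunct2[OF *]]]
  have Tc: "T i j \<in> carrier A" if "i \<in> I" for i j using T[OF that] by (auto simp: \<Phi>_def)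
  \<comment> \<open>Column \<open>i\<close> of the identity matrix minus \<open>T\<close>. Each
    \<open>c\<close> in \<open>\<Phi>\<close> annihilates it, because the row \<open>c\<close> times
    \<open>T\<close> is \<open>c\<close> again; as \<open>\<Phi>\<close> contains all
    \<open>gen\<close>, the column is the matrix of a double centraliser over
    \<open>A\<close>.\<close>
  define S where "S i j = (if j \<in> I then (if j = i then \<one> else \<zero>) \<ominus> T j i else \<zero>)" for i j
  have Sc: "S i \<in> UNIV \<rightarrow> carrier A" for i using Tc by (auto simp: S_def)
  have "R.dot I c (S i) = \<zero>" if c: "c \<in> \<Phi>" and i: "i \<in> I" for c i
  proof -
    have cc: "c \<in> I \<rightarrow> carrier A" using c by (auto simp: \<Phi>_def)
    have "R.dot I c (S i) = R.dot I c (\<lambda>j. (if j = i then \<one> else \<zero>) \<ominus> T j i)"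
      by (rule R.dot_cong) (use cc Tc in \<open>auto simp: S_def\<close>)
    also have "\<dots> = c i \<ominus> R.dot I c (\<lambda>j. T j i)"
      by (rule R.dot_delta_diff) (use i cc Tc in auto)
    finally show ?thesis using proj[OF c i] funcset_mem[OF cc i] by (simp add: R.minus_eq R.r_neg)
  qed
  then have sD: "linmap (S i) \<in> carrier \<D>" if "i \<in> I" for i
    using linmap_in_DEnd[OF Sc] gen_Phi that by blast
  have matS: "mat (linmap (S i)) j = (if i = j then \<one> else \<zero>) \<ominus> T j i" if "j \<in> I" for i j
    using mat_linmap[OF Sc that] that by (auto simp: S_def)
  \<comment> \<open>Entry \<open>j\<close> of the identity minus \<open>T\<close> applied to
    \<open>mat \<sigma>\<close>. Row \<open>j\<close> of \<open>T\<close> contributes nothing, being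
    a member of \<open>\<Phi>\<close>; the same holds below for \<open>Y f\<close>.\<close>
  have "(\<Oplus>i\<in>I. mat \<sigma> i \<otimes> mat (linmap (S i)) j) = mat \<sigma> j" if \<sigma>: "\<sigma> \<in> carrier \<D>" and j: "j \<in> I" for \<sigma> j
  proof -
    have mc: "mat \<sigma> \<in> I \<rightarrow> carrier A" and mj: "mat \<sigma> j \<in> carrier A" using mat_closed[OF \<sigma>] by auto
    have "(\<Oplus>i\<in>I. mat \<sigma> i \<otimes> mat (linmap (S i)) j) = R.dot I (mat \<sigma>) (\<lambda>i. (if i = j then \<one> else \<zero>) \<ominus> T j i)"
      unfolding R.dot_def matS[OF j] ..
    also have "\<dots> = mat \<sigma> j \<ominus> R.dot I (mat \<sigma>) (T j)"
      by (rule R.dot_delta_diff) (use j mc Tc in auto)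
    also have "R.dot I (mat \<sigma>) (T j) = R.dot I (T j) (mat \<sigma>)"
      by (rule R.dot_commute) (use j mc Tc in auto)
    also have "\<dots> = \<zero>" using T[OF j] \<sigma> by (simp add: \<Phi>_def)
    finally show ?thesis using mj by (simp add: R.minus_eq)
  qed
  moreover have "(\<Oplus>\<^bsub>B\<^esub>i\<in>I. mat (linmap (S i)) j \<odot>\<^bsub>B\<^esub> Y f i) = Y f j" if f: "f \<in> carrier \<D>\<^sub>B" and j: "j \<in> I" for f j
  proof -
    have "(\<Oplus>\<^bsub>B\<^esub>i\<in>I. ((if i = j then \<one> else \<zero>) \<ominus> T j i) \<odot>\<^bsub>B\<^esub> Y f i) = Y f j \<ominus>\<^bsub>B\<^esub> (\<Oplus>\<^bsub>B\<^esub>i\<in>I. T j i \<odot>\<^bsub>B\<^esub> Y f i)"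
      by (rule B.finsum_delta_diff) (use j Tc Yc[OF f] in auto)
    also have "(\<Oplus>\<^bsub>B\<^esub>i\<in>I. T j i \<odot>\<^bsub>B\<^esub> Y f i) = \<zero>\<^bsub>B\<^esub>" using T[OF j] f by (simp add: \<Phi>_def)
    finally show ?thesis unfolding matS[OF j] using Yc[OF f j] by (simp add: B.M.minus_eq)
  qed
  ultimately show ?thesis using sD by (intro exI[of _ "\<lambda>i. linmap (S i)"]) blast
qed

text \<open>The inverse sends \<open>f\<close> to the sum of the tensors Y f i \<otimes> s i. For
  the image of x \<otimes> \<sigma> the entry \<open>i\<close> is \<open>x\<close> multiplied by
  \<open>mat \<sigma> i\<close>; these scalars cross the tensor sign and reassemble \<sigma>. For
  the other composite the matrices over \<open>B\<close> agree, and they determine members of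
  \<open>\<D>\<^sub>B\<close>.\<close>

lemma bij_DEnd_map:
  assumes "\<exists>s. (\<forall>i\<in>I. s i \<in> carrier \<D>) \<and>
    (\<forall>\<sigma>\<in>carrier \<D>. \<forall>j\<in>I. (\<Oplus>i\<in>I. mat \<sigma> i \<otimes> mat (s i) j) = mat \<sigma> j) \<and>
    (\<forall>f\<in>carrier \<D>\<^sub>B. \<forall>j\<in>I. (\<Oplus>\<^bsub>B\<^esub>i\<in>I. mat (s i) j \<odot>\<^bsub>B\<^esub> Y f i) = Y f j)"
  shows "bij_betw (DEnd_map A B R P) (carrier D.XY.T) (carrier \<D>\<^sub>B)"
proof -
  obtain s where *: "(\<forall>i\<in>I. s i \<in> carrier \<D>) \<and>
    (\<forall>\<sigma>\<in>carrier \<D>. \<forall>j\<in>I. (\<Oplus>i\<in>I. mat \<sigma> i \<otimes> mat (s i) j) = mat \<sigma> j) \<and>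
    (\<forall>f\<in>carrier \<D>\<^sub>B. \<forall>j\<in>I. (\<Oplus>\<^bsub>B\<^esub>i\<in>I. mat (s i) j \<odot>\<^bsub>B\<^esub> Y f i) = Y f j)"
    using assms by (rule exE)
  note sD = bspec[OF conjunct1[OF *]]
    and rep = bspec[OF bspec[OF conjunct1[OF conjunct2[OF *]]]]
    and repY = bspec[OF bspec[OF conjunct2[OF conjunct2[OF *]]]]
  interpret D: module A \<D> by (rule DEnd_module)
  interpret DT: comm_group D.XY.T by (rule D.XY.tensor_group_comm_group)
  have pt_hom: "(\<lambda>x. D.XY.pt x (s i)) \<in> hom (add_monoid B) D.XY.T" if "i \<in> I" for i
    by (rule homI) (use sD[OF that] in \<open>simp_all add: D.XY.pure_add_left\<close>)
  define recover where "recover f = finprod D.XY.T (\<lambda>i. D.XY.pt (Y f i) (s i)) I" for f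
  have left: "recover (DEnd_map A B R P u) = u" if u: "u \<in> carrier D.XY.T" for u
  proof (rule D.XY.tensor_hom_eqI[where h = "\<lambda>u. recover (DEnd_map A B R P u)" and h' = "\<lambda>u. u", OF DT.is_group _ _ _ u])
    show "(\<lambda>u. recover (DEnd_map A B R P u)) \<in> hom D.XY.T D.XY.T"
      unfolding recover_def
    proof (rule finprod_hom[OF D.XY.tensor_group_comm_group])
      fix i assume "i \<in> I"
      from hom_compose[OF Y_DEnd_map_hom[OF this] pt_hom[OF this]]
      show "(\<lambda>u. D.XY.pt (Y (DEnd_map A B R P u) i) (s i)) \<in> hom D.XY.T D.XY.T" by (simp add: comp_def)
    qed
    show "(\<lambda>u. u) \<in> hom D.XY.T D.XY.T" by (auto simp: hom_def)
    fix x \<sigma> assume x: "x \<in> carrier B" and \<sigma>: "\<sigma> \<in> carrier \<D>"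
    have mc: "mat \<tau> i \<in> carrier A" if "\<tau> \<in> carrier \<D>" for \<tau> i using mat_closed[OF that] by auto
    have sum: "(\<Oplus>\<^bsub>\<D>\<^esub>i\<in>I. mat \<sigma> i \<odot>\<^bsub>\<D>\<^esub> s i) = \<sigma>"
    \<comment> \<open>A double centraliser is determined by its matrix, and entry by entry the
      identity is \<open>rep\<close>.\<close>
    proof (rule mat_eqI[OF _ \<sigma>])
      show "(\<Oplus>\<^bsub>\<D>\<^esub>i\<in>I. mat \<sigma> i \<odot>\<^bsub>\<D>\<^esub> s i) \<in> carrier \<D>"
        by (rule D.M.finsum_closed) (use mc \<sigma> sD in auto)
      fix j assume j: "j \<in> I"
      note bil = bilinear_opD[OF bilinear_op_DEnd]
      have add: "mat (\<tau> \<oplus>\<^bsub>\<D>\<^esub> \<rho>) j = mat \<tau> j \<oplus> mat \<rho> j" if "\<tau> \<in> carrier \<D>" "\<rho> \<in> carrier \<D>" for \<tau> \<rho>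
        using j that bil(2)[OF that] by (auto simp: mat_def co_add[unfolded restrict_scalars_simps] DEnd_closed)
      have sm: "mat (k \<odot>\<^bsub>\<D>\<^esub> \<tau>) j = k \<otimes> mat \<tau> j" if "k \<in> carrier A" "\<tau> \<in> carrier \<D>" for k \<tau>
        using j that bil(4)[OF that] by (auto simp: mat_def co_smult DEnd_closed simp del: restrict_scalars_simps(4))
      have "mat (\<Oplus>\<^bsub>\<D>\<^esub>i\<in>I. mat \<sigma> i \<odot>\<^bsub>\<D>\<^esub> s i) j = (\<Oplus>i\<in>I. mat (mat \<sigma> i \<odot>\<^bsub>\<D>\<^esub> s i) j)"
        by (rule additive_finsum[where h = "\<lambda>\<tau>. mat \<tau> j", OF D.M.abelian_group_axioms R.abelian_group_axioms])
          (use mc \<sigma> sD add in auto)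
      also have "\<dots> = (\<Oplus>i\<in>I. mat \<sigma> i \<otimes> mat (s i) j)"
        by (rule R.finsum_cong') (use mc \<sigma> sD sm in auto)
      finally show "mat (\<Oplus>\<^bsub>\<D>\<^esub>i\<in>I. mat \<sigma> i \<odot>\<^bsub>\<D>\<^esub> s i) j = mat \<sigma> j" using rep[OF \<sigma> j] by simp
    qed
    have "recover (DEnd_map A B R P (D.XY.pt x \<sigma>)) = finprod D.XY.T (\<lambda>i. D.XY.pt x (mat \<sigma> i \<odot>\<^bsub>\<D>\<^esub> s i)) I"
      unfolding recover_def
    proof (rule DT.finprod_cong')
      show "D.XY.pt (Y (DEnd_map A B R P (D.XY.pt x \<sigma>)) i) (s i) = D.XY.pt x (mat \<sigma> i \<odot>\<^bsub>\<D>\<^esub> s i)" if "i \<in> I" for i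
        unfolding Y_DEnd_map_pure[OF x \<sigma> that] by (rule D.XY.pure_smult[OF mc[OF \<sigma>] x sD[OF that]])
    qed (use mc \<sigma> sD x in auto)
    also have "\<dots> = D.XY.pt x (\<Oplus>\<^bsub>\<D>\<^esub>i\<in>I. mat \<sigma> i \<odot>\<^bsub>\<D>\<^esub> s i)"
      unfolding finsum_def
      by (rule hom_finprod[symmetric, where h = "\<lambda>\<tau>. D.XY.pt x \<tau>", OF D.M.a_comm_group D.XY.tensor_group_comm_group])
        (use mc \<sigma> sD x in \<open>auto intro!: homI simp: D.XY.pure_add_right\<close>)
    finally show "recover (DEnd_map A B R P (D.XY.pt x \<sigma>)) = D.XY.pt x \<sigma>" unfolding sum .
  qed
  have recover_closed: "recover f \<in> carrier D.XY.T" if f: "f \<in> carrier \<D>\<^sub>B" for f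
    unfolding recover_def
    by (rule DT.finprod_closed) (use sD Y_closed[OF DEnd_B_D(2)[OF f]] in \<open>auto intro!: D.XY.pure_closed\<close>)
  have right: "DEnd_map A B R P (recover f) = f" if f: "f \<in> carrier \<D>\<^sub>B" for f
  proof (rule DEnd_B_eqI[OF DEnd_map_in[OF recover_closed[OF f]] f])
    fix j assume j: "j \<in> I"
    have Yc: "Y f i \<in> carrier B" if "i \<in> I" for i using Y_closed[OF DEnd_B_D(2)[OF f] that] .
    have "Y (DEnd_map A B R P (recover f)) j = finprod (add_monoid B) (\<lambda>i. Y (DEnd_map A B R P (D.XY.pt (Y f i) (s i))) j) I"
      unfolding recover_def
      by (rule hom_finprod[OF D.XY.tensor_group_comm_group B_comm_group Y_DEnd_map_hom[OF j]])
        (use sD Yc in \<open>auto intro!: D.XY.pure_closed\<close>)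
    also have "\<dots> = (\<Oplus>\<^bsub>B\<^esub>i\<in>I. mat (s i) j \<odot>\<^bsub>B\<^esub> Y f i)"
      unfolding finsum_def
    proof (rule comm_monoid.finprod_cong'[OF comm_group.axioms(1)[OF B_comm_group]])
      show "Y (DEnd_map A B R P (D.XY.pt (Y f i) (s i))) j = mat (s i) j \<odot>\<^bsub>B\<^esub> Y f i" if "i \<in> I" for i
        by (rule Y_DEnd_map_pure[OF Yc[OF that] sD[OF that] j])
      show "(\<lambda>i. mat (s i) j \<odot>\<^bsub>B\<^esub> Y f i) \<in> I \<rightarrow> carrier (add_monoid B)"
      proof
        fix i assume i: "i \<in> I"
        show "mat (s i) j \<odot>\<^bsub>B\<^esub> Y f i \<in> carrier (add_monoid B)"
          using B.smult_closed[OF funcset_mem[OF mat_closed[OF sD[OF i]] UNIV_I] Yc[OF i]] by simp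
      qed
    qed simp
    finally show "Y (DEnd_map A B R P (recover f)) j = Y f j" using repY[OF f j] by simp
  qed
  show ?thesis
    by (rule bij_betwI[where g = recover]) (use left right recover_closed DEnd_map_in in auto)
qed

lemma DEnd_B_mult: "f \<otimes>\<^bsub>\<D>\<^sub>B\<^esub> g = (\<lambda>w\<in>carrier T. f (g w))"
  by (simp add: DEnd_alg_def End_alg_simps compose_def)

lemma DEnd_B_add: "f \<oplus>\<^bsub>\<D>\<^sub>B\<^esub> g = (\<lambda>w\<in>carrier T. f w \<otimes>\<^bsub>T\<^esub> g w)"
  by (simp add: DEnd_alg_def End_alg_simps)

lemma DEnd_B_one: "\<one>\<^bsub>\<D>\<^sub>B\<^esub> = (\<lambda>w\<in>carrier T. w)"
  by (simp add: DEnd_alg_def End_alg_simps)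

lemma DEnd_map_additive:
  assumes "u \<in> carrier D.XY.T" "v \<in> carrier D.XY.T"
  shows "DEnd_map A B R P (u \<otimes>\<^bsub>D.XY.T\<^esub> v) = DEnd_map A B R P u \<oplus>\<^bsub>\<D>\<^sub>B\<^esub> DEnd_map A B R P v"
  by (auto simp: DEnd_map_eq DEnd_B_add D.pairing_add_left assms intro!: ext)

end

section \<open>The isomorphism\<close>

lemma tensor_algebra_simps:
  "carrier (tensor_algebra A B R) = carrier (tensor_group A B R)"
  "monoid.mult (tensor_algebra A B R) = tensor_pairing A B R (monoid.mult B) (monoid.mult R)"
  "\<one>\<^bsub>tensor_algebra A B R\<^esub> = pure_tensor A B R \<one>\<^bsub>B\<^esub> \<one>\<^bsub>R\<^esub>"
  "ring.add (tensor_algebra A B R) = monoid.mult (tensor_group A B R)"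
  "smult (tensor_algebra A B R) = (\<lambda>a. tensor_lift (tensor_group A B R) (\<lambda>b r. pure_tensor A B R (a \<odot>\<^bsub>B\<^esub> b) r))"
  by (simp_all add: tensor_algebra_def)

lemma (in tensor_factors) scalar_balanced:
  assumes a: "a \<in> carrier A"
  shows "balanced T (\<lambda>x y. pt (a \<odot>\<^bsub>M\<^esub> x) y)"
proof -
  interpret M: module A M by (rule module_M)
  interpret N: module A N by (rule module_N)
  show ?thesis
  proof (rule balancedI)
    fix k x y assume *: "k \<in> carrier A" "x \<in> carrier M" "y \<in> carrier N"
    have "a \<odot>\<^bsub>M\<^esub> (k \<odot>\<^bsub>M\<^esub> x) = k \<odot>\<^bsub>M\<^esub> (a \<odot>\<^bsub>M\<^esub> x)"
      using * a M.smult_assoc1[of a k x] M.smult_assoc1[of k a x] by (simp add: M.R.m_comm)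
    then show "pt (a \<odot>\<^bsub>M\<^esub> (k \<odot>\<^bsub>M\<^esub> x)) y = pt (a \<odot>\<^bsub>M\<^esub> x) (k \<odot>\<^bsub>N\<^esub> y)"
      using * a by (simp add: pure_smult)
  qed (use a in \<open>auto simp: M.smult_r_distr pure_add_left pure_add_right\<close>)
qed

section \<open>Compatibility with products and with the scalars of A\<close>

context base_change
begin

interpretation T: comm_group T by (rule tensor_group_comm_group)
interpretation P: left_module R P by (rule left_module)

lemma DEnd_assoc_algebra: "assoc_algebra A \<D>"
  unfolding DEnd_alg_def by (rule algebra_module.End_alg_assoc_algebra[OF eval_algebra_module])

interpretation DD: tensor_pairing_factors A B "DEnd_alg R P" B "DEnd_alg R P" "\<lambda>x y. x \<otimes>\<^bsub>B\<^esub> y" "\<lambda>x y. x \<otimes>\<^bsub>DEnd_alg R P\<^esub> y"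
  by (intro tensor_pairing_factors.intro tensor_factors.intro tensor_pairing_factors_axioms.intro
      B.module_axioms DEnd_module bilinear_op_mult[OF B.assoc_algebra_axioms] bilinear_op_mult[OF DEnd_assoc_algebra])

lemma DEnd_mult_apply: "p \<in> carrier P \<Longrightarrow> (\<sigma> \<otimes>\<^bsub>\<D>\<^esub> \<tau>) p = \<sigma> (\<tau> p)"
  by (simp add: DEnd_alg_def End_alg_simps compose_def)

text \<open>Both sides are additive in \<open>u\<close>, \<open>v\<close> and \<open>w\<close>
  separately. On pure tensors the claim is associativity of \<open>B\<close> and composition of
  double centralisers.\<close>

lemma pairing_mult:
  assumes u: "u \<in> carrier D.XY.T" and v: "v \<in> carrier D.XY.T" and w: "w \<in> carrier T"
  shows "D.pairing (DD.pairing u v) w = D.pairing u (D.pairing v w)"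
proof (rule D.XY.tensor_hom_eqI[where h = "\<lambda>u. D.pairing (DD.pairing u v) w", OF T.is_group _ _ _ u])
  show "(\<lambda>u. D.pairing (DD.pairing u v) w) \<in> hom D.XY.T T"
    using hom_compose[OF DD.pairing_hom_left[OF v] D.pairing_hom_left[OF w]] by (simp add: comp_def)
  show "(\<lambda>u. D.pairing u (D.pairing v w)) \<in> hom D.XY.T T"
    by (rule D.pairing_hom_left[OF D.pairing_closed[OF v w]])
  fix x \<sigma> assume x: "x \<in> carrier B" and \<sigma>: "\<sigma> \<in> carrier \<D>"
  have px: "D.XY.pt x \<sigma> \<in> carrier D.XY.T" using x \<sigma> by blast
  show "D.pairing (DD.pairing (D.XY.pt x \<sigma>) v) w = D.pairing (D.XY.pt x \<sigma>) (D.pairing v w)"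
  proof (rule D.XY.tensor_hom_eqI[where h = "\<lambda>v. D.pairing (DD.pairing (D.XY.pt x \<sigma>) v) w", OF T.is_group _ _ _ v])
    show "(\<lambda>v. D.pairing (DD.pairing (D.XY.pt x \<sigma>) v) w) \<in> hom D.XY.T T"
      using hom_compose[OF DD.pairing_hom_right[OF px] D.pairing_hom_left[OF w]] by (simp add: comp_def)
    show "(\<lambda>v. D.pairing (D.XY.pt x \<sigma>) (D.pairing v w)) \<in> hom D.XY.T T"
      using hom_compose[OF D.pairing_hom_left[OF w] D.pairing_hom_right[OF px]] by (simp add: comp_def)
    fix y \<tau> assume y: "y \<in> carrier B" and \<tau>: "\<tau> \<in> carrier \<D>"
    have py: "D.XY.pt y \<tau> \<in> carrier D.XY.T" using y \<tau> by blast
    have pxy: "DD.pairing (D.XY.pt x \<sigma>) (D.XY.pt y \<tau>) \<in> carrier D.XY.T" by (rule DD.pairing_closed[OF px py])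
    show "D.pairing (DD.pairing (D.XY.pt x \<sigma>) (D.XY.pt y \<tau>)) w = D.pairing (D.XY.pt x \<sigma>) (D.pairing (D.XY.pt y \<tau>) w)"
    proof (rule tensor_hom_eqI[where h = "\<lambda>w. D.pairing (DD.pairing (D.XY.pt x \<sigma>) (D.XY.pt y \<tau>)) w", OF T.is_group _ _ _ w])
      show "(\<lambda>w. D.pairing (DD.pairing (D.XY.pt x \<sigma>) (D.XY.pt y \<tau>)) w) \<in> hom T T"
        by (rule D.pairing_hom_right[OF pxy])
      show "(\<lambda>w. D.pairing (D.XY.pt x \<sigma>) (D.pairing (D.XY.pt y \<tau>) w)) \<in> hom T T"
        using hom_compose[OF D.pairing_hom_right[OF py] D.pairing_hom_right[OF px]] by (simp add: comp_def)
      fix z p assume z: "z \<in> carrier B" and "p \<in> carrier Q"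
      then have p: "p \<in> carrier P" by simp
      have \<sigma>\<tau>: "\<sigma> \<otimes>\<^bsub>\<D>\<^esub> \<tau> \<in> carrier \<D>" using bilinear_opD(1)[OF DD.g \<sigma> \<tau>] .
      show "D.pairing (DD.pairing (D.XY.pt x \<sigma>) (D.XY.pt y \<tau>)) (pt z p) = D.pairing (D.XY.pt x \<sigma>) (D.pairing (D.XY.pt y \<tau>) (pt z p))"
        using x y z \<sigma> \<tau> p \<sigma>\<tau> by (simp add: DEnd_mult_apply DEnd_closed B.m_assoc)
    qed
  qed
qed

text \<open>The operators of kind \<open>D\<close> multiply on the left by elements of
  \<open>B\<close>, and composition of left multiplications preserves the order of factors; hence
  products are formed in \<open>B\<close> and not in its opposite.\<close>

lemma DEnd_map_ring_iso:
  assumes bij: "bij_betw (DEnd_map A B R P) (carrier D.XY.T) (carrier \<D>\<^sub>B)"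
  shows "DEnd_map A B R P \<in> ring_iso (tensor_algebra A B \<D>) \<D>\<^sub>B"
  unfolding ring_iso_def
proof (intro CollectI conjI ring_hom_memI)
  show "bij_betw (DEnd_map A B R P) (carrier (tensor_algebra A B \<D>)) (carrier \<D>\<^sub>B)"
    using bij by (simp add: tensor_algebra_simps)
  show "DEnd_map A B R P u \<in> carrier \<D>\<^sub>B" if "u \<in> carrier (tensor_algebra A B \<D>)" for u
    using that DEnd_map_in by (simp add: tensor_algebra_simps)
  show "DEnd_map A B R P (u \<otimes>\<^bsub>tensor_algebra A B \<D>\<^esub> v) = DEnd_map A B R P u \<otimes>\<^bsub>\<D>\<^sub>B\<^esub> DEnd_map A B R P v"
    if "u \<in> carrier (tensor_algebra A B \<D>)" "v \<in> carrier (tensor_algebra A B \<D>)" for u v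
    using that by (auto simp: tensor_algebra_simps DEnd_map_eq DEnd_B_mult pairing_mult intro!: ext)
  show "DEnd_map A B R P (u \<oplus>\<^bsub>tensor_algebra A B \<D>\<^esub> v) = DEnd_map A B R P u \<oplus>\<^bsub>\<D>\<^sub>B\<^esub> DEnd_map A B R P v"
    if "u \<in> carrier (tensor_algebra A B \<D>)" "v \<in> carrier (tensor_algebra A B \<D>)" for u v
    using that DEnd_map_additive by (simp add: tensor_algebra_simps)
  have one: "\<one>\<^bsub>\<D>\<^esub> \<in> carrier \<D>" "\<And>p. p \<in> carrier P \<Longrightarrow> \<one>\<^bsub>\<D>\<^esub> p = p"
    using algebra_module.End_alg_closed(4)[OF eval_algebra_module] by (simp_all add: DEnd_alg_def End_alg_simps)
  have "D.pairing (D.XY.pt \<one>\<^bsub>B\<^esub> \<one>\<^bsub>\<D>\<^esub>) w = w" if w: "w \<in> carrier T" for w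
    by (rule tensor_hom_eqI[where h' = "\<lambda>w. w", OF T.is_group D.pairing_hom_right _ _ w])
      (use one in \<open>auto simp: hom_def\<close>)
  then show "DEnd_map A B R P \<one>\<^bsub>tensor_algebra A B \<D>\<^esub> = \<one>\<^bsub>\<D>\<^sub>B\<^esub>"
    by (auto simp: tensor_algebra_simps DEnd_map_eq DEnd_B_one intro!: ext)
qed

text \<open>The scalar \<open>a\<close> reaches \<open>\<D>\<^sub>B\<close> through two nested
  endomorphism algebras; unfolding both leaves the action of a \<otimes> 1 from B \<otimes>
  R.\<close>

lemma DEnd_B_smult:
  assumes a: "a \<in> carrier A" and f: "f \<in> carrier \<D>\<^sub>B"
  shows "a \<odot>\<^bsub>\<D>\<^sub>B\<^esub> f = (\<lambda>w\<in>carrier T. R.pairing (R.XY.pt (a \<odot>\<^bsub>B\<^esub> \<one>\<^bsub>B\<^esub>) \<one>\<^bsub>R\<^esub>) (f w))"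
proof -
  have "a \<odot>\<^bsub>tensor_algebra A B R\<^esub> \<one>\<^bsub>tensor_algebra A B R\<^esub> = R.XY.pt (a \<odot>\<^bsub>B\<^esub> \<one>\<^bsub>B\<^esub>) \<one>\<^bsub>R\<^esub>"
    using R.XY.tensor_lift_pure[OF R.XY.tensor_group_comm_group R.XY.scalar_balanced[OF a], of "\<one>\<^bsub>B\<^esub>" "\<one>\<^bsub>R\<^esub>"]
    by (simp add: tensor_algebra_simps)
  then show ?thesis
    using hom_in_carrier[OF DEnd_B_D(2)[OF f]] by (auto simp: DEnd_alg_def End_alg_simps intro!: ext)
qed

text \<open>The tensor products formed with \<open>B\<close> and with \<open>opposite B\<close> are
  the same module over \<open>A\<close>, so bijectivity and additivity carry over. What remains is
  that \<open>a\<close> acting on the left factor matches the action of a \<otimes> 1 on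
  values.\<close>

lemma DEnd_map_left_module_iso:
  assumes bij: "bij_betw (DEnd_map A B R P) (carrier D.XY.T) (carrier \<D>\<^sub>B)"
  shows "DEnd_map A B R P \<in> left_module_iso A (tensor_algebra A (opposite B) \<D>) \<D>\<^sub>B"
proof -
  let ?E = "tensor_algebra A (opposite B) \<D>"
  have E: "carrier ?E = carrier D.XY.T" "ring.add ?E = monoid.mult D.XY.T"
    "smult ?E = (\<lambda>a. tensor_lift D.XY.T (\<lambda>b r. D.XY.pt (a \<odot>\<^bsub>B\<^esub> b) r))"
    by (simp_all add: tensor_algebra_simps tensor_opposite)
  have smult: "DEnd_map A B R P (a \<odot>\<^bsub>?E\<^esub> u) = a \<odot>\<^bsub>\<D>\<^sub>B\<^esub> DEnd_map A B R P u"
    if a: "a \<in> carrier A" and u: "u \<in> carrier D.XY.T" for a u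
  proof -
    let ?s = "tensor_lift D.XY.T (\<lambda>b r. D.XY.pt (a \<odot>\<^bsub>B\<^esub> b) r)"
    let ?k = "R.XY.pt (a \<odot>\<^bsub>B\<^esub> \<one>\<^bsub>B\<^esub>) \<one>\<^bsub>R\<^esub>"
    have s_hom: "?s \<in> hom D.XY.T D.XY.T"
      by (rule D.XY.tensor_lift_hom[OF D.XY.tensor_group_comm_group D.XY.scalar_balanced[OF a]])
    have s_pure: "?s (D.XY.pt y \<sigma>) = D.XY.pt (a \<odot>\<^bsub>B\<^esub> y) \<sigma>" if "y \<in> carrier B" "\<sigma> \<in> carrier \<D>" for y \<sigma>
      by (rule D.XY.tensor_lift_pure[OF D.XY.tensor_group_comm_group D.XY.scalar_balanced[OF a] that])
    have k: "?k \<in> carrier R.XY.T" using a by (intro R.XY.pure_closed) auto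
    have "D.pairing (?s u) w = R.pairing ?k (D.pairing u w)" if w: "w \<in> carrier T" for w
    proof (rule D.XY.tensor_hom_eqI[where h = "\<lambda>u. D.pairing (?s u) w", OF T.is_group _ _ _ u])
      show "(\<lambda>u. D.pairing (?s u) w) \<in> hom D.XY.T T"
        using hom_compose[OF s_hom D.pairing_hom_left[OF w]] by (simp add: comp_def)
      show "(\<lambda>u. R.pairing ?k (D.pairing u w)) \<in> hom D.XY.T T"
        using hom_compose[OF D.pairing_hom_left[OF w] R.pairing_hom_right[OF k]] by (simp add: comp_def)
      fix y \<sigma> assume y: "y \<in> carrier B" and \<sigma>: "\<sigma> \<in> carrier \<D>"
      have py: "D.XY.pt y \<sigma> \<in> carrier D.XY.T" "D.XY.pt (a \<odot>\<^bsub>B\<^esub> y) \<sigma> \<in> carrier D.XY.T" using y \<sigma> a by auto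
      have "D.pairing (D.XY.pt (a \<odot>\<^bsub>B\<^esub> y) \<sigma>) w = R.pairing ?k (D.pairing (D.XY.pt y \<sigma>) w)"
      proof (rule tensor_hom_eqI[OF T.is_group D.pairing_hom_right[OF py(2)] _ _ w])
        show "(\<lambda>w. R.pairing ?k (D.pairing (D.XY.pt y \<sigma>) w)) \<in> hom T T"
          using hom_compose[OF D.pairing_hom_right[OF py(1)] R.pairing_hom_right[OF k]] by (simp add: comp_def)
        fix z p assume z: "z \<in> carrier B" and "p \<in> carrier Q"
        then have p: "p \<in> carrier P" by simp
        have "D.pairing (D.XY.pt (a \<odot>\<^bsub>B\<^esub> y) \<sigma>) (pt z p) = pt (a \<odot>\<^bsub>B\<^esub> (y \<otimes>\<^bsub>B\<^esub> z)) (\<sigma> p)"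
          using a y z \<sigma> p by (simp add: B.smult_mult_left)
        moreover have "R.pairing ?k (D.pairing (D.XY.pt y \<sigma>) (pt z p)) = pt (a \<odot>\<^bsub>B\<^esub> (y \<otimes>\<^bsub>B\<^esub> z)) (\<sigma> p)"
          using a y z \<sigma> p by (simp add: B.smult_mult_left DEnd_closed P.smult_one)
        ultimately show "D.pairing (D.XY.pt (a \<odot>\<^bsub>B\<^esub> y) \<sigma>) (pt z p) = R.pairing ?k (D.pairing (D.XY.pt y \<sigma>) (pt z p))"
          by simp
      qed
      then show "D.pairing (?s (D.XY.pt y \<sigma>)) w = R.pairing ?k (D.pairing (D.XY.pt y \<sigma>) w)"
        by (simp only: s_pure[OF y \<sigma>])
    qed
    then show ?thesis
      unfolding DEnd_B_smult[OF a DEnd_map_in[OF u]] E(3)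
      by (auto simp: DEnd_map_eq intro!: ext)
  qed
  show ?thesis
    unfolding left_module_iso_def left_module_hom_def
    using bij DEnd_map_in DEnd_map_additive smult by (auto simp: E(1,2))
qed

end

text \<open>The standard hypotheses are assumed for two element types: \<open>'b\<close> for the
  algebra \<open>B\<close>, and \<open>'a set\<close> for the residue fields, whose elements are
  cosets.\<close>

theorem proposition3p3:
  fixes A :: "'a ring" and R :: "('a, 'r) module" and P :: "('r, 'p) module"
  assumes "dedekind_domain A \<or> field A"
    and "assoc_algebra A R"
    and "left_module R P"
    and "standard_hypotheses TYPE('b) A R P"
    and "standard_hypotheses TYPE('a set) A R P"
    and "\<And>m. maximalideal m A \<Longrightarrow>
      DEnd_map A (residue_algebra A m) R P
          ` carrier (tensor_algebra A (residue_algebra A m) (DEnd_alg R P)) =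
        carrier (DEnd_alg (tensor_algebra A (residue_algebra A m) R)
                          (tensor_module A (residue_algebra A m) R P))"
  shows "\<forall>B :: ('a, 'b) module. assoc_algebra A B \<longrightarrow>
    DEnd_map A B R P \<in>
      left_module_iso A (tensor_algebra A (opposite B) (DEnd_alg R P))
        (DEnd_alg (tensor_algebra A B R) (tensor_module A B R P)) \<inter>
      ring_iso (tensor_algebra A B (DEnd_alg R P))
        (DEnd_alg (tensor_algebra A B R) (tensor_module A B R P))"
proof (intro allI impI)
  fix B :: "('a, 'b) module"
  assume B: "assoc_algebra A B"
  have dom: "domain A"
    using assms(1) by (auto simp: dedekind_domain_def noetherian_domain_def field_def)
  then have cring: "cring A" by (simp add: domain_def)
  interpret algebra_module A R P by (rule algebra_module.intro[OF assms(2,3)])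
  have "free_of_finite_rank A (restrict_scalars R P)"
    using assms(4) by (simp add: standard_hypotheses_def)
  then obtain n e co where based: "based_module A (restrict_scalars R P) n e co"
    using free_of_finite_rank_based[OF restrict_scalars_module] by blast
  interpret based_algebra_module A R P n e co
    by (intro based_algebra_module.intro algebra_module_axioms based)
  \<comment> \<open>The element type of \<open>C\<close> stays general, since residue fields and
    \<open>B\<close> have different ones.\<close>
  have base_changeI: "base_change A R P n e co C"
    if "assoc_algebra A C"
      and "Psi A C R P \<in> left_module_iso A (tensor_algebra A (opposite C) (End_alg R P))
        (End_alg (tensor_algebra A C R) (tensor_module A C R P))" for C :: "('a, 'c) module"
    using that
    by (intro base_change.intro base_change_axioms.intro based_tensor.intro algebra_module_axioms based)
      (auto simp: left_module_iso_def bij_betw_def)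
  have F: "base_change A R P n e co (residue_algebra A m)" if "maximalideal m A" for m
    using assms(5) residue_assoc_algebra[OF cring maximalideal.axioms(1)[OF that]]
    by (intro base_changeI) (auto simp: standard_hypotheses_def)
  interpret base_change A R P n e co B
    using assms(4) B by (intro base_changeI) (auto simp: standard_hypotheses_def)
  have "bij_betw (DEnd_map A B R P) (carrier D.XY.T) (carrier \<D>\<^sub>B)"
  proof (intro bij_DEnd_map exists_dual_system[OF dom])
    fix m x
    assume m: "maximalideal m A" and "x \<in> UNIV \<rightarrow> carrier A"
      and "\<And>\<alpha> c a. \<lbrakk> \<alpha> \<in> carrier \<Lambda>; c < n; a < n \<rbrakk> \<Longrightarrow> R.dot I (gen \<alpha> c a) x \<in> m"
    then show "\<exists>\<sigma>\<in>carrier \<D>. \<forall>p\<in>I. mat \<sigma> p \<ominus>\<^bsub>A\<^esub> x p \<in> m"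
      using assms(6)[OF m] by (intro residue_lift[OF maximalideal.axioms(1)[OF m] F[OF m]]) auto
  qed
  then show "DEnd_map A B R P \<in>
      left_module_iso A (tensor_algebra A (opposite B) (DEnd_alg R P))
        (DEnd_alg (tensor_algebra A B R) (tensor_module A B R P)) \<inter>
      ring_iso (tensor_algebra A B (DEnd_alg R P))
        (DEnd_alg (tensor_algebra A B R) (tensor_module A B R P))"
    using DEnd_map_ring_iso DEnd_map_left_module_iso by blast
qed

end
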